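(* Suppose that $P$ is a prime of $\mathbb{Z}[\zeta]$ over a prime integer $p>3$, where $\zeta=\exp(2\pi\sqrt{-1}/8)$. Then $X_{56}(P)$ is smooth and contains exactly $56$ lines, each of which is obtained by the reduction of a line on $X_{56}$ at $P$. Moreover, the isomorphism $X_{48}\to X_{56}$ given by $(x_1:x_2:x_3:x_4)\mapsto(f_1:f_2:f_3:f_4)$, with the cubic forms $f_1,\dots,f_4\in\mathbb{Z}[\zeta][x_1,x_2,x_3,x_4]$ listed in the context, reduces at $P$ to an isomorphism $X_{48}\otimes\bar{\kappa}_P\to X_{56}(P)$.
   Context: $X_{48}$ is the Fermat quartic $x_1^4+x_2^4+x_3^4+x_4^4=0$. $X_{56}$ is the surface in $\mathbb{P}^3$ over $\mathbb{Q}(\zeta)$ (equivalently, over $\mathbb{C}$) defined by $\Psi=0$, where $$\Psi=y_1^3y_2+y_1y_2^3+y_3^3y_4+y_3y_4^3+(y_1y_4+y_2y_3)\bigl(A(y_1y_3+y_2y_4)+B(y_1y_2-y_3y_4)\bigr),$$ $A=-1-2\zeta-2\zeta^3$, $B=3+A$. For a prime $P$ of $\mathbb{Z}[\zeta]$, $\kappa_P$ is the residue field, $\bar\kappa_P$ an algebraic closure of it, $X_{56}(P)$ is the surface in $\mathbb{P}^3$ over $\bar\kappa_P$ defined by $\Psi \bmod P=0$, and $X_{48}\otimes\bar\kappa_P$ is the surface $x_1^4+x_2^4+x_3^4+x_4^4=0$ over $\bar\kappa_P$. Every line $\lambda$ on $X_{56}$ is defined by $M_\lambda y=0$, where $y=[y_1,y_2,y_3,y_4]^T$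 and $M_\lambda$ is a $2\times4$ matrix in row-reduced echelon form with components in $\mathbb{Z}[\zeta,1/3]$; for $P$ over $p>3$ the reduction of $\lambda$ at $P$ is the line $(M_\lambda\bmod P)\,y=0$ on $X_{56}(P)$. The isomorphism $X_{48}\to X_{56}$ is the one for which the pull-back of the rational function $y_i/y_j$ on $X_{56}$ is the rational function $f_i/f_j$ on $X_{48}$; its reduction at $P$ is the map given in the same way by the reductions $f_1\bmod P,\dots,f_4\bmod P$ (the rational map extended to a morphism). Here $$\begin{aligned}f_1={}&(1+\zeta-\zeta^3)x_1^3+(\zeta+\zeta^2+\zeta^3)x_1^2x_3+(1+\zeta)x_1^2x_4+(-\zeta-\zeta^2-\zeta^3)x_1x_2^2\\&+(-1-\zeta)x_1x_2x_3+(\zeta+\zeta^2)x_1x_2x_4-x_1x_3^2+(\zeta+\zeta^2)x_1x_3x_4-\zeta^3x_1x_4^2\\&+(1-\zeta^2-\zeta^3)x_2^2x_3+(-\zeta-\zeta^2)x_2x_3^2+(\zeta^2+\zeta^3)x_2x_3x_4+\zeta^2x_3^3+x_3x_4^2,\end{aligned}$$ $$\begin{aligned}f_2={}&x_1^3-\zeta^2x_1^2x_3+(-1+\zeta^3)x_1^2x_4-\zeta^2x_1x_2^2+(1-\zeta^3)x_1x_2x_3+(-1-\zeta)x_1x_2x_4\\&+(1+\zeta-\zeta^3)x_1x_3^2+(-\zeta^2-\zeta^3)x_1x_3x_4+(-1-\zeta-\zeta^2)x_1x_4^2+\zeta x_2^2x_3\\&+(\zeta^2+\zeta^3)x_2x_3^2+(1-\zeta^3)x_2x_3x_4+(\zeta+\zeta^2+\zeta^3)x_3^3+(1+\zeta-\zeta^3)x_3x_4^2,\end{aligned}$$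 $$\begin{aligned}f_3={}&(1+\zeta+\zeta^2)x_1^2x_2+(\zeta+\zeta^2+\zeta^3)x_1^2x_4+(-1-\zeta)x_1x_2x_3+(\zeta+\zeta^2)x_1x_2x_4\\&+(-\zeta-\zeta^2)x_1x_3x_4+(\zeta^2+\zeta^3)x_1x_4^2+(1-\zeta^2-\zeta^3)x_2^3+(-\zeta-\zeta^2)x_2^2x_3\\&+(1+\zeta+\zeta^2)x_2^2x_4+\zeta^2x_2x_3^2+(-\zeta^2-\zeta^3)x_2x_3x_4+\zeta^3x_2x_4^2+\zeta^3x_3^2x_4+\zeta x_4^3,\end{aligned}$$ $$\begin{aligned}f_4={}&-\zeta x_1^2x_2+x_1^2x_4+(-1+\zeta^3)x_1x_2x_3+(1+\zeta)x_1x_2x_4+(-\zeta^2-\zeta^3)x_1x_3x_4\\&+(-1+\zeta^3)x_1x_4^2+\zeta^3x_2^3+(-1-\zeta)x_2^2x_3+\zeta x_2^2x_4+(-1-\zeta+\zeta^3)x_2x_3^2\\&+(1-\zeta^3)x_2x_3x_4+(-1+\zeta^2+\zeta^3)x_2x_4^2+(1-\zeta^2-\zeta^3)x_3^2x_4+(-1-\zeta-\zeta^2)x_4^3.\end{aligned}$$ *)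

theory Defs
  imports
    "HOL-Analysis.Analysis"
    "HOL-Library.Poly_Mapping"
    "HOL-Algebra.QuotRing"
    "HOL-Algebra.Algebraic_Closure_Type"
begin

section \<open>Polynomials in four variables\<close>

text \<open>
  The index type is \<^typ>\<open>4\<close>, in which \<open>4 = 0\<close>; so \<open>x $ 1, \<dots>, x $ 4\<close> are the four
  coordinates of \<open>x\<close>, but the built-in order of that type puts the coordinate
  with index 4 first and is never used here.
\<close>

type_synonym 'a poly4 = "(4 \<Rightarrow>\<^sub>0 nat) \<Rightarrow>\<^sub>0 'a"

definition Var :: "4 \<Rightarrow> 'a::comm_ring_1 poly4" where
  "Var i = Poly_Mapping.single (Poly_Mapping.single i 1) 1"

definition Const :: "'a::comm_ring_1 \<Rightarrow> 'a poly4" where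
  "Const c = Poly_Mapping.single 0 c"

definition peval :: "'a::comm_ring_1 poly4 \<Rightarrow> 'a ^ 4 \<Rightarrow> 'a" where
  "peval p x = (\<Sum>m\<in>Poly_Mapping.keys p. Poly_Mapping.lookup p m * (\<Prod>i\<in>UNIV. x $ i ^ Poly_Mapping.lookup m i))"

definition partial :: "4 \<Rightarrow> 'a::comm_ring_1 poly4 \<Rightarrow> 'a poly4" where
  "partial i p = (\<Sum>m\<in>Poly_Mapping.keys p.
     Poly_Mapping.single (m - Poly_Mapping.single i 1)
       (of_nat (Poly_Mapping.lookup m i) * Poly_Mapping.lookup p m))"

definition homogeneous :: "nat \<Rightarrow> 'a::comm_ring_1 poly4 \<Rightarrow> bool" where
  "homogeneous d p \<longleftrightarrow> (\<forall>m\<in>Poly_Mapping.keys p. (\<Sum>i\<in>UNIV. Poly_Mapping.lookup m i) = d)"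

definition pevals :: "(4 \<Rightarrow> 'a::comm_ring_1 poly4) \<Rightarrow> 'a ^ 4 \<Rightarrow> 'a ^ 4" where
  "pevals g x = (\<chi> i. peval (g i) x)"


section \<open>Projective 3-space\<close>

text \<open>Points are the one-dimensional subspaces of \<open>K\<^sup>4\<close>. All varieties below are
  taken over an algebraically closed field and are identified with their sets of points.\<close>

type_synonym 'a point = "('a ^ 4) set"

definition pt :: "'a::field ^ 4 \<Rightarrow> 'a point" where
  "pt x = vec.span {x}"

definition P3 :: "'a::field point set" where
  "P3 = {pt x | x. x \<noteq> 0}"

definition zero_locus :: "'a::field poly4 set \<Rightarrow> 'a point set" where
  "zero_locus S = {q \<in> P3. \<forall>p\<in>S. \<forall>x\<in>q. peval p x = 0}"

definition zariski_closed :: "'a::field point set \<Rightarrow> bool" where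
  "zariski_closed C \<longleftrightarrow> (\<exists>S. (\<forall>p\<in>S. \<exists>d. homogeneous d p) \<and> C = zero_locus S)"

definition zariski_open_in :: "'a::field point set \<Rightarrow> 'a point set \<Rightarrow> bool" where
  "zariski_open_in V U \<longleftrightarrow> (\<exists>C. zariski_closed C \<and> U = V - C)"

definition zariski_dense_in :: "'a::field point set \<Rightarrow> 'a point set \<Rightarrow> bool" where
  "zariski_dense_in V U \<longleftrightarrow> U \<subseteq> V \<and> (\<forall>C. zariski_closed C \<and> U \<subseteq> C \<longrightarrow> V \<subseteq> C)"

abbreviation surface :: "'a::field poly4 \<Rightarrow> 'a point set" where
  "surface p \<equiv> zero_locus {p}"

text \<open>The Jacobian criterion.\<close>

definition smooth_surface :: "'a::field poly4 \<Rightarrow> bool" where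
  "smooth_surface p \<longleftrightarrow>
     (\<forall>x. x \<noteq> 0 \<and> peval p x = 0 \<longrightarrow> (\<exists>i. peval (partial i p) x \<noteq> 0))"

definition proj_line :: "'a::field point set \<Rightarrow> bool" where
  "proj_line l \<longleftrightarrow> (\<exists>H. vec.subspace H \<and> vec.dim H = 2 \<and> l = {q \<in> P3. q \<subseteq> H})"


section \<open>Morphisms\<close>

definition regular_map ::
    "'a::field point set \<Rightarrow> 'a point set \<Rightarrow> ('a point \<Rightarrow> 'a point) \<Rightarrow> bool" where
  "regular_map V W F \<longleftrightarrow> F ` V \<subseteq> W \<and>
     (\<forall>q\<in>V. \<exists>U d g. zariski_open_in V U \<and> q \<in> U \<and> (\<forall>i. homogeneous d (g i)) \<and>
        (\<forall>x. x \<noteq> 0 \<and> pt x \<in> U \<longrightarrow> pevals g x \<noteq> 0 \<and> F (pt x) = pt (pevals g x)))"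

definition isomorphism ::
    "'a::field point set \<Rightarrow> 'a point set \<Rightarrow> ('a point \<Rightarrow> 'a point) \<Rightarrow> bool" where
  "isomorphism V W F \<longleftrightarrow> regular_map V W F \<and>
     (\<exists>G. regular_map W V G \<and> (\<forall>q\<in>V. G (F q) = q) \<and> (\<forall>r\<in>W. F (G r) = r))"

text \<open>\<open>F\<close> extends the rational map \<open>x \<mapsto> (f\<^sub>1(x) : \<dots> : f\<^sub>4(x))\<close> on \<open>V\<close>. The \<open>f\<^sub>i\<close> may have
  common zeros on \<open>V\<close>, but the complement of these is dense, so a regular \<open>F\<close> is determined by the \<open>f\<^sub>i\<close>.\<close>

definition extends_rational_map ::
    "'a::field point set \<Rightarrow> (4 \<Rightarrow> 'a poly4) \<Rightarrow> ('a point \<Rightarrow> 'a point) \<Rightarrow> bool" where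
  "extends_rational_map V f F \<longleftrightarrow>
     (\<exists>d. \<forall>i. homogeneous d (f i)) \<and>
     zariski_dense_in V {pt x | x. x \<noteq> 0 \<and> pt x \<in> V \<and> pevals f x \<noteq> 0} \<and>
     (\<forall>x. x \<noteq> 0 \<and> pt x \<in> V \<and> pevals f x \<noteq> 0 \<longrightarrow> F (pt x) = pt (pevals f x))"

definition isomorphism_given_by ::
    "'a::field point set \<Rightarrow> 'a point set \<Rightarrow> (4 \<Rightarrow> 'a poly4) \<Rightarrow> bool" where
  "isomorphism_given_by V W f \<longleftrightarrow> (\<exists>F. isomorphism V W F \<and> extends_rational_map V f F)"


section \<open>Reduction modulo a prime of \<open>\<int>[\<zeta>]\<close>\<close>

definition zeta :: complex (\<open>\<zeta>\<close>) where
  "\<zeta> = exp (2 * of_real pi * \<i> / 8)"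

definition Zzeta :: "complex set" where
  "Zzeta = range (\<lambda>q :: int poly. poly (map_poly of_int q) \<zeta>)"

definition Zzeta_third :: "complex set" where
  "Zzeta_third = {a / 3 ^ k | a k. a \<in> Zzeta}"

definition Zzeta_ring :: "complex ring" where
  "Zzeta_ring = ring_of_type_algebra\<lparr>carrier := Zzeta\<rparr>"

definition lies_over :: "complex set \<Rightarrow> nat \<Rightarrow> bool" where
  "lies_over P p \<longleftrightarrow> {n :: int. of_int n \<in> P} = {n. int p dvd n}"

definition residue_field :: "complex set \<Rightarrow> complex set ring" where
  "residue_field P = Zzeta_ring Quot P"

text \<open>An algebraic closure of the residue field \<open>\<kappa>\<close> of \<open>P\<close> is a field \<^typ>\<open>'k\<close> together with an
  embedding \<open>\<sigma>\<close> of \<open>\<kappa>\<close>.\<close>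

definition closure_of_residue_field :: "complex set \<Rightarrow> (complex set \<Rightarrow> 'k::field) \<Rightarrow> bool" where
  "closure_of_residue_field P \<sigma> \<longleftrightarrow>
     \<sigma> \<in> ring_hom (residue_field P) ring_of_type_algebra \<and>
     algebraic_closure (ring_of_type_algebra :: 'k ring) (\<sigma> ` carrier (residue_field P))"

definition red :: "complex set \<Rightarrow> (complex set \<Rightarrow> 'k::field) \<Rightarrow> complex \<Rightarrow> 'k" where
  "red P \<sigma> a = \<sigma> (P +>\<^bsub>Zzeta_ring\<^esub> a)"

definition red_third :: "complex set \<Rightarrow> (complex set \<Rightarrow> 'k::field) \<Rightarrow> complex \<Rightarrow> 'k" where
  "red_third P \<sigma> c = (THE d. \<exists>a\<in>Zzeta. \<exists>k. c = a / 3 ^ k \<and> d = red P \<sigma> a / 3 ^ k)"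

definition red_poly :: "complex set \<Rightarrow> (complex set \<Rightarrow> 'k::field) \<Rightarrow> complex poly4 \<Rightarrow> 'k poly4" where
  "red_poly P \<sigma> = Poly_Mapping.map (red P \<sigma>)"

definition red_matrix ::
    "complex set \<Rightarrow> (complex set \<Rightarrow> 'k::field) \<Rightarrow> complex ^ 4 ^ 2 \<Rightarrow> 'k ^ 4 ^ 2" where
  "red_matrix P \<sigma> M = (\<chi> i j. red_third P \<sigma> (M $ i $ j))"

text \<open>Row-reduced echelon form of rank 2 with pivot columns \<open>a < b\<close>. The columns are ordered
  as \<open>1, 2, 3, 4\<close>, hence the passage through \<^typ>\<open>nat\<close>.\<close>

definition rref :: "complex ^ 4 ^ 2 \<Rightarrow> bool" where
  "rref M \<longleftrightarrow> (\<exists>a b :: nat. 1 \<le> a \<and> a < b \<and> b \<le> 4 \<and>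
     M $ 1 $ of_nat a = 1 \<and> M $ 2 $ of_nat b = 1 \<and> M $ 1 $ of_nat b = 0 \<and>
     (\<forall>j\<in>{1..<a}. M $ 1 $ of_nat j = 0) \<and> (\<forall>j\<in>{1..<b}. M $ 2 $ of_nat j = 0))"

definition kernel_line :: "'a::field ^ 4 ^ 2 \<Rightarrow> 'a point set" where
  "kernel_line M = {q \<in> P3. \<forall>y\<in>q. M *v y = 0}"

definition reduction_of_line ::
    "complex set \<Rightarrow> (complex set \<Rightarrow> 'k::field) \<Rightarrow> complex point set \<Rightarrow> 'k point set \<Rightarrow> bool" where
  "reduction_of_line P \<sigma> l l' \<longleftrightarrow>
     (\<exists>M. rref M \<and> (\<forall>i j. M $ i $ j \<in> Zzeta_third) \<and>
          l = kernel_line M \<and> l' = kernel_line (red_matrix P \<sigma> M))"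


section \<open>The quartics and the cubic forms\<close>

definition fermat :: "'a::comm_ring_1 poly4" where
  "fermat = Var 1 ^ 4 + Var 2 ^ 4 + Var 3 ^ 4 + Var 4 ^ 4"

definition coeff_A :: complex where
  "coeff_A = - 1 - 2 * \<zeta> - 2 * \<zeta> ^ 3"

definition coeff_B :: complex where
  "coeff_B = 3 + coeff_A"

definition Psi :: "complex poly4" where
  "Psi = Var 1 ^ 3 * Var 2 + Var 1 * Var 2 ^ 3 + Var 3 ^ 3 * Var 4 + Var 3 * Var 4 ^ 3
     + (Var 1 * Var 4 + Var 2 * Var 3)
       * (Const coeff_A * (Var 1 * Var 3 + Var 2 * Var 4)
          + Const coeff_B * (Var 1 * Var 2 - Var 3 * Var 4))"

definition f1 :: "complex poly4" where
  "f1 =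
     Const (1 + \<zeta> - \<zeta> ^ 3) * Var 1 ^ 3
   + Const (\<zeta> + \<zeta> ^ 2 + \<zeta> ^ 3) * Var 1 ^ 2 * Var 3
   + Const (1 + \<zeta>) * Var 1 ^ 2 * Var 4
   + Const (- \<zeta> - \<zeta> ^ 2 - \<zeta> ^ 3) * Var 1 * Var 2 ^ 2
   + Const (- 1 - \<zeta>) * Var 1 * Var 2 * Var 3
   + Const (\<zeta> + \<zeta> ^ 2) * Var 1 * Var 2 * Var 4
   + Const (- 1) * Var 1 * Var 3 ^ 2
   + Const (\<zeta> + \<zeta> ^ 2) * Var 1 * Var 3 * Var 4
   + Const (- (\<zeta> ^ 3)) * Var 1 * Var 4 ^ 2
   + Const (1 - \<zeta> ^ 2 - \<zeta> ^ 3) * Var 2 ^ 2 * Var 3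
   + Const (- \<zeta> - \<zeta> ^ 2) * Var 2 * Var 3 ^ 2
   + Const (\<zeta> ^ 2 + \<zeta> ^ 3) * Var 2 * Var 3 * Var 4
   + Const (\<zeta> ^ 2) * Var 3 ^ 3
   + Var 3 * Var 4 ^ 2"

definition f2 :: "complex poly4" where
  "f2 =
     Var 1 ^ 3
   + Const (- (\<zeta> ^ 2)) * Var 1 ^ 2 * Var 3
   + Const (- 1 + \<zeta> ^ 3) * Var 1 ^ 2 * Var 4
   + Const (- (\<zeta> ^ 2)) * Var 1 * Var 2 ^ 2
   + Const (1 - \<zeta> ^ 3) * Var 1 * Var 2 * Var 3
   + Const (- 1 - \<zeta>) * Var 1 * Var 2 * Var 4
   + Const (1 + \<zeta> - \<zeta> ^ 3) * Var 1 * Var 3 ^ 2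
   + Const (- (\<zeta> ^ 2) - \<zeta> ^ 3) * Var 1 * Var 3 * Var 4
   + Const (- 1 - \<zeta> - \<zeta> ^ 2) * Var 1 * Var 4 ^ 2
   + Const \<zeta> * Var 2 ^ 2 * Var 3
   + Const (\<zeta> ^ 2 + \<zeta> ^ 3) * Var 2 * Var 3 ^ 2
   + Const (1 - \<zeta> ^ 3) * Var 2 * Var 3 * Var 4
   + Const (\<zeta> + \<zeta> ^ 2 + \<zeta> ^ 3) * Var 3 ^ 3
   + Const (1 + \<zeta> - \<zeta> ^ 3) * Var 3 * Var 4 ^ 2"

definition f3 :: "complex poly4" where
  "f3 =
     Const (1 + \<zeta> + \<zeta> ^ 2) * Var 1 ^ 2 * Var 2
   + Const (\<zeta> + \<zeta> ^ 2 + \<zeta> ^ 3) * Var 1 ^ 2 * Var 4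
   + Const (- 1 - \<zeta>) * Var 1 * Var 2 * Var 3
   + Const (\<zeta> + \<zeta> ^ 2) * Var 1 * Var 2 * Var 4
   + Const (- \<zeta> - \<zeta> ^ 2) * Var 1 * Var 3 * Var 4
   + Const (\<zeta> ^ 2 + \<zeta> ^ 3) * Var 1 * Var 4 ^ 2
   + Const (1 - \<zeta> ^ 2 - \<zeta> ^ 3) * Var 2 ^ 3
   + Const (- \<zeta> - \<zeta> ^ 2) * Var 2 ^ 2 * Var 3
   + Const (1 + \<zeta> + \<zeta> ^ 2) * Var 2 ^ 2 * Var 4
   + Const (\<zeta> ^ 2) * Var 2 * Var 3 ^ 2
   + Const (- (\<zeta> ^ 2) - \<zeta> ^ 3) * Var 2 * Var 3 * Var 4
   + Const (\<zeta> ^ 3) * Var 2 * Var 4 ^ 2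
   + Const (\<zeta> ^ 3) * Var 3 ^ 2 * Var 4
   + Const \<zeta> * Var 4 ^ 3"

definition f4 :: "complex poly4" where
  "f4 =
     Const (- \<zeta>) * Var 1 ^ 2 * Var 2
   + Var 1 ^ 2 * Var 4
   + Const (- 1 + \<zeta> ^ 3) * Var 1 * Var 2 * Var 3
   + Const (1 + \<zeta>) * Var 1 * Var 2 * Var 4
   + Const (- (\<zeta> ^ 2) - \<zeta> ^ 3) * Var 1 * Var 3 * Var 4
   + Const (- 1 + \<zeta> ^ 3) * Var 1 * Var 4 ^ 2
   + Const (\<zeta> ^ 3) * Var 2 ^ 3
   + Const (- 1 - \<zeta>) * Var 2 ^ 2 * Var 3
   + Const \<zeta> * Var 2 ^ 2 * Var 4
   + Const (- 1 - \<zeta> + \<zeta> ^ 3) * Var 2 * Var 3 ^ 2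
   + Const (1 - \<zeta> ^ 3) * Var 2 * Var 3 * Var 4
   + Const (- 1 + \<zeta> ^ 2 + \<zeta> ^ 3) * Var 2 * Var 4 ^ 2
   + Const (1 - \<zeta> ^ 2 - \<zeta> ^ 3) * Var 3 ^ 2 * Var 4
   + Const (- 1 - \<zeta> - \<zeta> ^ 2) * Var 4 ^ 3"

definition cubic_forms :: "4 \<Rightarrow> complex poly4" where
  "cubic_forms i = (if i = 1 then f1 else if i = 2 then f2 else if i = 3 then f3 else f4)"

end

theory Submission
  imports Defs
begin

text \<open>
  Everything except the last section takes place over an arbitrary field with an element \<open>z\<close>
  such that \<open>z\<^sup>4 = - 1\<close> and in which 6 is invertible (the density argument below also uses square
  roots). The complex numbers with \<open>z = \<zeta>\<close>, and an algebraic closure of the residue field with the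
  residue class of \<open>\<zeta>\<close>, are both of this kind, because \<open>P\<close> lies over \<open>p > 3\<close>. Thus each part of the
  theorem is proved once for a general \<open>z\<close>, and what remains is that \<open>\<Psi>\<close>, the cubic forms and the
  matrices of the lines are evaluations at \<open>\<zeta>\<close> of expressions over \<open>\<int>[1/3]\<close>, so that reduction
  replaces \<open>\<zeta>\<close> by its residue class.

  The isomorphism comes from a trilinear form in \<open>k\<close>, \<open>x\<close>, \<open>y\<close>. It is written in two ways, as
  \<open>A(x) y = B(y) x\<close>, with 4 by 4 matrices \<open>A(x)\<close> (\<open>point_matrix\<close>) and \<open>B(y)\<close> (\<open>image_matrix\<close>) of linear
  forms, whose determinants are, up to one and the same unit, the Fermat quartic and the quartic
  \<open>\<Psi>\<close>. A point \<open>x\<close> of the Fermat surface is sent to the kernel of \<open>A(x)\<close>, and a point \<open>y\<close> of the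
  other surface to the kernel of \<open>B(y)\<close>. As \<open>A(x) y = B(y) x\<close>, these maps are inverse to each other
  once all the kernels are one-dimensional, and they are regular because a kernel is then spanned by
  some row of cofactors (\<open>kernel_map_isomorphism\<close>). The cofactors of the last row of \<open>A(x)\<close> are \<open>z\<close>
  times the given cubic forms. That \<open>B(y)\<close> never drops rank by two is an explicit elimination
  (\<open>rank_image_matrix\<close>). It also yields smoothness of \<open>\<Psi> = 0\<close>, since a singular point where the rank
  is three would be carried to a singular point of the Fermat surface (\<open>singular_point_transfer\<close>).
  The cubic forms have common zeros on the Fermat surface, but the other points are dense: a
  polynomial modulo the Fermat quartic is a cubic in \<open>x\<^sub>4\<close> over the polynomials in the other variables,
  and its coefficients are determined on an open set (\<open>fermat_polynomial_vanishes\<close>,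
  \<open>cubics_dense\<close>).

  The lines are described by their row-reduced matrices. The planes \<open>y\<^sub>3 = 0\<close> and \<open>y\<^sub>4 = 0\<close> meet the
  surface in four lines each, so a line that avoids their intersection
  \<open>y\<^sub>3 = y\<^sub>4 = 0\<close> meets one of four lines in either plane; in each of the sixteen
  cases, the remaining conditions leave finitely many possibilities (\<open>chart_classification\<close>). A line that meets
  \<open>y\<^sub>3 = y\<^sub>4 = 0\<close> meets it in one of four points, and a one-variable cubic then determines it. The result
  is a table of 56 matrices with entries in \<open>\<int>[\<zeta>, 1/3]\<close>. That the lines of the table lie on the surface is
  checked by exact arithmetic in \<open>\<int>[\<zeta>]\<close>. That they stay distinct over every field in question follows
  from the norms of differences of entries, which have no prime factors other than 2 and 3.
\<close>

(* Vector components are written with the infix dollar sign, which coefficients of power series share. *)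
no_notation fps_nth (infixl \<open>$\<close> 75)

section \<open>Evaluation, derivatives and degrees of polynomials\<close>

definition mval :: "(4 \<Rightarrow>\<^sub>0 nat) \<Rightarrow> 'a::comm_ring_1 ^ 4 \<Rightarrow> 'a" where
  "mval m x = (\<Prod>i\<in>UNIV. x $ i ^ Poly_Mapping.lookup m i)"

lemma mval_add: "mval (m + n) x = mval m x * mval n x"
  by (simp add: mval_def lookup_add power_add prod.distrib)

lemma sum_single_keys: "(\<Sum>m\<in>Poly_Mapping.keys p. Poly_Mapping.single m (Poly_Mapping.lookup p m)) = p"
proof (rule poly_mapping_eqI)
  fix k
  have "(\<Sum>m\<in>Poly_Mapping.keys p. Poly_Mapping.lookup p m when m = k) = Poly_Mapping.lookup p k"
    by (simp add: when_def in_keys_iff)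
  then show "Poly_Mapping.lookup (\<Sum>m\<in>Poly_Mapping.keys p. Poly_Mapping.single m (Poly_Mapping.lookup p m)) k
      = Poly_Mapping.lookup p k"
    by (simp add: lookup_sum lookup_single)
qed

lemma peval_superset:
  assumes "finite S" "Poly_Mapping.keys p \<subseteq> S"
  shows "peval p x = (\<Sum>m\<in>S. Poly_Mapping.lookup p m * mval m x)"
  unfolding peval_def mval_def using assms
  by (intro sum.mono_neutral_left) (auto simp: in_keys_iff)

lemma peval_add [simp]: "peval (p + q) x = peval p x + peval q x"
proof -
  let ?S = "Poly_Mapping.keys p \<union> Poly_Mapping.keys q"
  have "Poly_Mapping.keys (p + q) \<subseteq> ?S" by (rule keys_add)
  then show ?thesis
    by (simp add: peval_superset[of ?S] lookup_add distrib_right sum.distrib)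
qed

lemma peval_zero [simp]: "peval 0 x = 0" by (simp add: peval_def)

lemma peval_sum [simp]: "peval (sum f A) x = (\<Sum>a\<in>A. peval (f a) x)"
  by (induction A rule: infinite_finite_induct) auto

lemma peval_single: "peval (Poly_Mapping.single m a) x = a * mval m x"
  by (simp add: peval_superset[of "{m}"])

lemma peval_mult [simp]: "peval (p * q) x = peval p x * peval q x"
proof -
  have "p * q = (\<Sum>m\<in>Poly_Mapping.keys p. \<Sum>n\<in>Poly_Mapping.keys q.
      Poly_Mapping.single (m + n) (Poly_Mapping.lookup p m * Poly_Mapping.lookup q n))"
    using sum_single_keys[of p] sum_single_keys[of q]
    by (simp only: mult_single[symmetric] sum_product[symmetric])
  then have "peval (p * q) x = (\<Sum>m\<in>Poly_Mapping.keys p. \<Sum>n\<in>Poly_Mapping.keys q.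
      (Poly_Mapping.lookup p m * mval m x) * (Poly_Mapping.lookup q n * mval n x))"
    by (simp only: peval_sum peval_single mval_add ac_simps)
  then show ?thesis
    by (simp only: sum_product[symmetric] peval_superset[OF finite_keys order_refl])
qed

lemma mval_single: "mval (Poly_Mapping.single i 1) x = x $ i"
proof -
  have "mval (Poly_Mapping.single i 1) x = (\<Prod>j\<in>UNIV. if j = i then x $ i else 1)"
    unfolding mval_def by (intro prod.cong) (auto simp: lookup_single when_def)
  then show ?thesis by simp
qed

lemma peval_Var [simp]: "peval (Var i) x = x $ i"
  unfolding Var_def peval_single mval_single by simp

lemma mval_0 [simp]: "mval 0 x = 1" by (simp add: mval_def)

lemma peval_Const [simp]: "peval (Const c) x = c"
  by (simp add: Const_def peval_single)

lemma Const_0 [simp]: "Const 0 = 0" and Const_1 [simp]: "Const 1 = 1"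
  by (simp_all add: Const_def)

lemma Const_add: "Const (a + b) = Const a + Const b"
  and Const_uminus: "Const (- a) = - Const a"
  and Const_diff: "Const (a - b) = Const a - Const b"
  and Const_mult: "Const (a * b) = Const a * Const b"
  by (simp_all add: Const_def single_add single_uminus single_diff mult_single)

lemma Const_power: "Const (a ^ n) = Const a ^ n"
  by (induction n) (simp_all add: Const_mult)

lemma Const_numeral: "Const (numeral n) = numeral n"
  by (simp add: Const_def)

lemma peval_1 [simp]: "peval 1 x = 1" using peval_Const[of 1] by simp

lemma peval_power [simp]: "peval (p ^ n) x = peval p x ^ n"
  by (induction n) simp_all

lemma peval_uminus [simp]: "peval (- p) x = - peval p x"
proof -
  have "- p = Const (- 1) * p" by (simp add: Const_uminus)
  then show ?thesis by (simp only: peval_mult peval_Const) simp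
qed

lemma peval_diff [simp]: "peval (p - q) x = peval p x - peval q x"
  using peval_add[of p "- q" x] by (simp del: peval_add)

lemma peval_numeral [simp]: "peval (numeral n) x = numeral n"
  using peval_Const[of "numeral n"] by (simp only: Const_numeral)

lemma partial_superset:
  assumes "finite S" "Poly_Mapping.keys p \<subseteq> S"
  shows "partial i p = (\<Sum>m\<in>S. Poly_Mapping.single (m - Poly_Mapping.single i 1)
      (of_nat (Poly_Mapping.lookup m i) * Poly_Mapping.lookup p m))"
  unfolding partial_def using assms
  by (intro sum.mono_neutral_left) (auto simp: in_keys_iff)

lemma partial_add [simp]: "partial i (p + q) = partial i p + partial i q"
proof -
  let ?S = "Poly_Mapping.keys p \<union> Poly_Mapping.keys q"
  have "Poly_Mapping.keys (p + q) \<subseteq> ?S" by (rule keys_add)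
  then show ?thesis
    by (simp add: partial_superset[of ?S] lookup_add distrib_left sum.distrib single_add)
qed

lemma partial_zero [simp]: "partial i 0 = 0" by (simp add: partial_def)

lemma partial_sum: "partial i (sum f A) = (\<Sum>a\<in>A. partial i (f a))"
  by (induction A rule: infinite_finite_induct) auto

lemma partial_single: "partial i (Poly_Mapping.single m a) =
   Poly_Mapping.single (m - Poly_Mapping.single i 1) (of_nat (Poly_Mapping.lookup m i) * a)"
  by (simp add: partial_superset[of "{m}"])

text \<open>
  The Leibniz rule for monomials; \<open>partial_mult\<close> follows by bilinearity. The subtraction of exponents is
  truncated, but only where the factor in front of the monomial vanishes.
\<close>

lemma partial_single_mult:
  "partial i (Poly_Mapping.single m a * Poly_Mapping.single n b) =
     partial i (Poly_Mapping.single m a) * Poly_Mapping.single n b +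
     Poly_Mapping.single m a * partial i (Poly_Mapping.single n b)"
proof -
  have shift: "Poly_Mapping.single (u - Poly_Mapping.single i 1 + v) (of_nat (Poly_Mapping.lookup u i) * c) =
      Poly_Mapping.single (u + v - Poly_Mapping.single i 1) (of_nat (Poly_Mapping.lookup u i) * c)"
    for u v and c :: 'a
  proof (cases "Poly_Mapping.lookup u i = 0")
    case False
    then have "u - Poly_Mapping.single i 1 + v = u + v - Poly_Mapping.single i 1"
      by (intro poly_mapping_eqI) (auto simp: lookup_add lookup_minus lookup_single when_def)
    then show ?thesis by simp
  qed simp
  show ?thesis
    using shift[of m n "a * b"] shift[of n m "a * b"]
    by (simp add: mult_single partial_single lookup_add single_add algebra_simps)
qed

lemma partial_mult [simp]: "partial i (p * q) = partial i p * q + p * partial i q"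
proof -
  let ?s = "\<lambda>r m. Poly_Mapping.single m (Poly_Mapping.lookup r m)"
  have "partial i ((\<Sum>m\<in>Poly_Mapping.keys p. ?s p m) * (\<Sum>n\<in>Poly_Mapping.keys q. ?s q n)) =
     partial i (\<Sum>m\<in>Poly_Mapping.keys p. ?s p m) * (\<Sum>n\<in>Poly_Mapping.keys q. ?s q n)
     + (\<Sum>m\<in>Poly_Mapping.keys p. ?s p m) * partial i (\<Sum>n\<in>Poly_Mapping.keys q. ?s q n)"
    unfolding partial_sum sum_product partial_single_mult sum.distrib ..
  then show ?thesis by (simp only: sum_single_keys)
qed

lemma partial_Const [simp]: "partial i (Const c) = 0"
  by (simp add: Const_def partial_single)

lemma partial_uminus [simp]: "partial i (- p) = - partial i p"
  using partial_add[of i p "- p"] by (simp add: eq_neg_iff_add_eq_0 add.commute del: partial_add)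

lemma partial_diff [simp]: "partial i (p - q) = partial i p - partial i q"
  using partial_add[of i p "- q"] by (simp del: partial_add)

lemma partial_Var [simp]: "partial i (Var j) = (if i = j then 1 else 0)"
  by (auto simp: Var_def partial_single lookup_single when_def)

lemma homogeneous_add: "homogeneous d p \<Longrightarrow> homogeneous d q \<Longrightarrow> homogeneous d (p + q)"
  unfolding homogeneous_def using keys_add[of p q] by blast

lemma homogeneous_mult: "homogeneous d p \<Longrightarrow> homogeneous e q \<Longrightarrow> homogeneous (d + e) (p * q)"
  unfolding homogeneous_def using keys_mult[of p q] by (fastforce simp: lookup_add sum.distrib)

lemma homogeneous_Const: "homogeneous 0 (Const c)"
  by (simp add: homogeneous_def Const_def)

lemma homogeneous_Var: "homogeneous 1 (Var i)"
proof -
  have "(\<Sum>j\<in>UNIV. Poly_Mapping.lookup (Poly_Mapping.single i 1 :: 4 \<Rightarrow>\<^sub>0 nat) j) = (\<Sum>j\<in>UNIV. if j = i then 1 else 0)"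
    by (intro sum.cong) (auto simp: lookup_single when_def)
  then show ?thesis by (simp add: homogeneous_def Var_def)
qed

lemma homogeneous_Const_mult: "homogeneous d p \<Longrightarrow> homogeneous d (Const c * p)"
  using homogeneous_mult[OF homogeneous_Const] by fastforce

lemma homogeneous_uminus: "homogeneous d p \<Longrightarrow> homogeneous d (- p)"
  using homogeneous_Const_mult[of d p "-1"] by (simp add: Const_uminus)

lemma homogeneous_diff: "homogeneous d p \<Longrightarrow> homogeneous d q \<Longrightarrow> homogeneous d (p - q)"
  using homogeneous_add[OF _ homogeneous_uminus] by fastforce

lemma homogeneous_power: "homogeneous d p \<Longrightarrow> homogeneous (n * d) (p ^ n)"
proof (induction n)
  case 0
  show ?case using homogeneous_Const[of 1] by simp
next
  case (Suc n)
  then show ?case using homogeneous_mult[of d p "n * d" "p ^ n"] by simp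
qed

lemma homogeneous_cong: "homogeneous d p \<Longrightarrow> d = e \<Longrightarrow> homogeneous e p" by simp

lemma peval_scale:
  assumes "homogeneous d p"
  shows "peval p (c *s x) = c ^ d * peval p x"
proof -
  have "mval m (c *s x) = c ^ d * mval m x" if "m \<in> Poly_Mapping.keys p" for m
  proof -
    have "(\<Sum>i\<in>UNIV. Poly_Mapping.lookup m i) = d" using assms that by (simp add: homogeneous_def)
    then have "c ^ d = (\<Prod>i\<in>UNIV. c ^ Poly_Mapping.lookup m i)" by (simp add: power_sum[symmetric])
    then show ?thesis by (simp add: mval_def power_mult_distrib prod.distrib)
  qed
  then show ?thesis
    by (simp add: peval_superset[of "Poly_Mapping.keys p"] sum_distrib_left mult.left_commute)
qed

section \<open>Points of projective space\<close>

lemma pt_def': "pt x = {c *s x | c. True}"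
  unfolding pt_def vec.span_singleton by auto

lemma self_in_pt: "x \<in> pt x"
  unfolding pt_def by (rule vec.span_base) simp

lemma pt_in_P3: "x \<noteq> 0 \<Longrightarrow> pt x \<in> P3" by (auto simp: P3_def)

lemma P3_ptE:
  assumes "q \<in> P3" obtains x where "x \<noteq> 0" "q = pt x"
  using assms by (auto simp: P3_def)

lemma pt_in_zero_locus:
  assumes "\<And>p. p \<in> S \<Longrightarrow> \<exists>d. homogeneous d p" "x \<noteq> 0"
  shows "pt x \<in> zero_locus S \<longleftrightarrow> (\<forall>p\<in>S. peval p x = 0)"
proof -
  have "peval p y = 0" if "p \<in> S" "peval p x = 0" "y \<in> pt x" for p y
    using assms(1)[OF that(1)] that(2,3) by (auto simp: pt_def' peval_scale)
  then show ?thesis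
    unfolding zero_locus_def using pt_in_P3[OF assms(2)] self_in_pt[of x] by auto
qed

lemma pt_in_surface: "homogeneous d p \<Longrightarrow> x \<noteq> 0 \<Longrightarrow> pt x \<in> surface p \<longleftrightarrow> peval p x = 0"
  by (subst pt_in_zero_locus) auto

lemma surface_ptE:
  assumes "q \<in> surface p" obtains x where "x \<noteq> 0" "q = pt x" "peval p x = 0"
  using assms unfolding zero_locus_def by (auto elim: P3_ptE intro: self_in_pt)

section \<open>Adjugates of 4 by 4 matrices\<close>

lemma idx4_neq: "(1::4) \<noteq> 2" "(1::4) \<noteq> 3" "(1::4) \<noteq> 4" "(2::4) \<noteq> 1" "(2::4) \<noteq> 3" "(2::4) \<noteq> 4"
  "(3::4) \<noteq> 1" "(3::4) \<noteq> 2" "(3::4) \<noteq> 4" "(4::4) \<noteq> 1" "(4::4) \<noteq> 2" "(4::4) \<noteq> 3"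
  by simp_all

text \<open>
  Laplace expansion of the determinant along the first two rows. With indices in type \<open>4\<close> and
  entries in an arbitrary commutative ring, the same expression serves for matrices of scalars and for
  matrices of polynomials.
\<close>

definition det4 :: "(4 \<Rightarrow> 4 \<Rightarrow> 'a::comm_ring_1) \<Rightarrow> 'a" where
  "det4 A = (let m = \<lambda>j k. A 1 j * A 2 k - A 1 k * A 2 j; n = \<lambda>j k. A 3 j * A 4 k - A 3 k * A 4 j
     in m 1 2 * n 3 4 - m 1 3 * n 2 4 + m 1 4 * n 2 3 + m 2 3 * n 1 4 - m 2 4 * n 1 3 + m 3 4 * n 1 2)"

definition unit_row :: "4 \<Rightarrow> 4 \<Rightarrow> 'a::comm_ring_1" where
  "unit_row j i = (if i = j then 1 else 0)"

text \<open>
  Replacing a row by a unit row builds the sign into the cofactor.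
\<close>

definition cofactor :: "(4 \<Rightarrow> 4 \<Rightarrow> 'a::comm_ring_1) \<Rightarrow> 4 \<Rightarrow> 4 \<Rightarrow> 'a" where
  "cofactor A k j = det4 (A(k := unit_row j))"

lemma cofactor_expansion: "(\<Sum>j\<in>UNIV. A k j * cofactor A l j) = (if k = l then det4 A else 0)"
proof -
  have "\<forall>k l. (\<Sum>j\<in>UNIV. A k j * cofactor A l j) = (if k = l then det4 A else 0)"
    unfolding forall_4 cofactor_def sum_4 det4_def Let_def
    by (simp add: unit_row_def idx4_neq) (simp add: algebra_simps)
  then show ?thesis by blast
qed

lemma cofactor_transpose: "cofactor (\<lambda>i j. A j i) k j = cofactor A j k"
proof -
  have "\<forall>k j. cofactor (\<lambda>i j. A j i) k j = cofactor A j k"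
    unfolding forall_4 cofactor_def det4_def Let_def
    by (simp add: unit_row_def idx4_neq) (simp add: algebra_simps)
  then show ?thesis by blast
qed

lemma det4_transpose: "det4 (\<lambda>i j. A j i) = det4 A"
  unfolding det4_def Let_def by (simp add: algebra_simps)

lemma cofactor_expansion_column: "(\<Sum>k\<in>UNIV. A k j * cofactor A k l) = (if j = l then det4 A else 0)"
  using cofactor_expansion[of "\<lambda>i j. A j i" j l]
  unfolding cofactor_transpose[of A] det4_transpose[of A] .

lemma det4_row_expansion: "det4 (A(k := v)) = (\<Sum>j\<in>UNIV. v j * cofactor A k j)"
proof -
  have "cofactor (A(k := v)) k j = cofactor A k j" for j by (simp add: cofactor_def)
  then show ?thesis using cofactor_expansion[of "A(k := v)" k k] by simp
qed

lemma sum_unit_row: "(\<Sum>l\<in>UNIV. (a * unit_row i l - b * unit_row j l) * u l) = a * u i - b * u j"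
proof -
  have "(\<Sum>l\<in>UNIV. unit_row m l * u l) = u m" for m
  proof -
    have "(\<Sum>l\<in>UNIV. unit_row m l * u l) = (\<Sum>l\<in>UNIV. if l = m then u l else 0)"
      by (intro sum.cong) (auto simp: unit_row_def)
    then show ?thesis by simp
  qed
  then show ?thesis
    by (simp only: left_diff_distrib sum_subtractf mult.assoc sum_distrib_left[symmetric])
qed

lemma det4_eq_0:
  fixes A :: "4 \<Rightarrow> 4 \<Rightarrow> 'a::field"
  assumes ker: "\<And>k. (\<Sum>j\<in>UNIV. A k j * u j) = 0" and "u l \<noteq> 0"
  shows "det4 A = 0"
proof -
  have "det4 A * u l = (\<Sum>j\<in>UNIV. (if j = l then det4 A else 0) * u j)"
  proof -
    have "(\<Sum>j\<in>UNIV. (if j = l then det4 A else 0) * u j) = (\<Sum>j\<in>UNIV. if j = l then det4 A * u j else 0)"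
      by (intro sum.cong) auto
    then show ?thesis by simp
  qed
  also have "\<dots> = (\<Sum>j\<in>UNIV. \<Sum>k\<in>UNIV. A k j * cofactor A k l * u j)"
    by (simp only: cofactor_expansion_column[symmetric] sum_distrib_right)
  also have "\<dots> = (\<Sum>k\<in>UNIV. \<Sum>j\<in>UNIV. A k j * cofactor A k l * u j)"
    by (rule sum.swap)
  also have "\<dots> = (\<Sum>k\<in>UNIV. cofactor A k l * (\<Sum>j\<in>UNIV. A k j * u j))"
    unfolding sum_distrib_left by (intro sum.cong refl) (simp only: ac_simps)
  also have "\<dots> = 0" using ker by simp
  finally show ?thesis using assms(2) by simp
qed

text \<open>
  If \<open>A\<close> kills \<open>u\<close>, then each row of cofactors is proportional to \<open>u\<close>. The matrix in which row \<open>k\<close> is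
  replaced by \<open>u\<^sub>j e\<^sub>i - u\<^sub>i e\<^sub>j\<close> still kills \<open>u\<close>, so its determinant vanishes; expansion along
  that row gives the identity.
\<close>

lemma cofactor_parallel:
  fixes A :: "4 \<Rightarrow> 4 \<Rightarrow> 'a::field"
  assumes "\<And>k. (\<Sum>j\<in>UNIV. A k j * u j) = 0"
  shows "cofactor A k i * u j = cofactor A k j * u i"
proof (cases "\<exists>l. u l \<noteq> 0")
  case True
  then obtain l where l: "u l \<noteq> 0" ..
  let ?v = "\<lambda>l. u j * unit_row i l - u i * unit_row j l"
  have "(\<Sum>l\<in>UNIV. (A(k := ?v)) m l * u l) = 0" for m
  proof (cases "m = k")
    case True
    have "(\<Sum>l\<in>UNIV. (A(k := ?v)) m l * u l) = (\<Sum>l\<in>UNIV. ?v l * u l)"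
      using True by simp
    also have "\<dots> = u j * u i - u i * u j" by (rule sum_unit_row)
    finally show ?thesis by (simp only: mult.commute diff_self)
  qed (use assms in simp)
  then have "det4 (A(k := ?v)) = 0" using l by (rule det4_eq_0)
  then show ?thesis
    by (simp only: det4_row_expansion sum_unit_row) (simp add: mult.commute)
qed simp

lemma cofactor_parallel_column:
  fixes A :: "4 \<Rightarrow> 4 \<Rightarrow> 'a::field"
  assumes "\<And>j. (\<Sum>k\<in>UNIV. w k * A k j) = 0"
  shows "cofactor A k j * w l = cofactor A l j * w k"
proof -
  have "(\<Sum>i\<in>UNIV. A i m * w i) = 0" for m
    using assms[of m] by (simp only: mult.commute)
  then show ?thesis
    using cofactor_parallel[of "\<lambda>i j. A j i" w j k l] unfolding cofactor_transpose[of A] by blast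
qed

text \<open>
  Jacobi's formula for the derivative of a determinant.
\<close>

lemma partial_det4:
  "partial i (det4 A) = (\<Sum>k\<in>UNIV. \<Sum>j\<in>UNIV. cofactor A k j * partial i (A k j))"
  unfolding cofactor_def sum_4 det4_def Let_def
  by (simp add: unit_row_def idx4_neq) (simp add: algebra_simps)

lemma peval_det4: "peval (det4 A) x = det4 (\<lambda>k j. peval (A k j) x)"
  by (simp add: det4_def Let_def)

lemma peval_cofactor: "peval (cofactor A k j) x = cofactor (\<lambda>k j. peval (A k j) x) k j"
  unfolding cofactor_def peval_det4
  by (rule arg_cong[of _ _ det4]) (auto simp: unit_row_def fun_eq_iff)

lemma homogeneous_cofactor:
  assumes "\<And>k j. homogeneous 1 (A k j)"
  shows "homogeneous 3 (cofactor A k j)"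
proof -
  have 2: "homogeneous 2 (A a b * A c d - A e f * A g h)" for a b c d e f g h
    using homogeneous_diff[OF homogeneous_mult[OF assms[of a b] assms[of c d]] homogeneous_mult[OF assms[of e f] assms[of g h]]]
    by (simp add: numeral_2_eq_2)
  have 3: "homogeneous 3 (A a b * (A a' b' * A c d - A e f * A g h))"  "homogeneous 3 ((A a' b' * A c d - A e f * A g h) * A a b)" for a b a' b' c d e f g h
    using homogeneous_cong[OF homogeneous_mult[OF assms[of a b] 2[of a' b' c d e f g h]], of 3] homogeneous_cong[OF homogeneous_mult[OF 2[of a' b' c d e f g h] assms[of a b]], of 3] by simp_all
  have "\<forall>k j. homogeneous 3 (cofactor A k j)"
    unfolding forall_4 cofactor_def det4_def Let_def
    by (simp add: unit_row_def idx4_neq) (intro conjI homogeneous_add homogeneous_diff homogeneous_uminus 3)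
  then show ?thesis by blast
qed

section \<open>The kernel map of a singular matrix of linear forms\<close>

definition apply4 :: "(4 \<Rightarrow> 4 \<Rightarrow> 'a::comm_ring_1) \<Rightarrow> 'a ^ 4 \<Rightarrow> 4 \<Rightarrow> 'a" where
  "apply4 A y k = (\<Sum>j\<in>UNIV. A k j * y $ j)"

lemma apply4_axis: "apply4 A (axis j 1) k = A k j"
proof -
  have "apply4 A (axis j 1) k = (\<Sum>i\<in>UNIV. if i = j then A k i else 0)"
    unfolding apply4_def by (intro sum.cong) (auto simp: axis_def)
  then show ?thesis by simp
qed

text \<open>
  For a matrix \<open>A(x)\<close> of linear forms, the kernel depends only on the point spanned by \<open>x\<close>; a
  projective point is a line in \<open>K\<^sup>4\<close>, so when the kernel is one-dimensional it is itself a point.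
\<close>

definition kernel_map :: "('a::field ^ 4 \<Rightarrow> 4 \<Rightarrow> 4 \<Rightarrow> 'a) \<Rightarrow> 'a point \<Rightarrow> 'a point" where
  "kernel_map A q = {y. \<forall>x\<in>q. apply4 (A x) y = (\<lambda>k. 0)}"

text \<open>
  A nonzero cofactor forces rank three: both vectors of the kernel are proportional to the same row
  of cofactors.
\<close>

lemma kernel_eq_pt:
  fixes y :: "'a::field ^ 4"
  assumes "cofactor A k i \<noteq> 0" "y \<noteq> 0" "apply4 A y = (\<lambda>k. 0)"
  shows "{y'. apply4 A y' = (\<lambda>k. 0)} = pt y"
proof (intro equalityI subsetI)
  fix y' assume "y' \<in> pt y"
  then obtain c where "y' = c *s y" by (auto simp: pt_def')
  then have "apply4 A y' k = c * apply4 A y k" for k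
    by (simp add: apply4_def sum_distrib_left mult.left_commute)
  then show "y' \<in> {y'. apply4 A y' = (\<lambda>k. 0)}" using assms(3) by (simp add: fun_eq_iff)
next
  fix y' assume "y' \<in> {y'. apply4 A y' = (\<lambda>k. 0)}"
  then have y': "(\<Sum>j\<in>UNIV. A k j * y' $ j) = 0" for k by (simp add: apply4_def fun_eq_iff)
  have y: "(\<Sum>j\<in>UNIV. A k j * y $ j) = 0" for k using assms(3) by (simp add: apply4_def fun_eq_iff)
  let ?c = "cofactor A k"
  have e: "?c i * y $ j = ?c j * y $ i" "?c i * y' $ j = ?c j * y' $ i" for j
    by (rule cofactor_parallel[OF y]) (rule cofactor_parallel[OF y'])
  have yi: "y $ i \<noteq> 0"
  proof
    assume "y $ i = 0"
    then have "y $ j = 0" for j using e(1)[of j] assms(1) by simp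
    then show False using assms(2) by (simp add: vec_eq_iff)
  qed
  define c where "c = y' $ i / y $ i"
  have "y' = c *s y"
    unfolding vec_eq_iff
  proof
    fix j
    have "?c i * (y' $ j * y $ i) = (?c i * y' $ j) * y $ i" by (simp only: mult.assoc)
    also have "\<dots> = (?c j * y $ i) * y' $ i" unfolding e(2)[of j] by (simp only: ac_simps)
    also have "\<dots> = ?c i * (y' $ i * y $ j)" unfolding e(1)[of j, symmetric] by (simp only: ac_simps)
    finally have "y' $ j * y $ i = y' $ i * y $ j" using assms(1) by simp
    then show "y' $ j = (c *s y) $ j"
      using yi by (simp add: c_def nonzero_eq_divide_eq)
  qed
  then show "y' \<in> pt y" unfolding pt_def' by blast
qed

lemma cofactor_row_in_kernel:
  assumes "det4 A = 0"
  shows "apply4 A (\<chi> j. cofactor A k j) = (\<lambda>k. 0)"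
  using assms cofactor_expansion[where A = A and l = k] by (auto simp: apply4_def fun_eq_iff)

text \<open>
  A trilinear form read in two ways. The polynomials \<open>p\<close> and \<open>q\<close> are the determinants of the two
  matrices of linear forms, up to a common factor, and \<open>rank_A\<close> says that the kernel of \<open>A(x)\<close> is at
  most one-dimensional. The matrix \<open>Ap\<close> consists of the linear forms whose values are the entries of
  \<open>A\<close>.
\<close>

locale determinantal_pair =
  fixes A B :: "'a::field ^ 4 \<Rightarrow> 4 \<Rightarrow> 4 \<Rightarrow> 'a" and Ap :: "4 \<Rightarrow> 4 \<Rightarrow> 'a poly4"
    and p q :: "'a poly4" and c :: 'a and d e :: nat
  assumes Ap: "\<And>k j. homogeneous 1 (Ap k j)" "\<And>x k j. peval (Ap k j) x = A x k j"
    and pairing: "\<And>x y. apply4 (A x) y = apply4 (B y) x"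
    and det_A: "\<And>x. det4 (A x) = c * peval p x" and det_B: "\<And>y. det4 (B y) = c * peval q y"
    and c_nz: "c \<noteq> 0" and hom_p: "homogeneous d p" and hom_q: "homogeneous e q"
    and rank_A: "\<And>x. x \<noteq> 0 \<Longrightarrow> \<exists>k j. cofactor (A x) k j \<noteq> 0"
begin

lemma kernel_map_pt: "kernel_map A (pt x) = {y. apply4 (A x) y = (\<lambda>k. 0)}"
proof -
  have "apply4 (A (r *s x)) y k = r * apply4 (A x) y k" for r y k
    unfolding pairing by (simp add: apply4_def sum_distrib_left mult.left_commute)
  then show ?thesis
    using self_in_pt[of x] by (force simp: kernel_map_def pt_def' fun_eq_iff)
qed

lemma kernel_map_eq_pt:
  assumes "x \<noteq> 0" "y \<noteq> 0" "apply4 (A x) y = (\<lambda>k. 0)"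
  shows "kernel_map A (pt x) = pt y"
  using rank_A[OF assms(1)] kernel_eq_pt[OF _ assms(2,3)] by (auto simp: kernel_map_pt)

lemma cofactor_row:
  assumes "x \<noteq> 0" "peval p x = 0" "pevals (\<lambda>j. cofactor Ap k j) x \<noteq> 0"
  shows "kernel_map A (pt x) = pt (pevals (\<lambda>j. cofactor Ap k j) x)"
proof (rule kernel_map_eq_pt[OF assms(1,3)])
  have "pevals (\<lambda>j. cofactor Ap k j) x = (\<chi> j. cofactor (A x) k j)"
    by (simp add: pevals_def peval_cofactor Ap(2))
  then show "apply4 (A x) (pevals (\<lambda>j. cofactor Ap k j) x) = (\<lambda>k. 0)"
    using assms(2) cofactor_row_in_kernel[of "A x" k] by (simp add: det_A)
qed

lemma nonzero_row:
  assumes "x \<noteq> 0" obtains k where "pevals (\<lambda>j. cofactor Ap k j) x \<noteq> 0"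
proof -
  obtain k j where "cofactor (A x) k j \<noteq> 0" using rank_A[OF assms] by blast
  then have "pevals (\<lambda>j. cofactor Ap k j) x $ j \<noteq> 0" by (simp add: pevals_def peval_cofactor Ap(2))
  then have "pevals (\<lambda>j. cofactor Ap k j) x \<noteq> 0" by (metis zero_index)
  then show ?thesis by (rule that)
qed

text \<open>
  A vector \<open>y\<close> in the kernel of \<open>A(x)\<close> satisfies \<open>B(y) x = 0\<close> as well, so \<open>B(y)\<close> is singular and \<open>y\<close>
  lies on \<open>q = 0\<close>.
\<close>

lemma kernel_map_cases:
  assumes "r \<in> surface p"
  obtains x y where "x \<noteq> 0" "y \<noteq> 0" "r = pt x" "kernel_map A r = pt y" "peval p x = 0" "peval q y = 0"
    "apply4 (A x) y = (\<lambda>k. 0)"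
proof -
  obtain x where x: "x \<noteq> 0" "r = pt x" "peval p x = 0" using surface_ptE[OF assms] .
  obtain k where k: "pevals (\<lambda>j. cofactor Ap k j) x \<noteq> 0" using nonzero_row[OF x(1)] .
  define y where "y = pevals (\<lambda>j. cofactor Ap k j) x"
  have F: "kernel_map A r = pt y" using cofactor_row[OF x(1,3) k] x(2) y_def by simp
  then have Ay: "apply4 (A x) y = (\<lambda>k. 0)" using self_in_pt[of y] kernel_map_pt[of x] x(2) by auto
  obtain l where "x $ l \<noteq> 0" using x(1) by (auto simp: vec_eq_iff)
  then have "det4 (B y) = 0"
    using Ay by (intro det4_eq_0[of _ "\<lambda>j. x $ j"]) (auto simp: pairing apply4_def fun_eq_iff)
  then have "peval q y = 0" using c_nz by (simp add: det_B)
  then show ?thesis using that x F k Ay y_def by blast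
qed

text \<open>
  Near each point, some row of cofactors is nonzero, and the cubic forms in this row compute the map.
\<close>

lemma kernel_map_regular: "regular_map (surface p) (surface q) (kernel_map A)"
  unfolding regular_map_def
proof (intro conjI ballI)
  show "kernel_map A ` surface p \<subseteq> surface q"
  proof (rule image_subsetI)
    fix r assume "r \<in> surface p"
    then show "kernel_map A r \<in> surface q"
      by (rule kernel_map_cases) (simp add: pt_in_surface[OF hom_q])
  qed
  fix r assume r: "r \<in> surface p"
  obtain x where x: "x \<noteq> 0" "r = pt x" "peval p x = 0" using surface_ptE[OF r] .
  obtain k where k: "pevals (\<lambda>j. cofactor Ap k j) x \<noteq> 0" using nonzero_row[OF x(1)] .
  let ?g = "\<lambda>j. cofactor Ap k j"
  let ?U = "surface p - zero_locus (range ?g)"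
  have hom: "homogeneous 3 (?g j)" for j by (rule homogeneous_cofactor) (rule Ap(1))
  have U: "pt x \<in> ?U \<longleftrightarrow> peval p x = 0 \<and> pevals ?g x \<noteq> 0" if "x \<noteq> 0" for x
  proof -
    have "pt x \<in> zero_locus (range ?g) \<longleftrightarrow> (\<forall>g\<in>range ?g. peval g x = 0)"
      by (rule pt_in_zero_locus[OF _ that]) (use hom in blast)
    then show ?thesis
      using pt_in_surface[OF hom_p that] by (auto simp: pevals_def vec_eq_iff)
  qed
  have "zariski_closed (zero_locus (range ?g))"
    unfolding zariski_closed_def using hom by blast
  then have "zariski_open_in (surface p) ?U"
    unfolding zariski_open_in_def by blast
  moreover have "r \<in> ?U" using U[OF x(1)] x k by simp
  moreover have "\<forall>x. x \<noteq> 0 \<and> pt x \<in> ?U \<longrightarrow> pevals ?g x \<noteq> 0 \<and> kernel_map A (pt x) = pt (pevals ?g x)"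
    using U cofactor_row by metis
  ultimately show "\<exists>U d g. zariski_open_in (surface p) U \<and> r \<in> U \<and> (\<forall>i. homogeneous d (g i)) \<and>
        (\<forall>x. x \<noteq> 0 \<and> pt x \<in> U \<longrightarrow> pevals g x \<noteq> 0 \<and> kernel_map A (pt x) = pt (pevals g x))"
    using hom by (intro exI[of _ ?U] exI[of _ "3::nat"] exI[of _ ?g] conjI allI) simp_all
qed

end

text \<open>
  The relation \<open>A(x) y = B(y) x = 0\<close> is symmetric, so both kernel maps read off the same
  correspondence and are inverse to each other.
\<close>

lemma kernel_map_isomorphism:
  assumes "determinantal_pair A B Ap p q c d e" "determinantal_pair B A Bp q p c e d"
  shows "isomorphism (surface p) (surface q) (kernel_map A)"
proof -
  interpret AB: determinantal_pair A B Ap p q c d e by fact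
  interpret BA: determinantal_pair B A Bp q p c e d by fact
  have "kernel_map B (kernel_map A r) = r" if "r \<in> surface p" for r
  proof (rule AB.kernel_map_cases[OF that])
    fix x y
    assume "x \<noteq> 0" "y \<noteq> 0" "r = pt x" "kernel_map A r = pt y" "apply4 (A x) y = (\<lambda>k. 0)"
    then show ?thesis using BA.kernel_map_eq_pt[of y x] by (simp add: BA.pairing)
  qed
  moreover have "kernel_map A (kernel_map B r) = r" if "r \<in> surface q" for r
  proof (rule BA.kernel_map_cases[OF that])
    fix y x
    assume "y \<noteq> 0" "x \<noteq> 0" "r = pt y" "kernel_map B r = pt x" "apply4 (B y) x = (\<lambda>k. 0)"
    then show ?thesis using AB.kernel_map_eq_pt[of x y] by (simp add: AB.pairing)
  qed
  ultimately show ?thesis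
    unfolding isomorphism_def using AB.kernel_map_regular BA.kernel_map_regular by blast
qed

lemma mult_swap: "(a::'a::field) * b = c * d \<Longrightarrow> a * (b * t) = c * (t * d)"
  by (simp only: mult.assoc[symmetric]) (simp only: ac_simps)

lemma mult_rotate: "(a::'a::field) * y = b * z \<Longrightarrow> b * w = c * v \<Longrightarrow> (y * w) * (a * t) = c * (v * (t * z))"
proof -
  assume 1: "a * y = b * z" and 2: "b * w = c * v"
  have "(y * w) * (a * t) = (a * y) * w * t" by (simp only: ac_simps)
  also have "\<dots> = (b * w) * z * t" unfolding 1 by (simp only: ac_simps)
  also have "\<dots> = c * (v * (t * z))" unfolding 2 by (simp only: ac_simps)
  finally show ?thesis .
qed

text \<open>
  Suppose that \<open>y\<close> is a singular point of \<open>q = det B\<close> at which \<open>B\<close> has rank three. Then the adjugate of \<open>B(y)\<close>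
  is, up to a scalar, the product of a vector \<open>x\<close> with \<open>B(y) x = 0\<close> and a covector \<open>w\<close> with
  \<open>w B(y) = 0\<close>. By Jacobi's formula, the derivatives of \<open>q\<close> at \<open>y\<close> are the numbers
  \<open>w B(e\<^sub>j) x = w A(x) e\<^sub>j\<close>, so \<open>w A(x) = 0\<close>. Together with \<open>A(x) y = B(y) x = 0\<close> this makes the adjugate
  of \<open>A(x)\<close> proportional to \<open>y w\<close> (possibly zero), and the derivatives of \<open>p\<close> at \<open>x\<close> are multiples of
  \<open>w A(e\<^sub>i) y = w B(y) e\<^sub>i = 0\<close>. Hence \<open>x\<close> is a singular point of \<open>p\<close>.
\<close>

lemma singular_point_transfer:
  fixes x y :: "'a::field ^ 4" and p q :: "'a poly4"
  assumes pair: "\<And>x y. apply4 (A x) y = apply4 (B y) x"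
    and Bp: "\<And>x k j. peval (Bp k j) x = B x k j"
    and dB: "\<And>i x k j. peval (partial i (Bp k j)) x = B (axis i 1) k j"
    and Ap: "\<And>x k j. peval (Ap k j) x = A x k j"
    and dA: "\<And>i x k j. peval (partial i (Ap k j)) x = A (axis i 1) k j"
    and det_A: "det4 Ap = Const c * p" and det_B: "det4 Bp = Const c * q" and c: "c \<noteq> 0"
    and smooth: "smooth_surface p"
    and rank: "\<And>y. y \<noteq> 0 \<Longrightarrow> \<exists>k i. cofactor (B y) k i \<noteq> 0"
  shows "smooth_surface q"
  unfolding smooth_surface_def
proof (intro allI impI; rule ccontr)
  fix y :: "'a ^ 4"
  assume y: "y \<noteq> 0 \<and> peval q y = 0" and "\<not> (\<exists>j. peval (partial j q) y \<noteq> 0)"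
  then have sing: "peval (partial j q) y = 0" for j by blast
  obtain b a where ab: "cofactor (B y) b a \<noteq> 0" using rank y by blast
  have detB: "det4 (B y) = 0"
    using arg_cong[OF det_B, of "\<lambda>r. peval r y"] y by (simp add: peval_det4 Bp)
  define x :: "'a ^ 4" where "x = (\<chi> i. cofactor (B y) b i)"
  define w where "w k = cofactor (B y) k a" for k
  have x0: "x \<noteq> 0" using ab by (auto simp: x_def vec_eq_iff)
  have Bx: "apply4 (B y) x = (\<lambda>k. 0)" unfolding x_def by (rule cofactor_row_in_kernel[OF detB])
  have Bx': "(\<Sum>j\<in>UNIV. B y k j * x $ j) = 0" for k using Bx by (simp add: apply4_def fun_eq_iff)
  have wB: "(\<Sum>k\<in>UNIV. w k * B y k i) = 0" for i
    using cofactor_expansion_column[where A = "B y" and j = i and l = a] detB by (simp add: w_def mult.commute)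
  have wA: "(\<Sum>k\<in>UNIV. w k * A x k j) = 0" for j
  proof -
    have "0 = peval (partial j (det4 Bp)) y"
      using sing[of j] by (simp add: det_B)
    also have "\<dots> = (\<Sum>k\<in>UNIV. \<Sum>i\<in>UNIV. cofactor (B y) k i * B (axis j 1) k i)"
      by (simp add: partial_det4 peval_cofactor Bp dB)
    finally have "0 = cofactor (B y) b a * (\<Sum>k\<in>UNIV. \<Sum>i\<in>UNIV. cofactor (B y) k i * B (axis j 1) k i)"
      by simp
    also have "\<dots> = (\<Sum>k\<in>UNIV. \<Sum>i\<in>UNIV. w k * (B (axis j 1) k i * x $ i))"
    proof -
      have h: "cofactor (B y) b a * (cofactor (B y) k i * t) = w k * (t * x $ i)" for k i t
      proof -
        have "cofactor (B y) b a * cofactor (B y) k i = w k * x $ i"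
          using cofactor_parallel[where A = "B y" and k = k and i = i and j = a and u = "\<lambda>j. x $ j", OF Bx']
          by (simp add: w_def x_def mult.commute)
        then show ?thesis by (rule mult_swap)
      qed
      show ?thesis unfolding sum_distrib_left h ..
    qed
    also have "\<dots> = (\<Sum>k\<in>UNIV. w k * apply4 (A x) (axis j 1) k)"
      unfolding pair unfolding apply4_def sum_distrib_left ..
    also have "\<dots> = (\<Sum>k\<in>UNIV. w k * A x k j)"
      by (simp only: apply4_axis)
    finally show ?thesis by simp
  qed
  have Ay: "(\<Sum>j\<in>UNIV. A x k j * y $ j) = 0" for k
    using Bx by (simp add: pair[symmetric]) (simp add: apply4_def fun_eq_iff)
  obtain l where l: "y $ l \<noteq> 0" using y by (auto simp: vec_eq_iff)
  have "det4 (A x) = 0" by (rule det4_eq_0[OF Ay l])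
  then have "peval p x = 0"
    using arg_cong[OF det_A, of "\<lambda>r. peval r x"] c by (simp add: peval_det4 Ap)
  then obtain i where i: "peval (partial i p) x \<noteq> 0"
    using smooth x0 unfolding smooth_surface_def by blast
  have "c * peval (partial i p) x = peval (partial i (det4 Ap)) x" by (simp add: det_A)
  also have "\<dots> = (\<Sum>k\<in>UNIV. \<Sum>j\<in>UNIV. cofactor (A x) k j * A (axis i 1) k j)"
    by (simp add: partial_det4 peval_cofactor Ap dA)
  finally have "(y $ l * w b) * (c * peval (partial i p) x) =
      (\<Sum>k\<in>UNIV. \<Sum>j\<in>UNIV. (y $ l * w b) * (cofactor (A x) k j * A (axis i 1) k j))"
    by (simp only: sum_distrib_left)
  also have "\<dots> = (\<Sum>k\<in>UNIV. \<Sum>j\<in>UNIV. cofactor (A x) b l * (w k * (A (axis i 1) k j * y $ j)))"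
  proof (rule sum.cong[OF refl], rule sum.cong[OF refl])
    fix k j
    have "cofactor (A x) k j * y $ l = cofactor (A x) k l * y $ j" by (rule cofactor_parallel[OF Ay])
    moreover have "cofactor (A x) k l * w b = cofactor (A x) b l * w k" by (rule cofactor_parallel_column[OF wA])
    ultimately show "(y $ l * w b) * (cofactor (A x) k j * A (axis i 1) k j) = cofactor (A x) b l * (w k * (A (axis i 1) k j * y $ j))"
      by (rule mult_rotate)
  qed
  also have "\<dots> = cofactor (A x) b l * (\<Sum>k\<in>UNIV. w k * apply4 (A (axis i 1)) y k)"
    unfolding apply4_def sum_distrib_left ..
  also have "\<dots> = cofactor (A x) b l * (\<Sum>k\<in>UNIV. w k * B y k i)"
    unfolding pair by (simp only: apply4_axis)
  also have "\<dots> = 0" by (simp add: wB)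
  finally show False using l c i ab by (simp add: w_def)
qed

section \<open>A trilinear form relating the two quartics\<close>

definition tab4 :: "'b \<Rightarrow> 'b \<Rightarrow> 'b \<Rightarrow> 'b \<Rightarrow> 4 \<Rightarrow> 'b" where
  "tab4 a b c d i = (if i = 1 then a else if i = 2 then b else if i = 3 then c else d)"

lemma tab4_simps [simp]: "tab4 a b c d 1 = a" "tab4 a b c d 2 = b" "tab4 a b c d 3 = c" "tab4 a b c d 4 = d"
  by (simp_all add: tab4_def)

text \<open>
  The quartic, the cubics and the matrices are written as functions of ring elements, so that one
  identity in a ring with \<open>z\<^sup>4 = - 1\<close> covers numbers, polynomials and exact elements of \<open>\<int>[\<zeta>]\<close>.
\<close>

definition quartic :: "'a::comm_ring_1 \<Rightarrow> 'a \<Rightarrow> 'a \<Rightarrow> 'a \<Rightarrow> 'a \<Rightarrow> 'a" where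
  "quartic z y1 y2 y3 y4 = y1 ^ 3 * y2 + y1 * y2 ^ 3 + y3 ^ 3 * y4 + y3 * y4 ^ 3
     + (y1 * y4 + y2 * y3) * ((- 1 - 2 * z - 2 * z ^ 3) * (y1 * y3 + y2 * y4)
       + (2 - 2 * z - 2 * z ^ 3) * (y1 * y2 - y3 * y4))"

definition cubics :: "'a::comm_ring_1 \<Rightarrow> 'a \<Rightarrow> 'a \<Rightarrow> 'a \<Rightarrow> 'a \<Rightarrow> 4 \<Rightarrow> 'a" where
  "cubics z x1 x2 x3 x4 = tab4
     ((1 + z - z^3)*x1^3 + (z + z^2 + z^3)*x1^2*x3 + (1 + z)*x1^2*x4 + (-z - z^2 - z^3)*x1*x2^2 + (-1 - z)*x1*x2*x3 + (z + z^2)*x1*x2*x4 + (-1)*x1*x3^2 + (z + z^2)*x1*x3*x4 + (-1*z^3)*x1*x4^2 + (1 - z^2 - z^3)*x2^2*x3 + (-z - z^2)*x2*x3^2 + (z^2 + z^3)*x2*x3*x4 + (z^2)*x3^3 + x3*x4^2)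
     (x1^3 + (-1*z^2)*x1^2*x3 + (-1 + z^3)*x1^2*x4 + (-1*z^2)*x1*x2^2 + (1 - z^3)*x1*x2*x3 + (-1 - z)*x1*x2*x4 + (1 + z - z^3)*x1*x3^2 + (-1*z^2 - z^3)*x1*x3*x4 + (-1 - z - z^2)*x1*x4^2 + (z)*x2^2*x3 + (z^2 + z^3)*x2*x3^2 + (1 - z^3)*x2*x3*x4 + (z + z^2 + z^3)*x3^3 + (1 + z - z^3)*x3*x4^2)
     ((1 + z + z^2)*x1^2*x2 + (z + z^2 + z^3)*x1^2*x4 + (-1 - z)*x1*x2*x3 + (z + z^2)*x1*x2*x4 + (-z - z^2)*x1*x3*x4 + (z^2 + z^3)*x1*x4^2 + (1 - z^2 - z^3)*x2^3 + (-z - z^2)*x2^2*x3 + (1 + z + z^2)*x2^2*x4 + (z^2)*x2*x3^2 + (-1*z^2 - z^3)*x2*x3*x4 + (z^3)*x2*x4^2 + (z^3)*x3^2*x4 + (z)*x4^3)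
     ((-z)*x1^2*x2 + x1^2*x4 + (-1 + z^3)*x1*x2*x3 + (1 + z)*x1*x2*x4 + (-1*z^2 - z^3)*x1*x3*x4 + (-1 + z^3)*x1*x4^2 + (z^3)*x2^3 + (-1 - z)*x2^2*x3 + (z)*x2^2*x4 + (-1 - z + z^3)*x2*x3^2 + (1 - z^3)*x2*x3*x4 + (-1 + z^2 + z^3)*x2*x4^2 + (1 - z^2 - z^3)*x3^2*x4 + (-1 - z - z^2)*x4^3)"

text \<open>
  The first three rows come from linear syzygies \<open>\<Sum>\<^sub>j l\<^sub>j f\<^sub>j = 0\<close> between the cubic forms; the
  last row is such that \<open>\<Sum>\<^sub>j l\<^sub>j f\<^sub>j\<close> is a multiple of the Fermat quartic.
\<close>

definition point_matrix :: "'a::comm_ring_1 \<Rightarrow> 'a \<Rightarrow> 'a \<Rightarrow> 'a \<Rightarrow> 'a \<Rightarrow> 4 \<Rightarrow> 4 \<Rightarrow> 'a" where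
  "point_matrix z x1 x2 x3 x4 = tab4
     (tab4 ((-1)*x2 + (-z)*x4) (0) ((-1*z^3)*x1 + x3) (0))
     (tab4 (0) ((-1*z^2)*x2 + (z)*x4) (0) ((-z)*x1 + x3))
     (tab4 ((-z)*x1 + (-1 + z^3)*x2 + (-1 + z^2 + z^3)*x3) ((1 + z + z^2)*x1 + (z^2 + z^3)*x2 + (-1*z^3)*x3) ((-1*z^2 - z^3)*x1 + (z^2)*x2 + (1 + z - z^3)*x4) ((z + z^2)*x1 + (z + z^2 + z^3)*x2 + x4))
     (tab4 ((-1 + z^3)*x2 + (-1 + z + z^3)*x3 + (-z)*x4) ((2 + z + z^3)*x1 + (z^2 + z^3)*x2 + (1 - z - z^3)*x3 + (1 - z + z^2)*x4) ((-z - 2*z^3)*x1 + (1 + z^2 + z^3)*x2 + (1 + z^2 - 2*z^3)*x4) ((z)*x1 + (1 + z^2 + z^3)*x2))"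

definition image_matrix :: "'a::comm_ring_1 \<Rightarrow> 'a \<Rightarrow> 'a \<Rightarrow> 'a \<Rightarrow> 'a \<Rightarrow> 4 \<Rightarrow> 4 \<Rightarrow> 'a" where
  "image_matrix z y1 y2 y3 y4 = tab4
     (tab4 ((-1*z^3)*y3) ((-1)*y1) (y3) ((-z)*y1))
     (tab4 ((-z)*y4) ((-1*z^2)*y2) (y4) ((z)*y2))
     (tab4 ((-z)*y1 + (1 + z + z^2)*y2 + (-1*z^2 - z^3)*y3 + (z + z^2)*y4) ((-1 + z^3)*y1 + (z^2 + z^3)*y2 + (z^2)*y3 + (z + z^2 + z^3)*y4) ((-1 + z^2 + z^3)*y1 + (-1*z^3)*y2) ((1 + z - z^3)*y3 + y4))
     (tab4 ((2 + z + z^3)*y2 + (-z - 2*z^3)*y3 + (z)*y4) ((-1 + z^3)*y1 + (z^2 + z^3)*y2 + (1 + z^2 + z^3)*y3 + (1 + z^2 + z^3)*y4) ((-1 + z + z^3)*y1 + (1 - z - z^3)*y2) ((-z)*y1 + (1 - z + z^2)*y2 + (1 + z^2 - 2*z^3)*y3))"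

text \<open>
  In nested products, these rules reduce all powers of \<open>z\<close> to exponents below four. Together with
  \<open>power_unfold\<close> and \<open>algebra_simps\<close> they decide identities of polynomials over \<open>\<int>[\<zeta>]\<close>.
\<close>

lemma zeta_rules:
  fixes z :: "'a::comm_ring_1" assumes "z ^ 4 = - 1"
  shows "z * (z * (z * (z * a))) = - a" "z * (z * (z * z)) = - 1"
proof -
  have "z * (z * (z * z)) = z ^ 4" by (simp add: power4_eq_xxxx mult.assoc)
  then show "z * (z * (z * z)) = - 1" using assms by simp
  then have "z * (z * (z * z)) * a = - 1 * a" by simp
  then show "z * (z * (z * (z * a))) = - a" by (simp add: mult.assoc)
qed

lemma power_unfold: "x ^ 4 = x * (x * (x * x))" "x ^ 3 = x * (x * x)" "x ^ 2 = x * x" for x :: "'a::comm_ring_1"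
  by (simp_all add: power4_eq_xxxx power3_eq_cube power2_eq_square mult.assoc)

lemma det_point_matrix:
  fixes z :: "'a::comm_ring_1" assumes "z ^ 4 = - 1"
  shows "det4 (point_matrix z x1 x2 x3 x4) = (z * (2 + z + z ^ 3)) * (x1 ^ 4 + x2 ^ 4 + x3 ^ 4 + x4 ^ 4)"
  unfolding det4_def point_matrix_def Let_def
  by (simp add: power_unfold algebra_simps zeta_rules[OF assms])

lemma det_image_matrix:
  fixes z :: "'a::comm_ring_1" assumes "z ^ 4 = - 1"
  shows "det4 (image_matrix z y1 y2 y3 y4) = (z * (2 + z + z ^ 3)) * quartic z y1 y2 y3 y4"
  unfolding det4_def image_matrix_def quartic_def Let_def
  by (simp add: power_unfold algebra_simps zeta_rules[OF assms])

lemma cofactor_point_matrix: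
  fixes z :: "'a::comm_ring_1" assumes "z ^ 4 = - 1"
  shows "cofactor (point_matrix z x1 x2 x3 x4) 4 j = z * cubics z x1 x2 x3 x4 j"
proof -
  have "\<forall>j. cofactor (point_matrix z x1 x2 x3 x4) 4 j = z * cubics z x1 x2 x3 x4 j"
    unfolding forall_4 cofactor_def point_matrix_def det4_def Let_def cubics_def
    by (simp add: unit_row_def idx4_neq power_unfold algebra_simps zeta_rules[OF assms])
  then show ?thesis ..
qed

lemma point_image_pairing:
  "(\<Sum>j\<in>UNIV. point_matrix z x1 x2 x3 x4 k j * tab4 y1 y2 y3 y4 j)
    = (\<Sum>i\<in>UNIV. image_matrix z y1 y2 y3 y4 k i * tab4 x1 x2 x3 x4 i)"
proof -
  have "\<forall>k. (\<Sum>j\<in>UNIV. point_matrix z x1 x2 x3 x4 k j * tab4 y1 y2 y3 y4 j)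
    = (\<Sum>i\<in>UNIV. image_matrix z y1 y2 y3 y4 k i * tab4 x1 x2 x3 x4 i)"
    unfolding forall_4 sum_4 point_matrix_def image_matrix_def
    by (simp add: algebra_simps)
  then show ?thesis ..
qed

lemma two_three_smooth:
  assumes "(6::'a::field) \<noteq> 0" shows "(2::'a) ^ a * 3 ^ b \<noteq> 0"
proof -
  have "(2::'a) * 3 \<noteq> 0" using assms by simp
  then have "(2::'a) \<noteq> 0" "(3::'a) \<noteq> 0" unfolding mult_eq_0_iff by blast+
  then show ?thesis by (intro no_zero_divisors power_not_zero)
qed

lemma left_cancel: "d * p = r \<Longrightarrow> r = 0 \<Longrightarrow> d \<noteq> 0 \<Longrightarrow> p = 0" for p :: "'a::field"
  by simp

text \<open>
  The six quadrics arise as factors of combinations of the cofactors of \<open>image_matrix\<close>. Gaussian elimination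
  on their coefficients, whose multipliers are the explicit factors below, leads to the simpler
  relations \<open>n1\<close> to \<open>n6\<close>. If \<open>y\<^sub>3\<^sup>2 \<noteq> y\<^sub>4\<^sup>2\<close>, then \<open>n2\<close> and \<open>n3\<close> express \<open>y\<^sub>1\<close> and \<open>y\<^sub>2\<close> linearly by
  \<open>y\<^sub>3\<close> and \<open>y\<^sub>4\<close>, which contradicts \<open>n1\<close>. Otherwise \<open>y\<^sub>4 = e y\<^sub>3\<close> with
  \<open>e = \<plusminus> 1\<close>; unless \<open>y\<^sub>3 = 0\<close>, also \<open>y\<^sub>1 = e y\<^sub>2\<close>, and the rest is a pair of linear equations with determinant \<open>- 36 (z + z\<^sup>3)\<close>.
\<close>

lemma quadrics_no_common_zero:
  fixes z :: "'a::field" assumes z4: "z ^ 4 = - 1" and six: "(6::'a) \<noteq> 0"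
    and Q1: "(-3 - z + z^2 + z^3)*y1*y2 + (-1 - z - z^2 + z^3)*y1*y4 + (1 + z - z^2 - 3*z^3)*y2^2 + (-1 - z - z^2 + z^3)*y2*y3 + (-3 - z + z^2 + z^3)*y3*y4 + (-1 - z + z^2 + 3*z^3)*y4^2 = 0" (is "?q1 = 0")
    and Q2: "(-1 - z^2 + 2*z^3)*y1*y2 + (-z + z^3)*y1*y4 + (3 - 2*z + z^2 - 4*z^3)*y2^2 + (-3 - z^2)*y2*y3 + (1 - 3*z + z^2 + z^3)*y2*y4 + (-2 - 3*z + 4*z^2 + z^3)*y3*y4 + (-z + 2*z^2 + z^3)*y4^2 = 0" (is "?q2 = 0")
    and Q3: "(-z + z^3)*y1^2 + (-1 - 6*z + z^2 - 6*z^3)*y1*y2 + (-8 - 2*z - 2*z^3)*y1*y3 + (-z + 2*z^2 + z^3)*y1*y4 + (-3 + z + z^2 - z^3)*y2^2 + (1 + 2*z - 3*z^2)*y2*y3 + (-7 - z + z^2 - 3*z^3)*y2*y4 + (-z + z^3)*y3^2 + (7*z + 3*z^3)*y3*y4 = 0" (is "?q3 = 0")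
    and Q4: "(-1 - 3*z - z^2 - z^3)*y1^2 + (1 + z + 3*z^2 + z^3)*y1*y2 + (-1 + z + z^2 + z^3)*y1*y4 + (-1 + z + z^2 + z^3)*y2*y3 + (1 + 3*z + z^2 + z^3)*y3^2 + (1 + z + 3*z^2 + z^3)*y3*y4 = 0" (is "?q4 = 0")
    and Q5: "(-2 - z - z^3)*y1^2 + (4 + z + 2*z^2 + 3*z^3)*y1*y2 + (-1 - z + z^2 - 3*z^3)*y1*y3 + (z + z^3)*y1*y4 + (-1 + 3*z^2)*y2*y3 + (-1 + 4*z + 3*z^2 - 2*z^3)*y3^2 + (-1 + 2*z + z^2)*y3*y4 = 0" (is "?q5 = 0")
    and Q6: "(1 + 3*z + z^2 + z^3)*y1^2 + (6 - z - 6*z^2 - z^3)*y1*y2 + (1 - 7*z - 3*z^2 - z^3)*y1*y3 + (2 - z - 3*z^3)*y1*y4 + (-1 - z^2)*y2^2 + (-1 - z^2 + 2*z^3)*y2*y3 + (2 - 8*z - 2*z^2)*y2*y4 + (-7 + 3*z^2)*y3*y4 + (-1 - z^2)*y4^2 = 0" (is "?q6 = 0")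
  shows "y1 = 0 \<and> y2 = 0 \<and> y3 = 0 \<and> y4 = 0"
proof -
  note calc = power_unfold algebra_simps zeta_rules[OF z4]
  note nz = two_three_smooth[OF six]
  define a where "a = y3 ^ 2 - y4 ^ 2"
  have "6 * (y1^2 + (-1)*y2^2 + (-1)*y3^2 + y4^2) =
      (1 - 2*z + z^3) * ?q1
      + (z - z^2 + 2*z^3) * ?q4"
    by (simp add: calc)
  then have n1: "y1^2 + (-1)*y2^2 + (-1)*y3^2 + y4^2 = 0"
    by (rule left_cancel) (simp only: Q1 Q2 Q3 Q4 Q5 Q6 mult_zero_right add_0_left, use nz[of 1 1] in simp)
  have "24 * (y1*y3 + (-1)*y2*y4 + (-z + z^3)*y3^2 + (z - z^3)*y4^2) =
      (-12 - z - 2*z^2 + z^3) * ?q1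
      + (3 + 6*z + 3*z^2 - 6*z^3) * ?q2
      + (3*z + 3*z^3) * ?q3
      + (-5 - 8*z - 3*z^2 - 2*z^3) * ?q4
      + (9*z + 6*z^2 + 3*z^3) * ?q5
      + (-3 - 3*z^2) * ?q6"
    by (simp add: calc)
  then have n2: "y1*y3 + (-1)*y2*y4 + (-z + z^3)*y3^2 + (z - z^3)*y4^2 = 0"
    by (rule left_cancel) (simp only: Q1 Q2 Q3 Q4 Q5 Q6 mult_zero_right add_0_left, use nz[of 3 1] in simp)
  have "8 * ((-3)*y1*y4 + (3)*y2*y3 + (-1 - 2*z - 2*z^3)*y3^2 + (1 + 2*z + 2*z^3)*y4^2) =
      (2 - z - 8*z^2 + 3*z^3) * ?q1
      + (1 + 2*z + 3*z^2 + 2*z^3) * ?q2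
      + (z + 4*z^2 - z^3) * ?q3
      + (-5 - 2*z - z^2) * ?q4
      + (2 + z + z^3) * ?q5
      + (-1 - 4*z + z^2) * ?q6"
    by (simp add: calc)
  then have n3: "(-3)*y1*y4 + (3)*y2*y3 + (-1 - 2*z - 2*z^3)*y3^2 + (1 + 2*z + 2*z^3)*y4^2 = 0"
    by (rule left_cancel) (simp only: Q1 Q2 Q3 Q4 Q5 Q6 mult_zero_right add_0_left, use nz[of 3 0] in simp)
  have "24 * ((3)*y1^2 + (-2*z + 4*z^2 + 2*z^3)*y2*y4 + (-2 + 2*z + 2*z^3)*y3^2 + (5 - 2*z - 2*z^3)*y4^2) =
      (-6 - 35*z + 28*z^2 + 23*z^3) * ?q1
      + (29 + 4*z - 9*z^2 - 14*z^3) * ?q2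
      + (5*z + 2*z^2 - 5*z^3) * ?q3
      + (-13 - 4*z + z^2 + 42*z^3) * ?q4
      + (20 + 13*z - 23*z^3) * ?q5
      + (-7 - 10*z + 7*z^2) * ?q6"
    by (simp add: calc)
  then have n4: "(3)*y1^2 + (-2*z + 4*z^2 + 2*z^3)*y2*y4 + (-2 + 2*z + 2*z^3)*y3^2 + (5 - 2*z - 2*z^3)*y4^2 = 0"
    by (rule left_cancel) (simp only: Q1 Q2 Q3 Q4 Q5 Q6 mult_zero_right add_0_left, use nz[of 3 1] in simp)
  have "12 * ((3)*y1*y2 + (2 - 4*z - 4*z^3)*y2*y4 + (z - 4*z^2 - z^3)*y3^2 + (-3)*y3*y4 + (-z + 4*z^2 + z^3)*y4^2) =
      (6 - 11*z - z^2 - 16*z^3) * ?q1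
      + (-2 - 2*z + 12*z^2 + 10*z^3) * ?q2
      + (-6) * ?q3
      + (14 + 2*z - 3*z^2 - 7*z^3) * ?q4
      + (-12 - 11*z + 2*z^2 + 5*z^3) * ?q5
      + (3 + 3*z^2 - 6*z^3) * ?q6"
    by (simp add: calc)
  then have n5: "(3)*y1*y2 + (2 - 4*z - 4*z^3)*y2*y4 + (z - 4*z^2 - z^3)*y3^2 + (-3)*y3*y4 + (-z + 4*z^2 + z^3)*y4^2 = 0"
    by (rule left_cancel) (simp only: Q1 Q2 Q3 Q4 Q5 Q6 mult_zero_right add_0_left, use nz[of 2 1] in simp)
  have "6 * ((3)*y1*y4 + (2*z + 9*z^2 - 2*z^3)*y2*y4 + (4 + 4*z + 4*z^3)*y3^2 + (3*z - 3*z^2 - 3*z^3)*y3*y4 + (-1 - 7*z - 7*z^3)*y4^2) =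
      (-4 + 3*z + 22*z^2 - 2*z^3) * ?q1
      + (2 - 10*z - 7*z^2 - 9*z^3) * ?q2
      + (2*z - 4*z^2 - 2*z^3) * ?q3
      + (-1 + z + 11*z^2 + 7*z^3) * ?q4
      + (4 - 6*z^2 - 12*z^3) * ?q5
      + (-4 + 2*z + 4*z^2) * ?q6"
    by (simp add: calc)
  then have n6: "(3)*y1*y4 + (2*z + 9*z^2 - 2*z^3)*y2*y4 + (4 + 4*z + 4*z^3)*y3^2 + (3*z - 3*z^2 - 3*z^3)*y3*y4 + (-1 - 7*z - 7*z^3)*y4^2 = 0"
    by (rule left_cancel) (simp only: Q1 Q2 Q3 Q4 Q5 Q6 mult_zero_right add_0_left, use nz[of 1 1] in simp)
  (* The square of z + z^3 is -2. *)
  have zz: "- 36 * (z + z ^ 3) \<noteq> 0"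
  proof
    assume "- 36 * (z + z ^ 3) = 0"
    then have "(z + z ^ 3) * (- 36 * (z + z ^ 3)) = 0" by simp
    then have "(72::'a) = 0" by (simp add: calc)
    then show False using nz[of 3 2] by simp
  qed
  have a0: "a = 0"
  proof (rule ccontr)
    assume a: "a \<noteq> 0"
    have "a * (3 * y1 - 3 * (z - z ^ 3) * y3 - (1 + 2 * z + 2 * z ^ 3) * y4) =
        3 * y3 * (y1*y3 + (-1)*y2*y4 + (-z + z^3)*y3^2 + (z - z^3)*y4^2) + y4 * ((-3)*y1*y4 + (3)*y2*y3 + (-1 - 2*z - 2*z^3)*y3^2 + (1 + 2*z + 2*z^3)*y4^2)"
      by (simp add: a_def calc)
    then have "3 * y1 - 3 * (z - z ^ 3) * y3 - (1 + 2 * z + 2 * z ^ 3) * y4 = 0"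
      unfolding n2 n3 using a by (simp only: mult_zero_right add_0_left mult_eq_0_iff simp_thms)
    then have y1: "3 * y1 = 3 * (z - z ^ 3) * y3 + (1 + 2 * z + 2 * z ^ 3) * y4"
      by (simp add: algebra_simps)
    have "a * (3 * y2 - (1 + 2 * z + 2 * z ^ 3) * y3 - 3 * (z - z ^ 3) * y4) =
        y3 * ((-3)*y1*y4 + (3)*y2*y3 + (-1 - 2*z - 2*z^3)*y3^2 + (1 + 2*z + 2*z^3)*y4^2) + 3 * y4 * (y1*y3 + (-1)*y2*y4 + (-z + z^3)*y3^2 + (z - z^3)*y4^2)"
      by (simp add: a_def calc)
    then have "3 * y2 - (1 + 2 * z + 2 * z ^ 3) * y3 - 3 * (z - z ^ 3) * y4 = 0"
      unfolding n2 n3 using a by (simp only: mult_zero_right add_0_left mult_eq_0_iff simp_thms)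
    then have y2: "3 * y2 = (1 + 2 * z + 2 * z ^ 3) * y3 + 3 * (z - z ^ 3) * y4"
      by (simp add: algebra_simps)
    have "9 * a = (3 * y1) ^ 2 - (3 * y2) ^ 2 - 9 * (y1^2 + (-1)*y2^2 + (-1)*y3^2 + y4^2)"
      by (simp add: a_def calc)
    also have "\<dots> = (25 - 4 * z - 4 * z ^ 3) * a"
      unfolding y1 y2 n1 by (simp add: a_def calc)
    finally have "(16 - 4 * z - 4 * z ^ 3) * a = 0"
      by (simp add: algebra_simps)
    then have "(16 - 4 * z - 4 * z ^ 3) = 0" using a by simp
    then have "(16 + 4 * z + 4 * z ^ 3) * (16 - 4 * z - 4 * z ^ 3) = 0" by simp
    then have "(288::'a) = 0" by (simp add: calc)
    then show False using nz[of 5 2] by simp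
  qed
  then have "(y4 - y3) * (y4 + y3) = 0" by (simp add: a_def power2_eq_square algebra_simps)
  then have "y4 = 1 * y3 \<or> y4 = - 1 * y3" by (auto simp: eq_neg_iff_add_eq_0)
  then obtain e where e: "e = 1 \<or> e = - 1" and y4: "y4 = e * y3" by blast
  have ee: "e * e = 1" using e by auto
  show ?thesis
  proof (cases "y3 = 0")
    case True
    have "3 * (y1 * y1) = 0" using n4 y4 True by (simp add: power2_eq_square)
    then have "y1 = 0" using nz[of 0 1] by simp
    moreover have "y2 * y2 = 0" using n1 y4 True \<open>y1 = 0\<close> by (simp add: power2_eq_square)
    ultimately show ?thesis using True y4 by simp
  next
    case False
    have "(y1 - e * y2) * y3 = 0"
    proof -
      have "(y1 - e * y2) * y3 = (y1*y3 + (-1)*y2*y4 + (-z + z^3)*y3^2 + (z - z^3)*y4^2) + (z - z ^ 3) * a"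
        by (simp add: a_def y4 algebra_simps)
      then show ?thesis unfolding n2 a0 by simp
    qed
    then have y1: "y1 = e * y2" using False by simp
    let ?c = "e * (- 2 * z + 2 * z ^ 3 + 4 * z ^ 2) - 2 + 4 * z + 4 * z ^ 3"
    let ?d = "3 + e * (2 * z - 2 * z ^ 3 + 9 * z ^ 2)"
    let ?f = "3 * e * (z - z ^ 3 - z ^ 2) + 3 * (1 - z - z ^ 3)"
    have 1: "y3 * (?c * y2 + 6 * y3) = 0"
    proof -
      have "y3 * (?c * y2 + 6 * y3) = ((3)*y1^2 + (-2*z + 4*z^2 + 2*z^3)*y2*y4 + (-2 + 2*z + 2*z^3)*y3^2 + (5 - 2*z - 2*z^3)*y4^2) - e * ((3)*y1*y2 + (2 - 4*z - 4*z^3)*y2*y4 + (z - 4*z^2 - z^3)*y3^2 + (-3)*y3*y4 + (-z + 4*z^2 + z^3)*y4^2)"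
        using e by (rule disjE) (simp_all add: y4 y1 calc)
      then show ?thesis unfolding n4 n5 by simp
    qed
    have 2: "y3 * (?d * y2 + ?f * y3) = 0"
    proof -
      have "y3 * (?d * y2 + ?f * y3) = ((3)*y1*y4 + (2*z + 9*z^2 - 2*z^3)*y2*y4 + (4 + 4*z + 4*z^3)*y3^2 + (3*z - 3*z^2 - 3*z^3)*y3*y4 + (-1 - 7*z - 7*z^3)*y4^2)"
        using e by (rule disjE) (simp_all add: y4 y1 calc)
      then show ?thesis unfolding n6 by simp
    qed
    have "(- 36 * (z + z ^ 3)) * y3 = ?d * (?c * y2 + 6 * y3) - ?c * (?d * y2 + ?f * y3)"
      using e by (rule disjE) (simp_all add: calc)
    then have "(- 36 * (z + z ^ 3)) * y3 = 0" using 1 2 False by simp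
    then show ?thesis using zz False by simp
  qed
qed

section \<open>The kernels are at most one-dimensional\<close>

lemma pair_cancel: "\<not> (a = 0 \<and> b = 0) \<Longrightarrow> a * q = 0 \<Longrightarrow> b * q = 0 \<Longrightarrow> q = 0" for a :: "'a::field"
  by auto

text \<open>
  Twelve combinations of the cofactors split off a variable: three quadrics occur multiplied by
  \<open>y\<^sub>1\<close> and by \<open>y\<^sub>3\<close>, three others multiplied by \<open>y\<^sub>2\<close> and by \<open>y\<^sub>4\<close>. So the quadrics vanish unless
  \<open>y\<^sub>1 = y\<^sub>3 = 0\<close> or \<open>y\<^sub>2 = y\<^sub>4 = 0\<close>, and in these two cases the cofactors generate the cubes of the
  two other variables.
\<close>

lemma rank_image_matrix:
  fixes z :: "'a::field" assumes z4: "z ^ 4 = - 1" and six: "(6::'a) \<noteq> 0"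
    and cof: "\<And>k i. cofactor (image_matrix z y1 y2 y3 y4) k i = 0"
  shows "y1 = 0 \<and> y2 = 0 \<and> y3 = 0 \<and> y4 = 0"
proof -
  note expand = cofactor_def det4_def image_matrix_def Let_def
  note calc = unit_row_def idx4_neq power_unfold algebra_simps zeta_rules[OF z4]
  let ?C = "cofactor (image_matrix z y1 y2 y3 y4)"
  let ?q1 = "(-3 - z + z^2 + z^3)*y1*y2 + (-1 - z - z^2 + z^3)*y1*y4 + (1 + z - z^2 - 3*z^3)*y2^2 + (-1 - z - z^2 + z^3)*y2*y3 + (-3 - z + z^2 + z^3)*y3*y4 + (-1 - z + z^2 + 3*z^3)*y4^2"
  let ?q2 = "(-1 - z^2 + 2*z^3)*y1*y2 + (-z + z^3)*y1*y4 + (3 - 2*z + z^2 - 4*z^3)*y2^2 + (-3 - z^2)*y2*y3 + (1 - 3*z + z^2 + z^3)*y2*y4 + (-2 - 3*z + 4*z^2 + z^3)*y3*y4 + (-z + 2*z^2 + z^3)*y4^2"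
  let ?q3 = "(-z + z^3)*y1^2 + (-1 - 6*z + z^2 - 6*z^3)*y1*y2 + (-8 - 2*z - 2*z^3)*y1*y3 + (-z + 2*z^2 + z^3)*y1*y4 + (-3 + z + z^2 - z^3)*y2^2 + (1 + 2*z - 3*z^2)*y2*y3 + (-7 - z + z^2 - 3*z^3)*y2*y4 + (-z + z^3)*y3^2 + (7*z + 3*z^3)*y3*y4"
  let ?q4 = "(-1 - 3*z - z^2 - z^3)*y1^2 + (1 + z + 3*z^2 + z^3)*y1*y2 + (-1 + z + z^2 + z^3)*y1*y4 + (-1 + z + z^2 + z^3)*y2*y3 + (1 + 3*z + z^2 + z^3)*y3^2 + (1 + z + 3*z^2 + z^3)*y3*y4"
  let ?q5 = "(-2 - z - z^3)*y1^2 + (4 + z + 2*z^2 + 3*z^3)*y1*y2 + (-1 - z + z^2 - 3*z^3)*y1*y3 + (z + z^3)*y1*y4 + (-1 + 3*z^2)*y2*y3 + (-1 + 4*z + 3*z^2 - 2*z^3)*y3^2 + (-1 + 2*z + z^2)*y3*y4"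
  let ?q6 = "(1 + 3*z + z^2 + z^3)*y1^2 + (6 - z - 6*z^2 - z^3)*y1*y2 + (1 - 7*z - 3*z^2 - z^3)*y1*y3 + (2 - z - 3*z^3)*y1*y4 + (-1 - z^2)*y2^2 + (-1 - z^2 + 2*z^3)*y2*y3 + (2 - 8*z - 2*z^2)*y2*y4 + (-7 + 3*z^2)*y3*y4 + (-1 - z^2)*y4^2"
  have Q121: "y1 * ?q1 = (z^3) * ?C 4 1 + (-1) * ?C 4 3"
    unfolding expand by (simp add: calc)
  have Q123: "y3 * ?q1 = (-1) * ?C 4 2 + (-z) * ?C 4 4"
    unfolding expand by (simp add: calc)
  have Q131: "y1 * ?q2 = (-1*z^3) * ?C 3 1 + 1 * ?C 3 3"
    unfolding expand by (simp add: calc)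
  have Q133: "y3 * ?q2 = 1 * ?C 3 2 + (z) * ?C 3 4"
    unfolding expand by (simp add: calc)
  have Q231: "y1 * ?q3 = (z^3) * ?C 2 1 + (-1) * ?C 2 3"
    unfolding expand by (simp add: calc)
  have Q233: "y3 * ?q3 = (-1) * ?C 2 2 + (-z) * ?C 2 4"
    unfolding expand by (simp add: calc)
  have R022: "y2 * ?q4 = (-1) * ?C 4 1 + (-1*z^3) * ?C 4 3"
    unfolding expand by (simp add: calc)
  have R024: "y4 * ?q4 = (z) * ?C 4 2 + (-1) * ?C 4 4"
    unfolding expand by (simp add: calc)
  have R032: "y2 * ?q5 = 1 * ?C 3 1 + (z^3) * ?C 3 3"
    unfolding expand by (simp add: calc)
  have R034: "y4 * ?q5 = (-z) * ?C 3 2 + 1 * ?C 3 4"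
    unfolding expand by (simp add: calc)
  have R232: "y2 * ?q6 = (-1) * ?C 1 1 + (-1*z^3) * ?C 1 3"
    unfolding expand by (simp add: calc)
  have R234: "y4 * ?q6 = (z) * ?C 1 2 + (-1) * ?C 1 4"
    unfolding expand by (simp add: calc)
  have E2: "24 * y2 ^ 3 = (-2 - 2*z - z^2 + 3*z^3) * ?C 1 1 + (-1 - 6*z + 2*z^2 + 3*z^3) * ?C 1 2 + (2 - 2*z + 3*z^2 + z^3) * ?C 1 3 + (-3 + 2*z + 6*z^2 - z^3) * ?C 1 4" if "y1 = 0" "y3 = 0"
    unfolding expand that by (simp add: calc)
  have E4: "24 * y4 ^ 3 = (6 - 2*z - 3*z^2 - z^3) * ?C 1 1 + (3 + 2*z + 2*z^2 + z^3) * ?C 1 2 + (-2 - 6*z + z^2 - 3*z^3) * ?C 1 3 + (1 - 2*z + 2*z^2 - 3*z^3) * ?C 1 4" if "y1 = 0" "y3 = 0"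
    unfolding expand that by (simp add: calc)
  have E1: "24 * y1 ^ 3 = (1 - 2*z + 2*z^2 - 3*z^3) * ?C 2 1 + (1 - 3*z + 2*z^2 + 6*z^3) * ?C 2 2 + (-3 - 2*z - 2*z^2 - z^3) * ?C 2 3 + (3 + z + 6*z^2 - 2*z^3) * ?C 2 4" if "y2 = 0" "y4 = 0"
    unfolding expand that by (simp add: calc)
  have E3: "24 * y3 ^ 3 = (-3 + 2*z + 6*z^2 - z^3) * ?C 2 1 + (3 + z - 2*z^2 + 2*z^3) * ?C 2 2 + (1 + 6*z - 2*z^2 - 3*z^3) * ?C 2 3 + (1 - 3*z - 2*z^2 - 2*z^3) * ?C 2 4" if "y2 = 0" "y4 = 0"
    unfolding expand that by (simp add: calc)
  have nz: "(24::'a) \<noteq> 0" using two_three_smooth[OF six, of 3 1] by simp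
  note E1 = E1[unfolded cof mult_zero_right add_0_left] and E2 = E2[unfolded cof mult_zero_right add_0_left]
    and E3 = E3[unfolded cof mult_zero_right add_0_left] and E4 = E4[unfolded cof mult_zero_right add_0_left]
  show ?thesis
  proof (cases "y1 = 0 \<and> y3 = 0 \<or> y2 = 0 \<and> y4 = 0")
    case True
    then show ?thesis
    proof
      assume *: "y1 = 0 \<and> y3 = 0"
      then show ?thesis using E2[OF conjunct1[OF *] conjunct2[OF *]] E4[OF conjunct1[OF *] conjunct2[OF *]] nz by simp
    next
      assume *: "y2 = 0 \<and> y4 = 0"
      then show ?thesis using E1[OF conjunct1[OF *] conjunct2[OF *]] E3[OF conjunct1[OF *] conjunct2[OF *]] nz by simp
    qed
  next
    case False
    then have F: "\<not> (y1 = 0 \<and> y3 = 0)" "\<not> (y2 = 0 \<and> y4 = 0)" by blast+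
    note Q = Q121 Q123 Q131 Q133 Q231 Q233 R022 R024 R032 R034 R232 R234
    note Q0 = Q[unfolded cof mult_zero_right add_0_left]
    show ?thesis
      by (rule quadrics_no_common_zero[OF z4 six
        pair_cancel[OF F(1) Q0(1,2)] pair_cancel[OF F(1) Q0(3,4)] pair_cancel[OF F(1) Q0(5,6)]
        pair_cancel[OF F(2) Q0(7,8)] pair_cancel[OF F(2) Q0(9,10)] pair_cancel[OF F(2) Q0(11,12)]])
  qed
qed

section \<open>Smoothness and the isomorphism\<close>

definition quartic_poly :: "'a::comm_ring_1 \<Rightarrow> 'a poly4" where
  "quartic_poly z = quartic (Const z) (Var 1) (Var 2) (Var 3) (Var 4)"

definition cubic_polys :: "'a::comm_ring_1 \<Rightarrow> 4 \<Rightarrow> 'a poly4" where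
  "cubic_polys z = cubics (Const z) (Var 1) (Var 2) (Var 3) (Var 4)"

lemma peval_quartic_poly: "peval (quartic_poly z) y = quartic z (y $ 1) (y $ 2) (y $ 3) (y $ 4)"
  by (simp add: quartic_poly_def quartic_def)

lemma peval_fermat: "peval fermat x = (x $ 1) ^ 4 + (x $ 2) ^ 4 + (x $ 3) ^ 4 + (x $ 4) ^ 4"
  by (simp add: fermat_def)

lemma partial_fermat: "peval (partial i fermat) x = 4 * (x $ i) ^ 3"
proof -
  have "\<forall>i. peval (partial i fermat) x = 4 * (x $ i) ^ 3"
    unfolding forall_4 by (simp add: fermat_def eval_nat_numeral algebra_simps)
  then show ?thesis ..
qed

lemma homogeneous_linear_form: "homogeneous 1 (\<Sum>i\<in>UNIV. Const (c i) * Var i)"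
  unfolding sum_4 by (intro homogeneous_add homogeneous_Const_mult homogeneous_Var)

lemma homogeneous_det4:
  assumes "\<And>k j. homogeneous 1 (A k j)"
  shows "homogeneous 4 (det4 A)"
proof -
  have 2: "homogeneous 2 (A a b * A c d - A e f * A g h)" for a b c d e f g h
    using homogeneous_diff[OF homogeneous_mult[OF assms[of a b] assms[of c d]] homogeneous_mult[OF assms[of e f] assms[of g h]]]
    by (simp add: numeral_2_eq_2)
  have 4: "homogeneous 4 ((A a b * A c d - A e f * A g h) * (A a' b' * A c' d' - A e' f' * A g' h'))"
    for a b c d e f g h a' b' c' d' e' f' g' h'
    by (rule homogeneous_cong[OF homogeneous_mult[OF 2 2]]) simp
  show ?thesis
    unfolding det4_def Let_def by (intro homogeneous_add homogeneous_diff 4)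
qed

definition point_at :: "'a::comm_ring_1 \<Rightarrow> 'a ^ 4 \<Rightarrow> 4 \<Rightarrow> 4 \<Rightarrow> 'a" where
  "point_at z x = point_matrix z (x $ 1) (x $ 2) (x $ 3) (x $ 4)"

definition image_at :: "'a::comm_ring_1 \<Rightarrow> 'a ^ 4 \<Rightarrow> 4 \<Rightarrow> 4 \<Rightarrow> 'a" where
  "image_at z y = image_matrix z (y $ 1) (y $ 2) (y $ 3) (y $ 4)"

abbreviation (input) point_forms :: "'a::comm_ring_1 \<Rightarrow> 4 \<Rightarrow> 4 \<Rightarrow> 'a poly4" where
  "point_forms z \<equiv> point_matrix (Const z) (Var 1) (Var 2) (Var 3) (Var 4)"

abbreviation (input) image_forms :: "'a::comm_ring_1 \<Rightarrow> 4 \<Rightarrow> 4 \<Rightarrow> 'a poly4" where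
  "image_forms z \<equiv> image_matrix (Const z) (Var 1) (Var 2) (Var 3) (Var 4)"

lemma axis_simps: "(axis i x :: 'a::zero ^ 4) $ j = (if j = i then x else 0)"
  by (simp add: axis_def)

lemma point_forms_eq: "point_forms z k j = (\<Sum>i\<in>UNIV. Const (point_at z (axis i 1) k j) * Var i)"
proof -
  have "\<forall>k j. point_forms z k j = (\<Sum>i\<in>UNIV. Const (point_at z (axis i 1) k j) * Var i)"
    unfolding forall_4 sum_4 point_matrix_def point_at_def
    by (simp add: axis_simps idx4_neq Const_add Const_diff Const_uminus Const_mult Const_power Const_numeral algebra_simps)
  then show ?thesis by blast
qed

lemma image_forms_eq: "image_forms z k j = (\<Sum>i\<in>UNIV. Const (image_at z (axis i 1) k j) * Var i)"
proof -
  have "\<forall>k j. image_forms z k j = (\<Sum>i\<in>UNIV. Const (image_at z (axis i 1) k j) * Var i)"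
    unfolding forall_4 sum_4 image_matrix_def image_at_def
    by (simp add: axis_simps idx4_neq Const_add Const_diff Const_uminus Const_mult Const_power Const_numeral algebra_simps)
  then show ?thesis by blast
qed

lemma peval_point_forms: "peval (point_forms z k j) x = point_at z x k j"
proof -
  have "\<forall>k j. peval (point_forms z k j) x = point_at z x k j"
    unfolding forall_4 point_matrix_def point_at_def by simp
  then show ?thesis by blast
qed

lemma peval_image_forms: "peval (image_forms z k j) x = image_at z x k j"
proof -
  have "\<forall>k j. peval (image_forms z k j) x = image_at z x k j"
    unfolding forall_4 image_matrix_def image_at_def by simp
  then show ?thesis by blast
qed

lemma partial_linear_form: "partial i (\<Sum>j\<in>UNIV. Const (c j) * Var j) = Const (c i)"
proof -
  have "partial i (\<Sum>j\<in>UNIV. Const (c j) * Var j) = (\<Sum>j\<in>UNIV. if j = i then Const (c j) else 0)"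
    unfolding partial_sum by (intro sum.cong) auto
  then show ?thesis by simp
qed

lemma point_image_apply: "apply4 (point_at z x) y = apply4 (image_at z y) x"
proof
  fix k
  have v: "tab4 (v $ 1) (v $ 2) (v $ 3) (v $ 4) = (\<lambda>i. v $ i)" for v :: "'a ^ 4"
  proof -
    have "\<forall>i. tab4 (v $ 1) (v $ 2) (v $ 3) (v $ 4) i = v $ i" by (simp add: forall_4)
    then show ?thesis by blast
  qed
  show "apply4 (point_at z x) y k = apply4 (image_at z y) x k"
    using point_image_pairing[of z "x $ 1" "x $ 2" "x $ 3" "x $ 4" k "y $ 1" "y $ 2" "y $ 3" "y $ 4"]
    by (simp add: v apply4_def point_at_def image_at_def)
qed

text \<open>
  All constants by which one has to divide are products of 2 and 3 or divisors of such products in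
  \<open>\<int>[\<zeta>]\<close>, such as the factor \<open>z (2 + z + z\<^sup>3)\<close> of the determinants, whose norm is 36.
\<close>

locale eighth_root =
  fixes z :: "'a::field"
  assumes z4: "z ^ 4 = - 1" and six: "(6::'a) \<noteq> 0"
begin

definition unit where "unit = z * (2 + z + z ^ 3)"

lemma unit_nz: "unit \<noteq> 0"
proof
  assume "unit = 0"
  then have "unit * (z ^ 3 * (2 - z - z ^ 3)) = 0" by simp
  then have "- (6::'a) = 0"
    by (simp add: unit_def power_unfold algebra_simps zeta_rules[OF z4])
  then show False using six by simp
qed

lemma Const_z4: "Const z ^ 4 = - 1"
  by (simp add: Const_power[symmetric] z4 Const_uminus)

lemma det_point_forms: "det4 (point_forms z) = Const unit * fermat"
  by (simp add: det_point_matrix[OF Const_z4] fermat_def unit_def Const_add Const_mult Const_power Const_numeral)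

lemma det_image_forms: "det4 (image_forms z) = Const unit * quartic_poly z"
  by (simp add: det_image_matrix[OF Const_z4] quartic_poly_def unit_def Const_add Const_mult Const_power Const_numeral)

lemma fermat_smooth: "smooth_surface (fermat :: 'a poly4)"
  unfolding smooth_surface_def
proof (intro allI impI)
  fix x :: "'a ^ 4" assume "x \<noteq> 0 \<and> peval fermat x = 0"
  then obtain i where i: "x $ i \<noteq> 0" by (auto simp: vec_eq_iff)
  have "(4::'a) \<noteq> 0" using two_three_smooth[OF six, of 2 0] by simp
  then show "\<exists>i. peval (partial i fermat) x \<noteq> 0" using i by (intro exI[of _ i]) (simp add: partial_fermat)
qed

lemma rank_image_at:
  assumes "y \<noteq> 0" shows "\<exists>k i. cofactor (image_at z y) k i \<noteq> 0"
proof (rule ccontr)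
  assume "\<not> ?thesis"
  then have "cofactor (image_matrix z (y $ 1) (y $ 2) (y $ 3) (y $ 4)) k i = 0" for k i
    by (simp add: image_at_def)
  from rank_image_matrix[OF z4 six this] have "y = 0" by (simp add: vec_eq_iff forall_4)
  with assms show False by simp
qed

lemma hom_fermat: "homogeneous 4 (fermat :: 'a poly4)"
  unfolding fermat_def
  by (intro homogeneous_add homogeneous_cong[OF homogeneous_power[OF homogeneous_Var]]) simp_all

text \<open>
  A multiple of a determinant of linear forms is a quartic form.
\<close>

lemma hom_quartic: "homogeneous 4 (quartic_poly z)"
proof -
  have "homogeneous 4 (Const (inverse unit) * det4 (image_forms z))"
    by (intro homogeneous_Const_mult homogeneous_det4) (simp only: image_forms_eq homogeneous_linear_form)
  also have "Const (inverse unit) * det4 (image_forms z) = quartic_poly z"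
    using unit_nz by (simp add: det_image_forms mult.assoc[symmetric] Const_mult[symmetric])
  finally show ?thesis .
qed

lemma quartic_smooth: "smooth_surface (quartic_poly z)"
proof (rule singular_point_transfer[where A = "point_at z" and B = "image_at z" and Ap = "point_forms z"
      and Bp = "image_forms z" and p = fermat and c = unit])
  show "apply4 (point_at z x) y = apply4 (image_at z y) x" for x y by (rule point_image_apply)
  show "peval (image_forms z k j) x = image_at z x k j" for k j x by (rule peval_image_forms)
  show "peval (point_forms z k j) x = point_at z x k j" for k j x by (rule peval_point_forms)
  show "peval (partial i (image_forms z k j)) x = image_at z (axis i 1) k j" for i k j x
    by (simp only: image_forms_eq partial_linear_form peval_Const)
  show "peval (partial i (point_forms z k j)) x = point_at z (axis i 1) k j" for i k j x
    by (simp only: point_forms_eq partial_linear_form peval_Const)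
qed (use det_point_forms det_image_forms unit_nz fermat_smooth rank_image_at in auto)

text \<open>
  If all cofactors vanish at \<open>x\<close>, then so do all derivatives of the determinant, but those of the
  Fermat quartic have no common zero.
\<close>

lemma rank_point_at:
  assumes "x \<noteq> 0" shows "\<exists>k j. cofactor (point_at z x) k j \<noteq> 0"
proof (rule ccontr)
  assume no: "\<not> ?thesis"
  have *: "unit * peval (partial i fermat) x = 0" for i
  proof -
    have "unit * peval (partial i fermat) x = peval (partial i (det4 (point_forms z))) x"
      by (simp add: det_point_forms)
    also have "\<dots> = 0" using no
      by (simp add: partial_det4 peval_cofactor peval_point_forms)
    finally show ?thesis .
  qed
  obtain i where i: "x $ i \<noteq> 0" using assms by (auto simp: vec_eq_iff)
  have "(4::'a) \<noteq> 0" using two_three_smooth[OF six, of 2 0] by simp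
  then show False using *[of i] i unit_nz by (simp add: partial_fermat)
qed

lemma pair_point: "determinantal_pair (point_at z) (image_at z) (point_forms z) fermat (quartic_poly z) unit 4 4"
proof
  show "det4 (point_at z x) = unit * peval fermat x" for x
    by (simp add: point_at_def det_point_matrix[OF z4] unit_def peval_fermat)
  show "det4 (image_at z x) = unit * peval (quartic_poly z) x" for x
    by (simp add: image_at_def det_image_matrix[OF z4] unit_def peval_quartic_poly)
  show "homogeneous 1 (point_forms z k j)" for k j
    by (simp only: point_forms_eq homogeneous_linear_form)
qed (use unit_nz hom_fermat hom_quartic rank_point_at peval_point_forms point_image_apply in auto)

lemma pair_image: "determinantal_pair (image_at z) (point_at z) (image_forms z) (quartic_poly z) fermat unit 4 4"
proof
  show "det4 (point_at z x) = unit * peval fermat x" for x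
    by (simp add: point_at_def det_point_matrix[OF z4] unit_def peval_fermat)
  show "det4 (image_at z x) = unit * peval (quartic_poly z) x" for x
    by (simp add: image_at_def det_image_matrix[OF z4] unit_def peval_quartic_poly)
  show "homogeneous 1 (image_forms z k j)" for k j
    by (simp only: image_forms_eq homogeneous_linear_form)
  show "apply4 (image_at z x) y = apply4 (point_at z y) x" for x y
    by (rule point_image_apply[symmetric])
qed (use unit_nz hom_fermat hom_quartic rank_image_at peval_image_forms in auto)

lemma kernel_map_iso: "isomorphism (surface fermat) (surface (quartic_poly z)) (kernel_map (point_at z))"
  by (rule kernel_map_isomorphism[OF pair_point pair_image])

lemma z_nz: "z \<noteq> 0" using z4 by auto

lemma hom_cubics: "homogeneous 3 (cubic_polys z j)"
proof -
  have "homogeneous 3 (Const (inverse z) * cofactor (point_forms z) 4 j)"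
    by (intro homogeneous_Const_mult homogeneous_cofactor) (simp only: point_forms_eq homogeneous_linear_form)
  also have "Const (inverse z) * cofactor (point_forms z) 4 j = cubic_polys z j"
    using z_nz by (simp add: cofactor_point_matrix[OF Const_z4] cubic_polys_def mult.assoc[symmetric] Const_mult[symmetric])
  finally show ?thesis .
qed

lemma kernel_map_cubics:
  assumes "x \<noteq> 0" "peval fermat x = 0" "pevals (cubic_polys z) x \<noteq> 0"
  shows "kernel_map (point_at z) (pt x) = pt (pevals (cubic_polys z) x)"
proof (rule determinantal_pair.kernel_map_eq_pt[OF pair_point assms(1,3)])
  interpret determinantal_pair "point_at z" "image_at z" "point_forms z" fermat "quartic_poly z" unit 4 4
    by (rule pair_point)
  have "z * peval (cubic_polys z j) x = cofactor (point_at z x) 4 j" for j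
  proof -
    have "z * peval (cubic_polys z j) x = peval (cofactor (point_forms z) 4 j) x"
      by (simp add: cofactor_point_matrix[OF Const_z4] cubic_polys_def)
    then show ?thesis by (simp add: peval_cofactor peval_point_forms)
  qed
  then have e: "(\<chi> j. cofactor (point_at z x) 4 j) = z *s pevals (cubic_polys z) x"
    by (simp add: vec_eq_iff pevals_def)
  have "det4 (point_at z x) = 0" using assms(2) by (simp add: det_A)
  from cofactor_row_in_kernel[OF this, of 4]
  have "z * apply4 (point_at z x) (pevals (cubic_polys z) x) k = 0" for k
    unfolding e by (simp add: apply4_def fun_eq_iff sum_distrib_left mult.left_commute)
  then show "apply4 (point_at z x) (pevals (cubic_polys z) x) = (\<lambda>k. 0)"
    using z_nz by auto
qed

end

section \<open>Density of the points where the cubic forms define the map\<close>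

text \<open>
  In a finite field, squaring would be injective if it were surjective, but \<open>1\<close> and \<open>- 1\<close> have the
  same square.
\<close>

lemma infinite_field_if_square_roots:
  assumes "\<And>a::'a::field. \<exists>b. b ^ 2 = a" "(2::'a) \<noteq> 0"
  shows "infinite (UNIV :: 'a set)"
proof
  assume fin: "finite (UNIV :: 'a set)"
  have "surj (\<lambda>b::'a. b ^ 2)" using assms(1) by (metis surjI)
  then have "inj (\<lambda>b::'a. b ^ 2)" using fin by (simp add: finite_UNIV_surj_inj)
  then have "(1::'a) = - 1" by (rule injD) simp
  then have "(2::'a) = 0" by (metis add.left_inverse one_add_one)
  with assms(2) show False by simp
qed

text \<open>
  Restrict \<open>p\<close> to a curve on which the first three coordinates are polynomials in a parameter \<open>t\<close> and
  \<open>x\<^sub>4\<^sup>4 = G(t)\<close>. Collecting the exponents of \<open>x\<^sub>4\<close> modulo four makes \<open>p\<close> a polynomial of degree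
  less than four in \<open>x\<^sub>4\<close>, with coefficients in \<open>K[t]\<close>.
\<close>

lemma residue_class_sum:
  fixes p :: "'a::field poly4" and L :: "4 \<Rightarrow> 'a poly" and G :: "'a poly"
  shows "\<exists>c :: nat \<Rightarrow> 'a poly. \<forall>x t. x $ 1 = poly (L 1) t \<and> x $ 2 = poly (L 2) t \<and> x $ 3 = poly (L 3) t \<and>
       (x $ 4) ^ 4 = poly G t \<longrightarrow> peval p x = (\<Sum>j<4. poly (c j) t * (x $ 4) ^ j)"
proof -
  let ?K = "Poly_Mapping.keys p"
  define w where "w m = Polynomial.smult (Poly_Mapping.lookup p m) (L 1 ^ Poly_Mapping.lookup m 1 *
      L 2 ^ Poly_Mapping.lookup m 2 * L 3 ^ Poly_Mapping.lookup m 3 * G ^ (Poly_Mapping.lookup m 4 div 4))" for m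
  define c where "c j = (\<Sum>m\<in>?K. if Poly_Mapping.lookup m 4 mod 4 = j then w m else 0)" for j
  have "peval p x = (\<Sum>j<4. poly (c j) t * (x $ 4) ^ j)"
    if x: "x $ 1 = poly (L 1) t" "x $ 2 = poly (L 2) t" "x $ 3 = poly (L 3) t" and x4: "(x $ 4) ^ 4 = poly G t"
    for x :: "'a ^ 4" and t
  proof -
    have summand: "Poly_Mapping.lookup p m * mval m x = poly (w m) t * (x $ 4) ^ (Poly_Mapping.lookup m 4 mod 4)" for m
    proof -
      let ?e = "Poly_Mapping.lookup m 4"
      have "(x $ 4) ^ ?e = (x $ 4) ^ (4 * (?e div 4) + ?e mod 4)" by simp
      also have "\<dots> = poly G t ^ (?e div 4) * (x $ 4) ^ (?e mod 4)"
        by (simp only: power_add power_mult x4)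
      finally have e: "(x $ 4) ^ ?e = poly G t ^ (?e div 4) * (x $ 4) ^ (?e mod 4)" .
      have "mval m x = x $ 1 ^ Poly_Mapping.lookup m 1 * x $ 2 ^ Poly_Mapping.lookup m 2
          * x $ 3 ^ Poly_Mapping.lookup m 3 * (x $ 4) ^ ?e"
        unfolding mval_def UNIV_4 by (simp add: idx4_neq mult.assoc)
      then show ?thesis unfolding e by (simp add: w_def x mult.assoc)
    qed
    have "(\<Sum>j<4. poly (c j) t * (x $ 4) ^ j) =
        (\<Sum>j<4. \<Sum>m\<in>?K. if Poly_Mapping.lookup m 4 mod 4 = j then poly (w m) t * (x $ 4) ^ j else 0)"
      unfolding c_def poly_sum sum_distrib_right by (intro sum.cong refl) auto
    also have "\<dots> = (\<Sum>m\<in>?K. \<Sum>j<4. if Poly_Mapping.lookup m 4 mod 4 = j then poly (w m) t * (x $ 4) ^ j else 0)"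
      by (rule sum.swap)
    also have "\<dots> = (\<Sum>m\<in>?K. poly (w m) t * (x $ 4) ^ (Poly_Mapping.lookup m 4 mod 4))"
      by (intro sum.cong refl) simp
    also have "\<dots> = peval p x"
      by (simp add: peval_superset[OF finite_keys order_refl] summand)
    finally show ?thesis ..
  qed
  then show ?thesis by (intro exI[of _ c]) blast
qed

text \<open>
  Inversion of the discrete Fourier transform of order four.
\<close>

lemma fourth_root_filter:
  fixes i a0 a1 a2 a3 :: "'a::field"
  assumes i: "i * i = - 1" and four: "(4::'a) \<noteq> 0"
    and "a0 + a1 + a2 + a3 = 0" "a0 + i * a1 - a2 - i * a3 = 0"
    "a0 - a1 + a2 - a3 = 0" "a0 - i * a1 - a2 + i * a3 = 0"
  shows "a0 = 0 \<and> a1 = 0 \<and> a2 = 0 \<and> a3 = 0"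
proof -
  let ?e0 = "a0 + a1 + a2 + a3" and ?e1 = "a0 + i * a1 - a2 - i * a3"
    and ?e2 = "a0 - a1 + a2 - a3" and ?e3 = "a0 - i * a1 - a2 + i * a3"
  have ii: "i * (i * a) = - a" for a using i by (simp add: mult.assoc[symmetric])
  have "4 * a0 = ?e0 + ?e1 + ?e2 + ?e3" by (simp add: algebra_simps)
  moreover have "4 * a1 = ?e0 - i * ?e1 - ?e2 + i * ?e3" by (simp add: algebra_simps ii)
  moreover have "4 * a2 = ?e0 - ?e1 + ?e2 - ?e3" by (simp add: algebra_simps)
  moreover have "4 * a3 = ?e0 + i * ?e1 - ?e2 - i * ?e3" by (simp add: algebra_simps ii)
  ultimately show ?thesis using four unfolding assms(3-6) by simp
qed

locale eighth_root_closed = eighth_root z for z :: "'a::field" +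
  assumes square_roots: "\<And>a::'a. \<exists>b. b ^ 2 = a"
begin

text \<open>
  Join the projection of \<open>x\<close> to the first three coordinates with a point in direction \<open>v\<close>, and lift
  this line to the Fermat surface. There \<open>p = \<Sum>\<^sub>j c\<^sub>j(t) y\<^sup>j\<close> with \<open>y\<^sup>4 = G(t)\<close>. For \<open>H(t) \<noteq> 0\<close> this
  vanishes for all four choices of \<open>y\<close>, so each \<open>c\<^sub>j(t) y\<^sup>j\<close> vanishes. Its fourth power
  \<open>c\<^sub>j\<^sup>4 G\<^sup>j\<close> is a polynomial in \<open>t\<close>, hence vanishes identically, in particular at \<open>t = 0\<close>, which
  belongs to \<open>x\<close>. This replaces irreducibility of the surface.
\<close>

lemma fermat_polynomial_vanishes:
  fixes x v :: "'a ^ 4" and p :: "'a poly4" and H :: "'a poly"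
  assumes x: "peval fermat x = 0" and H: "H \<noteq> 0"
    and vanish: "\<And>y t. peval fermat y = 0 \<Longrightarrow> y $ 1 = poly [:x $ 1, v $ 1:] t \<Longrightarrow> y $ 2 = poly [:x $ 2, v $ 2:] t
      \<Longrightarrow> y $ 3 = poly [:x $ 3, v $ 3:] t \<Longrightarrow> poly H t \<noteq> 0 \<Longrightarrow> peval p y = 0"
  shows "peval p x = 0"
proof -
  define L where "L i = [:x $ i, v $ i:]" for i
  define G where "G = - (L 1 ^ 4 + L 2 ^ 4 + L 3 ^ 4)"
  obtain c where c: "\<And>y t. y $ 1 = poly (L 1) t \<Longrightarrow> y $ 2 = poly (L 2) t \<Longrightarrow> y $ 3 = poly (L 3) t \<Longrightarrow>
       (y $ 4) ^ 4 = poly G t \<Longrightarrow> peval p y = (\<Sum>j<4. poly (c j) t * (y $ 4) ^ j)"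
    using residue_class_sum[where p = p and L = L and G = G] by blast
  have sum4: "(\<Sum>j<4. f j) = f 0 + f 1 + f 2 + f 3" for f :: "nat \<Rightarrow> 'a"
    by (simp add: eval_nat_numeral)
  have four: "(4::'a) \<noteq> 0" using two_three_smooth[OF six, of 2 0] by simp
  define w where "w = z ^ 2"
  have i: "w * w = - 1" using z4 by (simp add: w_def flip: power_add)
  have zero: "poly (c j) t ^ 4 * poly G t ^ j = 0" if H: "poly H t \<noteq> 0" and j: "j < 4" for t j
  proof -
    obtain b where "b ^ 2 = poly G t" using square_roots by blast
    moreover obtain y where "y ^ 2 = b" using square_roots by blast
    moreover have "y ^ 4 = (y ^ 2) ^ 2" by (simp flip: power_mult)
    ultimately have y: "y ^ 4 = poly G t" by simp
    have val: "(\<Sum>j<4. poly (c j) t * y' ^ j) = 0" if "y' ^ 4 = poly G t" for y'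
    proof -
      define u :: "'a ^ 4" where "u = (\<chi> k. tab4 (poly (L 1) t) (poly (L 2) t) (poly (L 3) t) y' k)"
      have u: "u $ 1 = poly (L 1) t" "u $ 2 = poly (L 2) t" "u $ 3 = poly (L 3) t" "u $ 4 = y'"
        by (simp_all add: u_def)
      have "peval fermat u = 0" by (simp add: peval_fermat u that G_def)
      then have "peval p u = 0" using vanish[of u t] u H by (simp add: L_def)
      then show ?thesis using c[of u t] u that by simp
    qed
    have "w ^ 4 = (w * w) * (w * w)" by (simp only: power4_eq_xxxx mult.assoc)
    then have w4: "w ^ 4 = 1" by (simp add: i)
    have w2: "w ^ 2 = - 1" and w3: "w ^ 3 = - w" by (simp_all add: power2_eq_square power3_eq_cube i)
    have p4: "(- y) ^ 4 = poly G t" "(w * y) ^ 4 = poly G t" "(- (w * y)) ^ 4 = poly G t"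
      using y by (simp_all add: power_mult_distrib w4)
    define a where "a j = poly (c j) t * y ^ j" for j
    have "a 0 + a 1 + a 2 + a 3 = 0" using val[OF y] by (simp add: sum4 a_def)
    moreover have "a 0 + w * a 1 - a 2 - w * a 3 = 0"
      using val[OF p4(2)] by (simp add: sum4 a_def power_mult_distrib w2 w3 algebra_simps)
    moreover have "a 0 - a 1 + a 2 - a 3 = 0"
      using val[OF p4(1)] by (simp add: sum4 a_def algebra_simps)
    moreover have "a 0 - w * a 1 - a 2 + w * a 3 = 0"
      using val[OF p4(3)] by (simp add: sum4 a_def power_mult_distrib w2 w3 algebra_simps)
    ultimately have "a 0 = 0 \<and> a 1 = 0 \<and> a 2 = 0 \<and> a 3 = 0"
      by (rule fourth_root_filter[OF i four])
    moreover have "j = 0 \<or> j = 1 \<or> j = 2 \<or> j = 3" using j by auto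
    ultimately have "a j = 0" by auto
    then have "(a j) ^ 4 = 0" by simp
    moreover have "(a j) ^ 4 = poly (c j) t ^ 4 * poly G t ^ j"
      unfolding a_def power_mult_distrib y[symmetric] power_mult[symmetric] by (simp only: mult.commute)
    ultimately show ?thesis by simp
  qed
  have cj: "c j ^ 4 * G ^ j = 0" if "j < 4" for j
  proof -
    have "poly (c j ^ 4 * G ^ j * H) t = 0" for t
      using zero[of t j] that by (cases "poly H t = 0") auto
    then have "{t. poly (c j ^ 4 * G ^ j * H) t = 0} = UNIV" by blast
    moreover have "infinite (UNIV :: 'a set)"
      using infinite_field_if_square_roots[OF square_roots] two_three_smooth[OF six, of 1 0] by simp
    ultimately have "c j ^ 4 * G ^ j * H = 0" using poly_roots_finite by metis
    then show ?thesis using H by simp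
  qed
  have "(x $ 4) ^ 4 = - ((x $ 1) ^ 4 + (x $ 2) ^ 4 + (x $ 3) ^ 4)"
    using x unfolding peval_fermat eq_neg_iff_add_eq_0 by (simp only: ac_simps)
  also have "\<dots> = poly G 0" by (simp add: G_def L_def)
  finally have G0: "(x $ 4) ^ 4 = poly G 0" .
  have "poly (c j) 0 * (x $ 4) ^ j = 0" if "j < 4" for j
  proof -
    have "(poly (c j) 0 * (x $ 4) ^ j) ^ 4 = poly (c j ^ 4 * G ^ j) 0"
      unfolding poly_mult poly_power power_mult_distrib G0[symmetric] power_mult[symmetric] by (simp only: mult.commute)
    also have "\<dots> = 0" by (simp only: cj[OF that] poly_0)
    finally show ?thesis by simp
  qed
  then have "(\<Sum>j<4. poly (c j) 0 * (x $ 4) ^ j) = 0" by (intro sum.neutral) blast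
  moreover have "peval p x = (\<Sum>j<4. poly (c j) 0 * (x $ 4) ^ j)"
    using G0 by (intro c) (simp_all add: L_def)
  ultimately show ?thesis by simp
qed

text \<open>
  The first two cubics split off linear factors in \<open>x\<^sub>1\<close> and \<open>x\<^sub>3\<close>,
  and a combination of the quotients \<open>g1\<close> and \<open>g2\<close> eliminates \<open>x\<^sub>4\<close>. So a form in
  \<open>x\<^sub>1, x\<^sub>2, x\<^sub>3\<close> alone controls the common zeros.
\<close>

lemma cubics_nonzero:
  assumes "(x3 - z ^ 3 * x1) * (x3 - z * x1) * (x1 - z * x2) * (x1 + z * x2) * (x3 + z * x2) \<noteq> 0"
  shows "cubics z x1 x2 x3 x4 1 \<noteq> 0 \<or> cubics z x1 x2 x3 x4 2 \<noteq> 0"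
proof -
  define g1 where "g1 = (1 + z + z^2)*x1^2 + (-1 - z)*x1*x3 + (z + z^2)*x1*x4 + (1 - z^2 - z^3)*x2^2 + (-z - z^2)*x2*x3 + (z^2 + z^3)*x2*x4 + (z^2)*x3^2 + x4^2"
  define g2 where "g2 = (z^3)*x1^2 + (z + z^2)*x1*x3 + (-1*z^2 - z^3)*x1*x4 + (z)*x2^2 + (z^2 + z^3)*x2*x3 + (1 - z^3)*x2*x4 + (z + z^2 + z^3)*x3^2 + (1 + z - z^3)*x4^2"
  have f: "cubics z x1 x2 x3 x4 1 = (x3 - z ^ 3 * x1) * g1" "cubics z x1 x2 x3 x4 2 = (x3 - z * x1) * g2"
    unfolding cubics_def g1_def g2_def by (simp_all add: power_unfold algebra_simps zeta_rules[OF z4])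
  have "12 * ((x1 - z * x2) * (x1 + z * x2) * (x3 + z * x2)) =
      ((-1 + 2*z - 3*z^2 + 2*z^3)*x1 + (3*z - 3*z^3)*x2 + (2 - z - z^3)*x3 + (1 + 2*z - z^2)*x4) * g1
      + ((-1 - z^2 - 2*z^3)*x1 + (3*z - 6*z^2 + 3*z^3)*x2 + (2 - 3*z + 2*z^2 + z^3)*x3 + (-1 + 2*z - 3*z^2 + 2*z^3)*x4) * g2"
    unfolding g1_def g2_def by (simp add: power_unfold algebra_simps zeta_rules[OF z4])
  moreover have "12 * ((x1 - z * x2) * (x1 + z * x2) * (x3 + z * x2)) \<noteq> 0"
    using assms two_three_smooth[OF six, of 2 1] by simp
  ultimately have "g1 \<noteq> 0 \<or> g2 \<noteq> 0" by auto
  then show ?thesis using assms unfolding f by auto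
qed

lemma cubics_dense: "zariski_dense_in (surface (fermat :: 'a poly4))
    {pt x | x. x \<noteq> 0 \<and> pt x \<in> surface fermat \<and> pevals (cubic_polys z) x \<noteq> 0}"
  (is "zariski_dense_in _ ?U")
  unfolding zariski_dense_in_def
proof (intro conjI allI impI)
  show "?U \<subseteq> surface fermat" by blast
  fix C :: "'a point set" assume C: "zariski_closed C \<and> ?U \<subseteq> C"
  then obtain S where S: "\<And>p. p \<in> S \<Longrightarrow> \<exists>d. homogeneous d p" "C = zero_locus S"
    unfolding zariski_closed_def by blast
  show "surface fermat \<subseteq> C"
  proof
    fix q :: "'a point" assume "q \<in> surface fermat"
    then obtain x where x: "x \<noteq> 0" "q = pt x" "peval fermat x = 0" by (rule surface_ptE)
    have "peval p x = 0" if p: "p \<in> S" for p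
    proof -
      define v :: "'a ^ 4" where "v = (\<chi> k. tab4 (1 - x $ 1) (- (x $ 2)) (1 - x $ 3) 0 k)"
      define L where "L i = [:x $ i, v $ i:]" for i
      define H where "H = (L 3 - Polynomial.smult (z ^ 3) (L 1)) * (L 3 - Polynomial.smult z (L 1)) *
        (L 1 - Polynomial.smult z (L 2)) * (L 1 + Polynomial.smult z (L 2)) * (L 3 + Polynomial.smult z (L 2))"
      (* The line is chosen to pass through (1:0:1), where the form of cubics_nonzero does not vanish. *)
      have L: "poly (L 1) 1 = 1" "poly (L 2) 1 = 0" "poly (L 3) 1 = 1"
        by (simp_all add: L_def v_def)
      have "poly H 1 = (1 - z ^ 3) * (1 - z)"
        unfolding H_def poly_mult poly_diff poly_add poly_smult L by simp
      moreover have "(1 - z ^ 3) * (1 - z) * ((1 + z) * (1 + z ^ 2) * ((1 + z ^ 3) * (1 + z ^ 6))) = 4"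
        by (simp add: eval_nat_numeral algebra_simps zeta_rules[OF z4])
      moreover have "(4::'a) \<noteq> 0" using two_three_smooth[OF six, of 2 0] by simp
      ultimately have H: "H \<noteq> 0" by auto
      show ?thesis
      proof (rule fermat_polynomial_vanishes[OF x(3) H, of v])
        fix y :: "'a ^ 4" and t
        assume y: "peval fermat y = 0" "y $ 1 = poly [:x $ 1, v $ 1:] t" "y $ 2 = poly [:x $ 2, v $ 2:] t"
          "y $ 3 = poly [:x $ 3, v $ 3:] t" and Ht: "poly H t \<noteq> 0"
        have h: "(y $ 3 - z ^ 3 * y $ 1) * (y $ 3 - z * y $ 1) * (y $ 1 - z * y $ 2) * (y $ 1 + z * y $ 2) * (y $ 3 + z * y $ 2) \<noteq> 0"
          using Ht unfolding H_def poly_mult poly_add poly_diff poly_smult L_def y(2-4)[symmetric] .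
        then have y0: "y \<noteq> 0" by auto
        have "peval (cubic_polys z 1) y \<noteq> 0 \<or> peval (cubic_polys z 2) y \<noteq> 0"
        proof -
          have "peval (cubic_polys z 1) y = cubics z (y $ 1) (y $ 2) (y $ 3) (y $ 4) 1"
            "peval (cubic_polys z 2) y = cubics z (y $ 1) (y $ 2) (y $ 3) (y $ 4) 2"
            unfolding cubic_polys_def cubics_def by simp_all
          then show ?thesis using cubics_nonzero[OF h, of "y $ 4"] by simp
        qed
        then have "pevals (cubic_polys z) y \<noteq> 0"
          unfolding pevals_def vec_eq_iff by auto
        then have "pt y \<in> ?U" using y0 y(1) pt_in_surface[OF hom_fermat y0] by blast
        then have "pt y \<in> zero_locus S" using C S(2) by blast
        then show "peval p y = 0" using pt_in_zero_locus[OF S(1) y0] p by blast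
      qed
    qed
    then show "q \<in> C" using pt_in_zero_locus[OF S(1) x(1)] x(2) S(2) by simp
  qed
qed

lemma cubics_give_isomorphism:
  "isomorphism_given_by (surface fermat) (surface (quartic_poly z)) (cubic_polys z)"
  unfolding isomorphism_given_by_def extends_rational_map_def
proof (intro exI[of _ "kernel_map (point_at z)"] conjI kernel_map_iso cubics_dense allI impI)
  show "\<exists>d. \<forall>i. homogeneous d (cubic_polys z i)" using hom_cubics by blast
  fix x :: "'a ^ 4" assume x: "x \<noteq> 0 \<and> pt x \<in> surface fermat \<and> pevals (cubic_polys z) x \<noteq> 0"
  then have "peval fermat x = 0" using pt_in_surface[OF hom_fermat] by blast
  then show "kernel_map (point_at z) (pt x) = pt (pevals (cubic_polys z) x)"
    using x kernel_map_cubics by blast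
qed

end

section \<open>Exact arithmetic in \<open>\<int>[\<zeta>]\<close>\<close>

text \<open>
  The entries are the coordinates with respect to \<open>1, \<zeta>, \<zeta>\<^sup>2, \<zeta>\<^sup>3\<close>, with \<open>\<zeta>\<^sup>4 = - 1\<close>. Such an
  element can be evaluated at a \<open>z\<close> in any field, and identities can be decided by computation.
\<close>

datatype zeta_int = Zeta int int int int

instantiation zeta_int :: comm_ring_1
begin
definition "0 = Zeta 0 0 0 0"
definition "1 = Zeta 1 0 0 0"
fun plus_zeta_int where "Zeta a b c d + Zeta a' b' c' d' = Zeta (a + a') (b + b') (c + c') (d + d')"
fun minus_zeta_int where "Zeta a b c d - Zeta a' b' c' d' = Zeta (a - a') (b - b') (c - c') (d - d')"
fun uminus_zeta_int where "- Zeta a b c d = Zeta (- a) (- b) (- c) (- d)"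
fun times_zeta_int where "Zeta a b c d * Zeta a' b' c' d' =
  Zeta (a * a' - b * d' - c * c' - d * b') (a * b' + b * a' - c * d' - d * c')
    (a * c' + b * b' + c * a' - d * d') (a * d' + b * c' + c * b' + d * a')"
instance
proof
  fix x y w :: zeta_int
  show "x + y + w = x + (y + w)" by (cases x; cases y; cases w) simp
  show "x + y = y + x" by (cases x; cases y) simp
  show "0 + x = x" by (cases x) (simp add: zero_zeta_int_def)
  show "- x + x = 0" by (cases x) (simp add: zero_zeta_int_def)
  show "x - y = x + - y" by (cases x; cases y) simp
  show "x * y * w = x * (y * w)" by (cases x; cases y; cases w) (simp add: algebra_simps)
  show "x * y = y * x" by (cases x; cases y) (simp add: algebra_simps)
  show "1 * x = x" by (cases x) (simp add: one_zeta_int_def)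
  show "(x + y) * w = x * w + y * w" by (cases x; cases y; cases w) (simp add: algebra_simps)
  show "(0::zeta_int) \<noteq> 1" by (simp add: zero_zeta_int_def one_zeta_int_def)
qed
end

fun ev :: "'a::comm_ring_1 \<Rightarrow> zeta_int \<Rightarrow> 'a" where
  "ev z (Zeta a b c d) = of_int a + of_int b * z + of_int c * z ^ 2 + of_int d * z ^ 3"

fun zeta_norm :: "zeta_int \<Rightarrow> int" where
  "zeta_norm (Zeta a b c d) = (a ^ 2 - c ^ 2 + 2 * b * d) ^ 2 + (2 * a * c - b ^ 2 + d ^ 2) ^ 2"

lemma ev_0 [simp]: "ev z 0 = 0" and ev_1 [simp]: "ev z 1 = 1"
  by (simp_all add: zero_zeta_int_def one_zeta_int_def)

lemma ev_add [simp]: "ev z (x + y) = ev z x + ev z y"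
  by (cases x; cases y) (simp add: algebra_simps)

lemma ev_diff [simp]: "ev z (x - y) = ev z x - ev z y"
  by (cases x; cases y) (simp add: algebra_simps)

lemma ev_uminus [simp]: "ev z (- x) = - ev z x"
  by (cases x) (simp add: algebra_simps)

lemma ev_mult: "z ^ 4 = - 1 \<Longrightarrow> ev z (x * y) = ev z x * ev z y"
  by (cases x; cases y) (simp add: power_unfold algebra_simps zeta_rules)

lemma ev_power: "z ^ 4 = - 1 \<Longrightarrow> ev z (x ^ n) = ev z x ^ n"
  by (induction n) (simp_all add: ev_mult)

lemma ev_numeral [simp]: "ev z (numeral n) = numeral n"
proof -
  have "ev z (of_nat k) = of_nat k" for k by (induction k) simp_all
  from this[of "numeral n"] show ?thesis by simp
qed

text \<open>
  The norm from \<open>\<int>[\<zeta>]\<close> to \<open>\<int>\<close> in two steps: the product of \<open>x\<close> with its conjugate under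
  \<open>\<zeta> \<mapsto> - \<zeta>\<close> is of the form \<open>u + v \<zeta>\<^sup>2\<close>, whose norm from \<open>\<int>[\<zeta>\<^sup>2]\<close> is \<open>u\<^sup>2 + v\<^sup>2\<close>.
\<close>

lemma ev_norm:
  assumes "z ^ 4 = - 1"
  shows "\<exists>y. ev z x * y = of_int (zeta_norm x)"
proof (cases x)
  case (Zeta a b c d)
  let ?u = "a ^ 2 - c ^ 2 + 2 * b * d" and ?v = "2 * a * c - b ^ 2 + d ^ 2"
  have "ev z x * (ev z (Zeta a (- b) c (- d)) * ev z (Zeta ?u 0 (- ?v) 0)) =
      ev z (x * (Zeta a (- b) c (- d) * Zeta ?u 0 (- ?v) 0))"
    by (simp only: ev_mult[OF assms])
  also have "x * (Zeta a (- b) c (- d) * Zeta ?u 0 (- ?v) 0) = Zeta (zeta_norm x) 0 0 0"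
    unfolding Zeta by (simp add: power2_eq_square algebra_simps)
  finally show ?thesis by auto
qed

lemma ev_nonzero:
  fixes z :: "'a::field"
  assumes "z ^ 4 = - 1" "(6::'a) \<noteq> 0" "zeta_norm x dvd 6 ^ n"
  shows "ev z x \<noteq> 0"
proof
  assume "ev z x = 0"
  moreover obtain y where "ev z x * y = of_int (zeta_norm x)" using ev_norm[OF assms(1)] by blast
  ultimately have "of_int (zeta_norm x) = (0::'a)" by simp
  moreover obtain m where "6 ^ n = zeta_norm x * m" using assms(3) by blast
  then have "(6::'a) ^ n = of_int (zeta_norm x) * of_int m" by (metis of_int_mult of_int_numeral of_int_power)
  ultimately have "(6::'a) ^ n = 0" by simp
  then show False using assms(2) by simp
qed

section \<open>A table of 56 lines\<close>

text \<open>
  The Schubert cells of the space of lines: a line is the kernel of a unique 2 by 4 matrix in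
  row-reduced echelon form, the constructor names the pivot columns, and the arguments are the free
  entries. The pivots 3 and 4 belong to the line \<open>y\<^sub>3 = y\<^sub>4 = 0\<close> alone, which does not lie on the surface.
\<close>

datatype 'r cell = C12 'r 'r 'r 'r | C13 'r 'r 'r | C14 'r 'r | C23 'r 'r | C24 'r

text \<open>
  The table uses pairs \<open>(x, k)\<close> for the elements \<open>x / 3\<^sup>k\<close> of \<open>\<int>[\<zeta>, 1/3]\<close>.
\<close>

definition zfrac :: "'a::field \<Rightarrow> zeta_int \<times> nat \<Rightarrow> 'a" where
  "zfrac z r = ev z (fst r) / 3 ^ snd r"

text \<open>
  A cell \<open>C12 a b c d\<close> is the line \<open>y\<^sub>1 = a y\<^sub>3 + b y\<^sub>4\<close>, \<open>y\<^sub>2 = c y\<^sub>3 + d y\<^sub>4\<close>. The lists follow the case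
  distinction of \<open>chart_classification\<close>, according to which of \<open>a, b, c, d\<close> are zero.
\<close>

definition lines_axis_exchange :: "(zeta_int \<times> nat) cell list" where
  "lines_axis_exchange = [
     C12 (Zeta 0 0 0 0, 0) (Zeta 1 1 0 1, 0) (Zeta (-1) 1 0 1, 1) (Zeta 0 0 0 0, 0),
     C12 (Zeta 0 0 0 0, 0) (Zeta (-1) (-1) 0 1, 0) (Zeta (-1) (-1) 0 1, 0) (Zeta 0 0 0 0, 0),
     C12 (Zeta 0 0 0 0, 0) (Zeta (-1) 1 0 1, 1) (Zeta 1 1 0 1, 0) (Zeta 0 0 0 0, 0),
     C12 (Zeta 0 0 0 0, 0) (Zeta 0 0 (-1) 0, 0) (Zeta 0 0 1 0, 0) (Zeta 0 0 0 0, 0),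
     C12 (Zeta 0 0 0 0, 0) (Zeta 0 0 1 0, 0) (Zeta 0 0 (-1) 0, 0) (Zeta 0 0 0 0, 0),
     C12 (Zeta 0 0 0 0, 0) (Zeta 0 1 (-1) 1, 0) (Zeta 0 1 (-1) 1, 0) (Zeta 0 0 0 0, 0),
     C12 (Zeta 0 0 0 0, 0) (Zeta (-1) 1 0 (-1), 0) (Zeta (-1) 1 0 (-1), 0) (Zeta 0 0 0 0, 0),
     C12 (Zeta 0 0 0 0, 0) (Zeta 0 1 1 1, 0) (Zeta 0 1 1 1, 0) (Zeta 0 0 0 0, 0)]"

definition lines_first_axis :: "(zeta_int \<times> nat) cell list" where
  "lines_first_axis = [
     C12 (Zeta 0 0 0 0, 0) (Zeta 0 0 0 0, 0) (Zeta 1 1 0 1, 1) (Zeta 0 (-1) 1 1, 1),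
     C12 (Zeta 0 0 0 0, 0) (Zeta 0 0 0 0, 0) (Zeta 1 1 0 1, 1) (Zeta 0 1 (-1) (-1), 1)]"

definition lines_last_axis :: "(zeta_int \<times> nat) cell list" where
  "lines_last_axis = [
     C12 (Zeta 0 (-1) 1 1, 1) (Zeta 1 1 0 1, 1) (Zeta 0 0 0 0, 0) (Zeta 0 0 0 0, 0),
     C12 (Zeta 0 1 (-1) (-1), 1) (Zeta 1 1 0 1, 1) (Zeta 0 0 0 0, 0) (Zeta 0 0 0 0, 0)]"

definition lines_axis_preserving :: "(zeta_int \<times> nat) cell list" where
  "lines_axis_preserving = [
     C12 (Zeta 1 0 0 0, 0) (Zeta 0 0 0 0, 0) (Zeta 0 0 0 0, 0) (Zeta (-1) 0 0 0, 0),
     C12 (Zeta 0 0 1 0, 0) (Zeta 0 0 0 0, 0) (Zeta 0 0 0 0, 0) (Zeta 0 0 (-1) 0, 0),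
     C12 (Zeta 0 0 (-1) 0, 0) (Zeta 0 0 0 0, 0) (Zeta 0 0 0 0, 0) (Zeta 0 0 1 0, 0),
     C12 (Zeta (-1) 0 0 0, 0) (Zeta 0 0 0 0, 0) (Zeta 0 0 0 0, 0) (Zeta 1 0 0 0, 0)]"

definition lines_first_zero :: "(zeta_int \<times> nat) cell list" where
  "lines_first_zero = [
     C12 (Zeta 0 0 0 0, 0) (Zeta 0 1 (-1) 1, 0) (Zeta 1 1 0 (-1), 0) (Zeta 1 0 1 0, 0),
     C12 (Zeta 0 0 0 0, 0) (Zeta 0 1 (-1) 1, 0) (Zeta 1 1 0 (-1), 0) (Zeta (-1) 0 (-1) 0, 0),
     C12 (Zeta 0 0 0 0, 0) (Zeta 0 1 1 1, 0) (Zeta 1 (-1) 0 1, 0) (Zeta (-1) 0 1 0, 0),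
     C12 (Zeta 0 0 0 0, 0) (Zeta 0 1 1 1, 0) (Zeta 1 (-1) 0 1, 0) (Zeta 1 0 (-1) 0, 0)]"

definition lines_last_zero :: "(zeta_int \<times> nat) cell list" where
  "lines_last_zero = [
     C12 (Zeta (-1) 0 1 0, 0) (Zeta 1 (-1) 0 1, 0) (Zeta 0 1 1 1, 0) (Zeta 0 0 0 0, 0),
     C12 (Zeta 1 0 1 0, 0) (Zeta 1 1 0 (-1), 0) (Zeta 0 1 (-1) 1, 0) (Zeta 0 0 0 0, 0),
     C12 (Zeta (-1) 0 (-1) 0, 0) (Zeta 1 1 0 (-1), 0) (Zeta 0 1 (-1) 1, 0) (Zeta 0 0 0 0, 0),
     C12 (Zeta 1 0 (-1) 0, 0) (Zeta 1 (-1) 0 1, 0) (Zeta 0 1 1 1, 0) (Zeta 0 0 0 0, 0)]"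

definition lines_second_zero :: "(zeta_int \<times> nat) cell list" where
  "lines_second_zero = [
     C12 (Zeta 0 1 0 0, 0) (Zeta 0 0 0 0, 0) (Zeta (-1) 1 0 0, 0) (Zeta 0 (-1) 1 (-1), 0),
     C12 (Zeta 0 0 0 (-1), 0) (Zeta 0 0 0 0, 0) (Zeta (-1) 0 0 1, 0) (Zeta 0 1 1 1, 0),
     C12 (Zeta 0 0 0 1, 0) (Zeta 0 0 0 0, 0) (Zeta (-1) 0 0 1, 0) (Zeta 0 (-1) (-1) (-1), 0),
     C12 (Zeta 0 (-1) 0 0, 0) (Zeta 0 0 0 0, 0) (Zeta (-1) 1 0 0, 0) (Zeta 0 1 (-1) 1, 0)]"

definition lines_third_zero :: "(zeta_int \<times> nat) cell list" where
  "lines_third_zero = [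
     C12 (Zeta 0 1 1 1, 0) (Zeta (-1) 0 0 1, 0) (Zeta 0 0 0 0, 0) (Zeta 0 0 0 (-1), 0),
     C12 (Zeta 0 1 (-1) 1, 0) (Zeta (-1) 1 0 0, 0) (Zeta 0 0 0 0, 0) (Zeta 0 (-1) 0 0, 0),
     C12 (Zeta 0 (-1) 1 (-1), 0) (Zeta (-1) 1 0 0, 0) (Zeta 0 0 0 0, 0) (Zeta 0 1 0 0, 0),
     C12 (Zeta 0 (-1) (-1) (-1), 0) (Zeta (-1) 0 0 1, 0) (Zeta 0 0 0 0, 0) (Zeta 0 0 0 1, 0)]"

definition lines_generic :: "(zeta_int \<times> nat) cell list" where
  "lines_generic = [
     C12 (Zeta 0 1 2 (-1), 1) (Zeta (-1) 2 0 2, 1) (Zeta (-1) 2 0 2, 1) (Zeta 0 (-1) (-2) 1, 1),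
     C12 (Zeta (-1) 1 0 0, 0) (Zeta 0 1 0 0, 0) (Zeta (-1) 1 1 0, 0) (Zeta 0 1 1 0, 0),
     C12 (Zeta 1 0 0 (-1), 0) (Zeta 0 0 0 1, 0) (Zeta (-1) 0 (-1) 1, 0) (Zeta 0 0 1 (-1), 0),
     C12 (Zeta 0 1 0 (-1), 0) (Zeta (-1) 0 0 0, 0) (Zeta (-1) 0 0 0, 0) (Zeta 0 1 0 (-1), 0),
     C12 (Zeta 0 0 (-1) 1, 0) (Zeta (-1) 0 (-1) 1, 0) (Zeta 0 0 0 1, 0) (Zeta (-1) 0 0 1, 0),
     C12 (Zeta 0 0 1 0, 0) (Zeta 0 1 0 1, 0) (Zeta 0 1 0 1, 0) (Zeta 0 0 1 0, 0),
     C12 (Zeta 0 1 1 0, 0) (Zeta (-1) 1 1 0, 0) (Zeta 0 1 0 0, 0) (Zeta (-1) 1 0 0, 0),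
     C12 (Zeta 0 (-1) (-1) 0, 0) (Zeta (-1) 1 1 0, 0) (Zeta 0 1 0 0, 0) (Zeta 1 (-1) 0 0, 0),
     C12 (Zeta 0 0 (-1) 0, 0) (Zeta 0 1 0 1, 0) (Zeta 0 1 0 1, 0) (Zeta 0 0 (-1) 0, 0),
     C12 (Zeta 0 0 1 (-1), 0) (Zeta (-1) 0 (-1) 1, 0) (Zeta 0 0 0 1, 0) (Zeta 1 0 0 (-1), 0),
     C12 (Zeta 0 (-1) 0 1, 0) (Zeta (-1) 0 0 0, 0) (Zeta (-1) 0 0 0, 0) (Zeta 0 (-1) 0 1, 0),
     C12 (Zeta (-1) 0 0 1, 0) (Zeta 0 0 0 1, 0) (Zeta (-1) 0 (-1) 1, 0) (Zeta 0 0 (-1) 1, 0),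
     C12 (Zeta 1 (-1) 0 0, 0) (Zeta 0 1 0 0, 0) (Zeta (-1) 1 1 0, 0) (Zeta 0 (-1) (-1) 0, 0),
     C12 (Zeta 0 (-1) (-2) 1, 1) (Zeta (-1) 2 0 2, 1) (Zeta (-1) 2 0 2, 1) (Zeta 0 1 2 (-1), 1)]"

definition lines_meeting_axis :: "(zeta_int \<times> nat) cell list" where
  "lines_meeting_axis = [
     C13 (Zeta 0 0 1 0, 0) (Zeta 1 (-1) 0 (-1), 0) (Zeta 0 0 0 0, 0),
     C13 (Zeta 0 0 1 0, 0) (Zeta 0 0 0 0, 0) (Zeta 0 0 (-1) 0, 0),
     C14 (Zeta 0 0 1 0, 0) (Zeta 0 1 1 (-1), 0),
     C13 (Zeta 0 0 (-1) 0, 0) (Zeta 1 (-1) 0 (-1), 0) (Zeta 0 0 0 0, 0),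
     C13 (Zeta 0 0 (-1) 0, 0) (Zeta 0 0 0 0, 0) (Zeta 0 0 1 0, 0),
     C14 (Zeta 0 0 (-1) 0, 0) (Zeta 0 (-1) (-1) 1, 0),
     C13 (Zeta 0 0 0 0, 0) (Zeta 0 0 0 0, 0) (Zeta 0 0 0 0, 0),
     C14 (Zeta 0 0 0 0, 0) (Zeta 0 0 0 0, 0),
     C23 (Zeta 0 0 0 0, 0) (Zeta 0 0 0 0, 0),
     C24 (Zeta 0 0 0 0, 0)]"

definition line_table :: "(zeta_int \<times> nat) cell list" where
  "line_table = lines_axis_exchange @ lines_first_axis @ lines_last_axis @ lines_axis_preserving @ lines_first_zero @ lines_last_zero @ lines_second_zero @ lines_third_zero @ lines_generic @ lines_meeting_axis"

text \<open>
  The difference, up to a power of 3, has a norm that divides a power of 6; the exponent 20 is large enough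
  for all entries of the table.
\<close>

fun separated :: "zeta_int \<times> nat \<Rightarrow> zeta_int \<times> nat \<Rightarrow> bool" where
  "separated (x, k) (y, l) \<longleftrightarrow> zeta_norm (x * Zeta (3 ^ l) 0 0 0 - y * Zeta (3 ^ k) 0 0 0) dvd 6 ^ 20"

fun separated_cells :: "(zeta_int \<times> nat) cell \<Rightarrow> (zeta_int \<times> nat) cell \<Rightarrow> bool" where
  "separated_cells (C12 a b c d) (C12 a' b' c' d') \<longleftrightarrow>
     separated a a' \<or> separated b b' \<or> separated c c' \<or> separated d d'"
| "separated_cells (C13 a b c) (C13 a' b' c') \<longleftrightarrow> separated a a' \<or> separated b b' \<or> separated c c'"
| "separated_cells (C14 a b) (C14 a' b') \<longleftrightarrow> separated a a' \<or> separated b b'"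
| "separated_cells (C23 a b) (C23 a' b') \<longleftrightarrow> separated a a' \<or> separated b b'"
| "separated_cells (C24 a) (C24 a') \<longleftrightarrow> separated a a'"
| "separated_cells _ _ \<longleftrightarrow> True"

text \<open>
  Multiplication by 3 clears the denominators of the table.
\<close>

definition scaled :: "zeta_int \<times> nat \<Rightarrow> zeta_int" where
  "scaled r = fst r * (if snd r = 0 then Zeta 3 0 0 0 else 1)"

text \<open>
  All four coordinates of the point with parameters \<open>(m : n)\<close> are multiplied by 3.
\<close>

definition vanishes_at :: "zeta_int \<Rightarrow> zeta_int \<Rightarrow> zeta_int \<Rightarrow> zeta_int \<Rightarrow> int \<times> int \<Rightarrow> bool" where
  "vanishes_at a b c d = (\<lambda>(m, n). let u = Zeta m 0 0 0; v = Zeta n 0 0 0 in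
     quartic (Zeta 0 1 0 0) (a * u + b * v) (c * u + d * v) (Zeta 3 0 0 0 * u) (Zeta 3 0 0 0 * v) = 0)"

text \<open>
  A form of degree four in two variables that vanishes at these five points is zero, provided that 6
  is invertible.
\<close>

fun chart_check :: "(zeta_int \<times> nat) cell \<Rightarrow> bool" where
  "chart_check (C12 a b c d) \<longleftrightarrow> snd a \<le> 1 \<and> snd b \<le> 1 \<and> snd c \<le> 1 \<and> snd d \<le> 1 \<and>
     list_all (vanishes_at (scaled a) (scaled b) (scaled c) (scaled d)) [(1,0), (0,1), (1,1), (1,-1), (1,2)]"
| "chart_check _ \<longleftrightarrow> True"

lemma separated_table: "sorted_wrt separated_cells line_table"
  by code_simp

lemma chart_table: "list_all chart_check line_table"
  by code_simp

lemma length_table: "length line_table = 56"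
  by code_simp

section \<open>Lines in Schubert cells\<close>

fun cell_rows :: "'a::field cell \<Rightarrow> (4 \<Rightarrow> 'a) \<times> (4 \<Rightarrow> 'a)" where
  "cell_rows (C12 a b c d) = (tab4 1 0 (- a) (- b), tab4 0 1 (- c) (- d))"
| "cell_rows (C13 a b c) = (tab4 1 a 0 b, tab4 0 0 1 c)"
| "cell_rows (C14 a b) = (tab4 1 a b 0, tab4 0 0 0 1)"
| "cell_rows (C23 b c) = (tab4 0 1 0 b, tab4 0 0 1 c)"
| "cell_rows (C24 a) = (tab4 0 1 a 0, tab4 0 0 0 1)"

definition cell_matrix :: "'a::field cell \<Rightarrow> 'a ^ 4 ^ 2" where
  "cell_matrix C = (\<chi> i j. if i = 1 then fst (cell_rows C) j else snd (cell_rows C) j)"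

fun cell_point :: "'a::field cell \<Rightarrow> 'a \<Rightarrow> 'a \<Rightarrow> 4 \<Rightarrow> 'a" where
  "cell_point (C12 a b c d) u v = tab4 (a * u + b * v) (c * u + d * v) u v"
| "cell_point (C13 a b c) u v = tab4 (- a * u - b * v) u (- c * v) v"
| "cell_point (C14 a b) u v = tab4 (- a * u - b * v) u v 0"
| "cell_point (C23 b c) u v = tab4 u (- b * v) (- c * v) v"
| "cell_point (C24 a) u v = tab4 u (- a * v) v 0"

definition cell_vec :: "'a::field cell \<Rightarrow> 'a \<Rightarrow> 'a \<Rightarrow> 'a ^ 4" where
  "cell_vec C u v = (\<chi> i. cell_point C u v i)"

definition cell_line :: "'a::field cell \<Rightarrow> 'a point set" where
  "cell_line C = kernel_line (cell_matrix C)"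

text \<open>
  The two non-pivot coordinates parametrise the kernel.
\<close>

lemma cell_matrix_kernel: "cell_matrix C *v y = 0 \<longleftrightarrow> (\<exists>u v. y = cell_vec C u v)"
proof -
  have "cell_matrix C *v y = 0 \<longleftrightarrow> (\<Sum>j\<in>UNIV. fst (cell_rows C) j * y $ j) = 0 \<and> (\<Sum>j\<in>UNIV. snd (cell_rows C) j * y $ j) = 0"
    by (simp add: vec_eq_iff forall_2 matrix_vector_mult_def cell_matrix_def)
  also have "\<dots> \<longleftrightarrow> (\<exists>u v. y = cell_vec C u v)"
  proof
    assume "(\<Sum>j\<in>UNIV. fst (cell_rows C) j * y $ j) = 0 \<and> (\<Sum>j\<in>UNIV. snd (cell_rows C) j * y $ j) = 0"
    then have rows: "(\<Sum>j\<in>UNIV. fst (cell_rows C) j * y $ j) = 0" "(\<Sum>j\<in>UNIV. snd (cell_rows C) j * y $ j) = 0"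
      by blast+
    show "\<exists>u v. y = cell_vec C u v"
    proof (cases C)
      case (C12 a b c d)
      have "y $ 1 - (a * y $ 3 + b * y $ 4) = 0" "y $ 2 - (c * y $ 3 + d * y $ 4) = 0"
        using rows by (simp_all add: C12 sum_4 algebra_simps)
      then have "y = cell_vec C (y $ 3) (y $ 4)"
        unfolding right_minus_eq by (simp add: C12 cell_vec_def vec_eq_iff forall_4)
      then show ?thesis by blast
    next
      case (C13 a b c)
      have "y $ 1 - (- a * y $ 2 - b * y $ 4) = 0" "y $ 3 - (- c * y $ 4) = 0"
        using rows by (simp_all add: C13 sum_4 algebra_simps)
      then have "y = cell_vec C (y $ 2) (y $ 4)"
        unfolding right_minus_eq by (simp add: C13 cell_vec_def vec_eq_iff forall_4)
      then show ?thesis by blast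
    next
      case (C14 a b)
      have "y $ 1 - (- a * y $ 2 - b * y $ 3) = 0" "y $ 4 = 0"
        using rows by (simp_all add: C14 sum_4 algebra_simps)
      then have "y = cell_vec C (y $ 2) (y $ 3)"
        unfolding right_minus_eq by (simp add: C14 cell_vec_def vec_eq_iff forall_4)
      then show ?thesis by blast
    next
      case (C23 b c)
      have "y $ 2 - (- b * y $ 4) = 0" "y $ 3 - (- c * y $ 4) = 0"
        using rows by (simp_all add: C23 sum_4 algebra_simps)
      then have "y = cell_vec C (y $ 1) (y $ 4)"
        unfolding right_minus_eq by (simp add: C23 cell_vec_def vec_eq_iff forall_4)
      then show ?thesis by blast
    next
      case (C24 a)
      have "y $ 2 - (- a * y $ 3) = 0" "y $ 4 = 0"
        using rows by (simp_all add: C24 sum_4 algebra_simps)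
      then have "y = cell_vec C (y $ 1) (y $ 3)"
        unfolding right_minus_eq by (simp add: C24 cell_vec_def vec_eq_iff forall_4)
      then show ?thesis by blast
    qed
  next
    assume "\<exists>u v. y = cell_vec C u v"
    then show "(\<Sum>j\<in>UNIV. fst (cell_rows C) j * y $ j) = 0 \<and> (\<Sum>j\<in>UNIV. snd (cell_rows C) j * y $ j) = 0"
      by (cases C) (auto simp: sum_4 cell_vec_def)
  qed
  finally show ?thesis .
qed

lemma cell_vec_combination: "cell_vec C u v = u *s cell_vec C 1 0 + v *s cell_vec C 0 1"
  by (cases C) (simp_all add: vec_eq_iff forall_4 cell_vec_def algebra_simps)

lemma cell_vec_eq_0: "cell_vec C u v = 0 \<longleftrightarrow> u = 0 \<and> v = 0"
  by (cases C) (auto simp: vec_eq_iff forall_4 cell_vec_def)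

lemma cell_line_eq: "cell_line C = {q \<in> P3. q \<subseteq> {cell_vec C u v | u v. True}}"
  unfolding cell_line_def kernel_line_def cell_matrix_kernel by blast

lemma subspace_cell: "vec.subspace {cell_vec C u v | u v. True}"
proof -
  have "{cell_vec C u v | u v. True} = {y. cell_matrix C *v y = 0}"
    by (auto simp: cell_matrix_kernel)
  also have "vec.subspace \<dots>"
    unfolding vec.subspace_def
    by (simp add: matrix_vector_right_distrib vector_scalar_commute)
  finally show ?thesis .
qed

lemma dim_cell: "vec.dim {cell_vec C u v | u v. True} = 2"
proof -
  let ?B = "{cell_vec C 1 0, cell_vec C 0 1}"
  have ne: "cell_vec C 1 0 \<noteq> cell_vec C 0 1"
    by (cases C) (simp_all add: vec_eq_iff forall_4 cell_vec_def)
  have "\<not> vec.dependent ?B"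
  proof (rule vec.independent_insertI)
    show "\<not> vec.dependent {cell_vec C 0 1}"
      by (simp add: vec.dependent_single cell_vec_eq_0)
    show "cell_vec C 1 0 \<notin> vec.span {cell_vec C 0 1}"
    proof
      assume "cell_vec C 1 0 \<in> vec.span {cell_vec C 0 1}"
      then obtain k where "cell_vec C 1 0 = k *s cell_vec C 0 1" by (auto simp: vec.span_singleton)
      then have "cell_vec C 1 (- k) = 0" by (subst cell_vec_combination) simp
      then show False by (simp add: cell_vec_eq_0)
    qed
  qed
  moreover have "{cell_vec C u v | u v. True} = vec.span ?B"
  proof -
    have "vec.span ?B = {x. \<exists>k l. x = k *s cell_vec C 1 0 + l *s cell_vec C 0 1}"
      unfolding vec.span_insert vec.span_singleton by (auto simp: diff_eq_eq add.commute)
    then show ?thesis by (subst cell_vec_combination) auto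
  qed
  ultimately show ?thesis using ne by (simp add: vec.dim_span vec.dim_eq_card_independent)
qed

lemma proj_line_cell: "proj_line (cell_line C)"
  unfolding proj_line_def using subspace_cell dim_cell cell_line_eq by blast

lemma pt_in_cell_line: "y \<noteq> 0 \<Longrightarrow> pt y \<in> cell_line C \<longleftrightarrow> (\<exists>u v. y = cell_vec C u v)"
proof -
  assume y: "y \<noteq> 0"
  have "pt y \<subseteq> {cell_vec C u v | u v. True} \<longleftrightarrow> y \<in> {cell_vec C u v | u v. True}"
    unfolding pt_def using vec.span_minimal[OF _ subspace_cell, of "{y}" C] vec.span_base[of y "{y}"] by blast
  then show ?thesis using pt_in_P3[OF y] by (auto simp: cell_line_eq)
qed

lemma cell_line_inj: "cell_line C = cell_line C' \<Longrightarrow> C = C'"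
proof -
  assume eq: "cell_line C = cell_line C'"
  have "\<exists>u' v'. cell_vec C u v = cell_vec C' u' v'" if "u \<noteq> 0 \<or> v \<noteq> 0" for u v
  proof -
    have "cell_vec C u v \<noteq> 0" using that by (simp add: cell_vec_eq_0)
    then show ?thesis using eq pt_in_cell_line[of "cell_vec C u v" C] pt_in_cell_line[of "cell_vec C u v" C'] by blast
  qed
  from this[of 1 0] this[of 0 1] show "C = C'"
    by (cases C; cases C') (auto simp: vec_eq_iff forall_4 cell_vec_def)
qed

lemma cell_line_subset_surface:
  assumes "homogeneous d p"
  shows "cell_line C \<subseteq> surface p \<longleftrightarrow> (\<forall>u v. peval p (cell_vec C u v) = 0)"
proof
  assume sub: "cell_line C \<subseteq> surface p"
  show "\<forall>u v. peval p (cell_vec C u v) = 0"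
  proof (intro allI)
    fix u v
    show "peval p (cell_vec C u v) = 0"
    proof (cases "cell_vec C u v = 0")
      case True
      have "pt (cell_vec C 1 0) \<in> surface p"
        using sub pt_in_cell_line[of "cell_vec C 1 0" C] by (auto simp: cell_vec_eq_0)
      then have "peval p (cell_vec C 1 0) = 0"
        using pt_in_surface[OF assms, of "cell_vec C 1 0"] by (simp add: cell_vec_eq_0)
      then have "peval p (0 *s cell_vec C 1 0) = 0"
        unfolding peval_scale[OF assms] by (simp only: mult_zero_right)
      then show ?thesis using True by simp
    next
      case False
      then show ?thesis using sub pt_in_cell_line[OF False, of C] pt_in_surface[OF assms False] by blast
    qed
  qed
next
  assume *: "\<forall>u v. peval p (cell_vec C u v) = 0"
  show "cell_line C \<subseteq> surface p"
  proof
    fix q assume q: "q \<in> cell_line C"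
    then obtain y where y: "y \<noteq> 0" "q = pt y" unfolding cell_line_eq by (auto elim: P3_ptE)
    then obtain u v where "y = cell_vec C u v" using q pt_in_cell_line by blast
    then show "q \<in> surface p" using * y pt_in_surface[OF assms y(1)] by simp
  qed
qed

context eighth_root
begin

definition lines :: "'a cell list" where
  "lines = map (map_cell (zfrac z)) line_table"

lemma three: "(3::'a) \<noteq> 0" using two_three_smooth[OF six, of 0 1] by simp
lemma two: "(2::'a) \<noteq> 0" using two_three_smooth[OF six, of 1 0] by simp

lemma separated_frac: "separated r r' \<Longrightarrow> zfrac z r \<noteq> zfrac z r'"
proof -
  assume sep: "separated r r'"
  obtain x k y l where r: "r = (x, k)" "r' = (y, l)" by (cases r; cases r')
  have "ev z (x * Zeta (3 ^ l) 0 0 0 - y * Zeta (3 ^ k) 0 0 0) \<noteq> 0"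
    using sep r by (intro ev_nonzero[OF z4 six, of _ 20]) simp
  then have "ev z x * 3 ^ l \<noteq> ev z y * 3 ^ k" by (simp add: ev_mult[OF z4])
  then show ?thesis using three by (simp add: r zfrac_def frac_eq_eq)
qed

lemma separated_cells_frac: "separated_cells C C' \<Longrightarrow> map_cell (zfrac z) C \<noteq> map_cell (zfrac z) C'"
  by (induction C C' rule: separated_cells.induct) (auto dest: separated_frac)

text \<open>
  Distinct cells give distinct lines, and two entries of the table that differ in \<open>\<int>[\<zeta>, 1/3]\<close> by a number of
  norm \<open>2\<^sup>a 3\<^sup>b\<close> stay different after evaluation at any \<open>z\<close>.
\<close>

lemma distinct_lines: "distinct lines"
proof -
  have "distinct (map f xs)" if "sorted_wrt R xs" "\<And>x y. R x y \<Longrightarrow> f x \<noteq> f y" for R xs and f :: "'b \<Rightarrow> 'c"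
    using that(1) by (induction xs) (auto dest: that(2))
  from this[OF separated_table separated_cells_frac] show ?thesis unfolding lines_def .
qed

lemma card_lines: "card (cell_line ` set lines) = 56"
proof -
  have "card (cell_line ` set lines) = card (set lines)"
    by (rule card_image) (simp add: inj_on_def cell_line_inj)
  then show ?thesis
    by (simp add: distinct_card[OF distinct_lines]) (simp add: lines_def length_table)
qed

lemma quartic_on_chart:
  "quartic z (a * u + b * v) (c * u + d * v) u v =
     (a^3*c + a*c^3 + (- 1 - 2*z - 2*z^3)*(a*c) + (2 - 2*z - 2*z^3)*(a*c^2)) * u^4
   + (a^3*d + 3*a^2*b*c + 3*a*c^2*d + b*c^3 + 1 + (- 1 - 2*z - 2*z^3)*(a^2 + a*d + b*c + c^2)
      + (2 - 2*z - 2*z^3)*(a^2*c + 2*a*c*d + b*c^2 - c)) * (u^3 * v)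
   + (3*a^2*b*d + 3*a*b^2*c + 3*a*c*d^2 + 3*b*c^2*d + (- 1 - 2*z - 2*z^3)*(2*a*b + a*c + b*d + 2*c*d)
      + (2 - 2*z - 2*z^3)*(a^2*d + 2*a*b*c + a*d^2 - a + 2*b*c*d - d)) * (u^2 * v^2)
   + (3*a*b^2*d + a*d^3 + b^3*c + 3*b*c*d^2 + 1 + (- 1 - 2*z - 2*z^3)*(a*d + b^2 + b*c + d^2)
      + (2 - 2*z - 2*z^3)*(2*a*b*d + b^2*c + b*d^2 - b)) * (u * v^3)
   + (b^3*d + b*d^3 + (- 1 - 2*z - 2*z^3)*(b*d) + (2 - 2*z - 2*z^3)*(b^2*d)) * v^4"
proof -
  define A B where "A = - 1 - 2*z - 2*z^3" and "B = 2 - 2*z - 2*z^3"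
  show ?thesis unfolding quartic_def A_def[symmetric] B_def[symmetric]
    by (simp add: power_unfold algebra_simps)
qed

lemma binary_quartic_zero:
  fixes e0 e1 e2 e3 e4 :: 'a
  assumes "\<And>u v. (u, v) \<in> {(1,0), (0,1), (1,1), (1,-1), (1,2)} \<Longrightarrow>
    e0 * u^4 + e1 * (u^3 * v) + e2 * (u^2 * v^2) + e3 * (u * v^3) + e4 * v^4 = 0"
  shows "e0 = 0 \<and> e1 = 0 \<and> e2 = 0 \<and> e3 = 0 \<and> e4 = 0"
proof -
  have 0: "e0 = 0" "e4 = 0" using assms[of 1 0] assms[of 0 1] by simp_all
  have 1: "e1 + e2 + e3 = 0" "- e1 + e2 - e3 = 0" "2 * e1 + 4 * e2 + 8 * e3 = 0"
    subgoal using assms[of 1 1] by (simp add: 0)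
    subgoal using assms[of 1 "-1"] by (simp add: 0)
    subgoal using assms[of 1 2] by (simp add: 0 mult.commute)
    done
  have "2 * e2 = (e1 + e2 + e3) + (- e1 + e2 - e3)" by simp
  then have e2: "e2 = 0" unfolding 1 using two by simp
  have "6 * e3 = (2 * e1 + 4 * e2 + 8 * e3) - 2 * (e1 + e2 + e3)" by (simp add: e2)
  then have e3: "e3 = 0" unfolding 1 using six by simp
  show ?thesis using 0 e2 e3 1(1) by simp
qed

text \<open>
  A line of the cell lies on the surface iff five coefficients vanish. The five points suffice to extract them.
\<close>

lemma chart_coefficients:
  assumes "\<And>u v. (u, v) \<in> {(1,0), (0,1), (1,1), (1,-1), (1,2)} \<Longrightarrow> quartic z (a * u + b * v) (c * u + d * v) u v = 0"
  shows "a^3*c + a*c^3 + (- 1 - 2*z - 2*z^3)*(a*c) + (2 - 2*z - 2*z^3)*(a*c^2) = 0 \<and>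
    a^3*d + 3*a^2*b*c + 3*a*c^2*d + b*c^3 + 1 + (- 1 - 2*z - 2*z^3)*(a^2 + a*d + b*c + c^2)
      + (2 - 2*z - 2*z^3)*(a^2*c + 2*a*c*d + b*c^2 - c) = 0 \<and>
    3*a^2*b*d + 3*a*b^2*c + 3*a*c*d^2 + 3*b*c^2*d + (- 1 - 2*z - 2*z^3)*(2*a*b + a*c + b*d + 2*c*d)
      + (2 - 2*z - 2*z^3)*(a^2*d + 2*a*b*c + a*d^2 - a + 2*b*c*d - d) = 0 \<and>
    3*a*b^2*d + a*d^3 + b^3*c + 3*b*c*d^2 + 1 + (- 1 - 2*z - 2*z^3)*(a*d + b^2 + b*c + d^2)
      + (2 - 2*z - 2*z^3)*(2*a*b*d + b^2*c + b*d^2 - b) = 0 \<and>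
    b^3*d + b*d^3 + (- 1 - 2*z - 2*z^3)*(b*d) + (2 - 2*z - 2*z^3)*(b^2*d) = 0"
  by (rule binary_quartic_zero) (use assms in \<open>simp only: quartic_on_chart\<close>)

lemma chart_on_surface:
  assumes "\<And>u v. (u, v) \<in> {(1,0), (0,1), (1,1), (1,-1), (1,2)} \<Longrightarrow> quartic z (a * u + b * v) (c * u + d * v) u v = 0"
  shows "quartic z (a * u + b * v) (c * u + d * v) u v = 0"
  using chart_coefficients[OF assms] unfolding quartic_on_chart by simp

lemma ev_quartic: "ev z (quartic (Zeta 0 1 0 0) y1 y2 y3 y4) = quartic z (ev z y1) (ev z y2) (ev z y3) (ev z y4)"
proof -
  have "ev z (Zeta 0 1 0 0) = z" by simp
  then show ?thesis unfolding quartic_def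
    by (simp only: ev_add ev_diff ev_uminus ev_mult[OF z4] ev_power[OF z4] ev_numeral ev_1)
qed

lemma quartic_scale: "quartic z (k * y1) (k * y2) (k * y3) (k * y4) = k ^ 4 * quartic z y1 y2 y3 y4"
proof -
  define A B where "A = - 1 - 2*z - 2*z^3" and "B = 2 - 2*z - 2*z^3"
  show ?thesis unfolding quartic_def A_def[symmetric] B_def[symmetric]
    by (simp add: power_unfold algebra_simps)
qed

lemma scaled_frac: "snd r \<le> 1 \<Longrightarrow> ev z (scaled r) = 3 * zfrac z r"
proof -
  assume "snd r \<le> 1"
  then have "snd r = 0 \<or> snd r = 1" by auto
  then show ?thesis using three by (auto simp: scaled_def zfrac_def ev_mult[OF z4])
qed

lemma vanishes_at_frac:
  assumes "vanishes_at (scaled a) (scaled b) (scaled c) (scaled d) (m, n)"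
    "snd a \<le> 1" "snd b \<le> 1" "snd c \<le> 1" "snd d \<le> 1"
  shows "quartic z (zfrac z a * of_int m + zfrac z b * of_int n) (zfrac z c * of_int m + zfrac z d * of_int n) (of_int m) (of_int n) = 0"
    (is "quartic z ?y1 ?y2 ?y3 ?y4 = 0")
proof -
  have "0 = ev z (quartic (Zeta 0 1 0 0) (scaled a * Zeta m 0 0 0 + scaled b * Zeta n 0 0 0)
      (scaled c * Zeta m 0 0 0 + scaled d * Zeta n 0 0 0) (Zeta 3 0 0 0 * Zeta m 0 0 0) (Zeta 3 0 0 0 * Zeta n 0 0 0))"
    using assms(1) by (simp add: vanishes_at_def Let_def)
  also have "\<dots> = quartic z (3 * ?y1) (3 * ?y2) (3 * ?y3) (3 * ?y4)"
  proof -
    have "ev z (Zeta k 0 0 0) = of_int k" for k by simp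
    then show ?thesis unfolding ev_quartic ev_add ev_mult[OF z4] scaled_frac[OF assms(2)] scaled_frac[OF assms(3)]
        scaled_frac[OF assms(4)] scaled_frac[OF assms(5)]
      by (simp add: algebra_simps)
  qed
  also have "\<dots> = 3 ^ 4 * quartic z ?y1 ?y2 ?y3 ?y4" by (rule quartic_scale)
  finally have "3 ^ 4 * quartic z ?y1 ?y2 ?y3 ?y4 = 0" by simp
  then show ?thesis using power_not_zero[OF three, of 4] by (simp only: mult_eq_0_iff simp_thms)
qed

lemma chart_line_on_surface:
  assumes "C12 a b c d \<in> set line_table"
  shows "cell_line (map_cell (zfrac z) (C12 a b c d)) \<subseteq> surface (quartic_poly z)"
proof -
  have ch: "chart_check (C12 a b c d)" using assms chart_table by (auto simp: list_all_iff)
  then have le: "snd a \<le> 1" "snd b \<le> 1" "snd c \<le> 1" "snd d \<le> 1" by simp_all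
  have v: "vanishes_at (scaled a) (scaled b) (scaled c) (scaled d) (m, n)"
    if "(m, n) \<in> {(1,0), (0,1), (1,1), (1,-1), (1,2)}" for m n
    using ch that by auto
  have "quartic z (zfrac z a * u + zfrac z b * v) (zfrac z c * u + zfrac z d * v) u v = 0"
    if "(u, v) \<in> {(1,0), (0,1), (1,1), (1,-1), (1,2)}" for u v
  proof -
    have f: "quartic z (zfrac z a * of_int m + zfrac z b * of_int n) (zfrac z c * of_int m + zfrac z d * of_int n) (of_int m) (of_int n) = 0"
      if "(m, n) \<in> {(1,0), (0,1), (1,1), (1,-1), (1,2)}" for m n
      by (rule vanishes_at_frac[OF v[OF that] le])
    show ?thesis using that f[of 1 0] f[of 0 1] f[of 1 1] f[of 1 "-1"] f[of 1 2] by auto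
  qed
  then have "quartic z (zfrac z a * u + zfrac z b * v) (zfrac z c * u + zfrac z d * v) u v = 0" for u v
    by (rule chart_on_surface)
  then show ?thesis
    by (simp add: cell_line_subset_surface[OF hom_quartic] peval_quartic_poly cell_vec_def)
qed

lemma axis_line_on_surface:
  assumes "C \<in> set lines_meeting_axis"
  shows "cell_line (map_cell (zfrac z) C) \<subseteq> surface (quartic_poly z)"
proof -
  have "\<forall>C\<in>set lines_meeting_axis. \<forall>u v. peval (quartic_poly z) (cell_vec (map_cell (zfrac z) C) u v) = 0"
    unfolding lines_meeting_axis_def list.set
    by (intro ballI allI; elim insertE emptyE)
      (simp_all add: peval_quartic_poly cell_vec_def zfrac_def quartic_def power_unfold algebra_simps zeta_rules[OF z4])
  then show ?thesis using assms by (simp add: cell_line_subset_surface[OF hom_quartic])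
qed

lemma lines_on_surface:
  assumes "C \<in> set lines"
  shows "cell_line C \<subseteq> surface (quartic_poly z)"
proof -
  obtain R where R: "R \<in> set line_table" "C = map_cell (zfrac z) R" using assms by (auto simp: lines_def)
  show ?thesis
  proof (cases "R \<in> set lines_meeting_axis")
    case True
    then show ?thesis using axis_line_on_surface R(2) by simp
  next
    case False
    have "list_all (\<lambda>R. \<exists>a b c d. R = C12 a b c d) (lines_axis_exchange @ lines_first_axis @ lines_last_axis
      @ lines_axis_preserving @ lines_first_zero @ lines_last_zero @ lines_second_zero @ lines_third_zero @ lines_generic)"
      by (simp add: lines_axis_exchange_def lines_first_axis_def lines_last_axis_def lines_axis_preserving_def
        lines_first_zero_def lines_last_zero_def lines_second_zero_def lines_third_zero_def lines_generic_def)
    then have "\<exists>a b c d. R = C12 a b c d"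
      using R(1) False unfolding line_table_def list_all_iff set_append by blast
    then show ?thesis using chart_line_on_surface R by blast
  qed
qed

end

section \<open>Solving for the lines of the generic cell\<close>

text \<open>
  These are the coefficients of \<open>u\<^sup>3 v\<close>, \<open>u\<^sup>2 v\<^sup>2\<close> and \<open>u v\<^sup>3\<close> in \<open>quartic_on_chart\<close>. The quartic depends on \<open>z\<close>
  only through \<open>s = z + z\<^sup>3\<close>, a square root of \<open>- 2\<close>.
\<close>

definition coeff31 :: "'a::field \<Rightarrow> 'a \<Rightarrow> 'a \<Rightarrow> 'a \<Rightarrow> 'a \<Rightarrow> 'a" where
  "coeff31 s a b c d = a^3*d + 3*a^2*b*c + 3*a*c^2*d + b*c^3 + 1 + (- 1 - 2* s)*(a^2 + a*d + b*c + c^2)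
     + (2 - 2* s)*(a^2*c + 2*a*c*d + b*c^2 - c)"

definition coeff22 :: "'a::field \<Rightarrow> 'a \<Rightarrow> 'a \<Rightarrow> 'a \<Rightarrow> 'a \<Rightarrow> 'a" where
  "coeff22 s a b c d = 3*a^2*b*d + 3*a*b^2*c + 3*a*c*d^2 + 3*b*c^2*d + (- 1 - 2* s)*(2*a*b + a*c + b*d + 2*c*d)
     + (2 - 2* s)*(a^2*d + 2*a*b*c + a*d^2 - a + 2*b*c*d - d)"

definition coeff13 :: "'a::field \<Rightarrow> 'a \<Rightarrow> 'a \<Rightarrow> 'a \<Rightarrow> 'a \<Rightarrow> 'a" where
  "coeff13 s a b c d = 3*a*b^2*d + a*d^3 + b^3*c + 3*b*c*d^2 + 1 + (- 1 - 2* s)*(a*d + b^2 + b*c + d^2)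
     + (2 - 2* s)*(2*a*b*d + b^2*c + b*d^2 - b)"

text \<open>
  The exchange of \<open>y\<^sub>1\<close> with \<open>y\<^sub>2\<close> and of \<open>y\<^sub>3\<close> with \<open>y\<^sub>4\<close> is a symmetry of the surface, and saves
  several of the cases below.
\<close>

lemma coeff_swap: "coeff31 s d c b a = coeff13 s a b c d" "coeff22 s d c b a = coeff22 s a b c d"
    "coeff13 s d c b a = coeff31 s a b c d"
  by (simp_all add: coeff31_def coeff22_def coeff13_def algebra_simps)

lemma square_rules:
  fixes s :: "'a::field" assumes "s * s = k" shows "s * (s * x) = k * x"
  using assms by (simp add: mult.assoc[symmetric])

context
  fixes s e :: "'a::field"
  assumes ss: "s * s = - 2" and ee: "e * e = - 1" and six: "(6::'a) \<noteq> 0"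
begin

lemmas coeff_defs = coeff31_def coeff22_def coeff13_def
lemmas se_rules = ss square_rules[OF ss] ee square_rules[OF ee]
lemmas calc = coeff_defs power_unfold algebra_simps se_rules

lemma int_nonzero: "(2::'a) ^ a * 3 ^ b \<noteq> 0" by (rule two_three_smooth[OF six])

lemma lambda_nonzero: "1 - s \<noteq> 0" "1 + s \<noteq> 0" "s \<noteq> 0" "s + 2 \<noteq> 0"
proof -
  have "(1 - s) * (1 + s) = 3" "s * s * (- 1) = 2" "(s + 2) * (2 - s) = 6" by (simp_all add: algebra_simps ss)
  then show "1 - s \<noteq> 0" "1 + s \<noteq> 0" "s \<noteq> 0" "s + 2 \<noteq> 0"
    using int_nonzero[of 0 1] int_nonzero[of 1 0] six by auto
qed

text \<open>
  The difference of the two equations is divisible by \<open>c - b\<close>. For \<open>b \<noteq> c\<close> it and the sum are equations in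
  \<open>p = b c\<close> and \<open>q = b + c\<close> only, and give \<open>p\<^sup>2 = 1\<close>.
\<close>

lemma axis_exchange_case:
  assumes E: "coeff31 s 0 b c 0 = 0" "coeff13 s 0 b c 0 = 0"
  shows "b = c \<and> (b^2 + 2*b - 1) * (b^2 - 2* s*b - 1) = 0 \<or> c = - b \<and> b^2 + 1 = 0 \<or>
    b * c = - 1 \<and> (b - (1 + s)) * (3*b - (s - 1)) = 0"
proof (cases "b = c")
  case True
  have "(b^2 + 2*b - 1) * (b^2 - 2* s*b - 1) = coeff31 s 0 b b 0" by (simp add: calc)
  then show ?thesis using E True by simp
next
  case False
  define p q where "p = b * c" and "q = b + c"
  have "(c - b) * ((p - 1 - 2* s) * q + (2 - 2* s) * (p - 1)) = coeff31 s 0 b c 0 - coeff13 s 0 b c 0"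
    by (simp add: p_def q_def calc)
  then have 1: "(p - 1 - 2* s) * q + (2 - 2* s) * (p - 1) = 0" using E False by simp
  have "2 * (1 - p * p) = coeff31 s 0 b c 0 + coeff13 s 0 b c 0 - q * ((p - 1 - 2* s) * q + (2 - 2* s) * (p - 1))"
    by (simp add: p_def q_def calc)
  then have "2 * (1 - p * p) = 0" using E 1 by simp
  then have "(1 - p) * (1 + p) = 0" using int_nonzero[of 1 0] by (simp add: algebra_simps)
  then consider "p = 1" | "p = - 1" by (auto simp: add_eq_0_iff)
  then show ?thesis
  proof cases
    case 1
    then have "s * q = 0" using \<open>(p - 1 - 2* s) * q + (2 - 2* s) * (p - 1) = 0\<close> int_nonzero[of 1 0] by simp
    then have "c = - b" using lambda_nonzero(3) by (simp add: q_def add_eq_0_iff)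
    moreover have "b^2 + 1 = 0"
    proof -
      have "b^2 + 1 = 1 - p" unfolding p_def \<open>c = - b\<close> by (simp add: power2_eq_square)
      then show ?thesis using 1 by simp
    qed
    ultimately show ?thesis by blast
  next
    case 2
    have "(2 + 2* s) * q + 4 * (1 - s) = 0"
    proof -
      have "(2 + 2* s) * q + 4 * (1 - s) = - ((p - 1 - 2* s) * q + (2 - 2* s) * (p - 1))"
        by (simp add: 2 algebra_simps)
      then show ?thesis using 1 by simp
    qed
    then have "(1 - s) * ((2 + 2* s) * q + 4 * (1 - s)) = 0" by simp
    then have "2 * (3 * q - (2 + 4* s)) = 0" by (simp add: algebra_simps se_rules)
    then have q: "3 * q - (2 + 4* s) = 0" using int_nonzero[of 1 0] by (simp only: mult_eq_0_iff) simp
    have "(b - (1 + s)) * (3*b - (s - 1)) = b * (3 * q - (2 + 4* s)) - 3 * (p + 1)"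
      by (simp add: p_def q_def algebra_simps se_rules)
    then have "(b - (1 + s)) * (3*b - (s - 1)) = 0" unfolding q 2 by simp
    then show ?thesis using 2 by (simp add: p_def)
  qed
qed

lemma first_axis_case:
  assumes E: "coeff31 s 0 0 c d = 0" "coeff22 s 0 0 c d = 0" "coeff13 s 0 0 c d = 0"
  shows "3 * c = 1 + s \<and> (3*d - e*(1 + s)) * (3*d + e*(1 + s)) = 0"
proof
  have "(3*d - e*(1 + s)) * (3*d + e*(1 + s)) = - (1 - 2* s) * coeff13 s 0 0 c d"
    by (simp add: calc)
  then show "(3*d - e*(1 + s)) * (3*d + e*(1 + s)) = 0" using E by simp
  have "d \<noteq> 0" using E(3) by (auto simp: coeff13_def)
  moreover have "d * (6 * (3 * c - (1 + s))) = - (1 - 2* s) * coeff22 s 0 0 c d"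
    by (simp add: calc)
  ultimately have "6 * (3 * c - (1 + s)) = 0" unfolding E by simp
  then show "3 * c = 1 + s" using six by (simp only: mult_eq_0_iff simp_thms right_minus_eq)
qed

lemma axis_preserving_case:
  assumes E: "coeff31 s a 0 0 d = 0" "coeff22 s a 0 0 d = 0"
  shows "d = - a \<and> a ^ 4 = 1"
proof -
  have "2 * (1 - s) * ((a + d) * (a * d - 1)) = coeff22 s a 0 0 d" by (simp add: calc)
  then have "(a + d) * (a * d - 1) = 0"
    unfolding E using int_nonzero[of 1 0] lambda_nonzero(1) by simp
  moreover have "a + d = 0" if ad: "a * d = 1"
  proof -
    have "coeff31 s a 0 0 d = (a * d) * (a * a) + (- 1 - 2* s) * (a * a + a * d) + 1"
      by (simp add: calc)
    also have "\<dots> = - 2 * s * (a * a + 1)" by (simp add: ad algebra_simps)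
    finally have "2 * s * (a * a + 1) = 0" unfolding E by simp
    then have "a * a + 1 = 0" using int_nonzero[of 1 0] lambda_nonzero(3) by simp
    moreover have "a * (a + d) = a * a + 1" by (simp add: ad algebra_simps)
    moreover have "a \<noteq> 0" using ad by auto
    ultimately show ?thesis by simp
  qed
  ultimately have "a + d = 0" by auto
  then have d: "d = - a" by (simp add: add_eq_0_iff)
  have "coeff31 s a 0 0 d = 1 - a ^ 4" unfolding d by (simp add: calc)
  then show ?thesis using d E by simp
qed

text \<open>
  The long identities in this and the next lemma show that the conclusions lie in the ideal generated by
  the three coefficients, up to factors \<open>2\<^sup>a 3\<^sup>b\<close>. The multipliers were found by linear
  algebra over \<open>\<rat>(s, e)\<close>.
\<close>

lemma first_zero_case:
  assumes E: "coeff31 s 0 b c (e * (b + 1 - s)) = 0" "coeff22 s 0 b c (e * (b + 1 - s)) = 0" "coeff13 s 0 b c (e * (b + 1 - s)) = 0"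
  shows "(b - s - e) * (b - s + e) = 0 \<and> c = 3 + s*b"
proof -
  have "192 * ((b - s)^2 + 1) = ((-112 + 40* s)*b^2*c + (144* s)*b^2 + (-40 + 172* s)*b*c + (416 + 292* s)*b + (32 + 28* s)*c + (360 - 36* s)) * coeff31 s 0 b c (e * (b + 1 - s)) + ((-52*e + 14*e* s)*b*c^2 + (-16*e + 92*e* s)*b*c + (28*e + 42*e* s)*b + (-16*e + 22*e* s)*c^2 + (80*e + 76*e* s)*c + (32*e + 2*e* s)) * coeff22 s 0 b c (e * (b + 1 - s)) + ((22 - s)*c^3 + (20 - 23* s)*c^2 + (18 - 45* s)*c + (-56 - 7* s)) * coeff13 s 0 b c (e * (b + 1 - s))"
    by (simp add: calc)
  then have 1: "(b - s)^2 + 1 = 0"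
    by (rule left_cancel) (simp only: E mult_zero_right add_0_left, use int_nonzero[of 6 1] in simp)
  have "96 * (c - 3 - s*b) = ((52 - 46* s)*b^2*c + (-120 - 78* s)*b^2 + (-32 - 118* s)*b*c + (-380 - 22* s)*b + (-32 - 28* s)*c + (-168 + 96* s)) * coeff31 s 0 b c (e * (b + 1 - s)) + ((32*e - 16*e* s)*b*c^2 + (-40*e - 58*e* s)*b*c + (-20*e - 10*e* s)*b + (16*e - 22*e* s)*c^2 + (-68*e - 34*e* s)*c + (8*e - 28*e* s)) * coeff22 s 0 b c (e * (b + 1 - s)) + ((-22 + s)*c^3 + (-20 + 23* s)*c^2 + (-30 + 45* s)*c + (20 - 5* s)) * coeff13 s 0 b c (e * (b + 1 - s))"
    by (simp add: calc)
  then have 2: "c - 3 - s*b = 0"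
    by (rule left_cancel) (simp only: E mult_zero_right add_0_left, use int_nonzero[of 5 1] in simp)
  have "(b - s - e) * (b - s + e) = (b - s)^2 + 1" by (simp add: power_unfold algebra_simps se_rules)
  then show ?thesis using 1 2 by (simp add: algebra_simps)
qed

lemma second_zero_case:
  assumes E: "coeff31 s (e * (c + 1 - s)) 0 c d = 0" "coeff22 s (e * (c + 1 - s)) 0 c d = 0" "coeff13 s (e * (c + 1 - s)) 0 c d = 0"
  shows "(c + 1)^2 - s*(c + 1) - 1 = 0 \<and> d = e*(s - 1 - 2*c)"
proof -
  have "384 * ((c + 1)^2 - s*(c + 1) - 1) = ((42 + 6* s)*c*d^2 + (36*e - 24*e* s)*c*d + (-6 - 30* s)*c + (-42*e - 15*e* s)*d^3 + (116 - 59* s)*d^2 + (78*e - 33*e* s)*d + (-32 - 25* s)) * coeff31 s (e * (c + 1 - s)) 0 c d + ((-28 - 4* s)*c^2*d + (-36*e + 24*e* s)*c^2 + (28*e + 10*e* s)*c*d^2 + (-124 + 72* s)*c*d + (-56*e + 90*e* s)*c + (-16*e + 6*e* s)*d^2 + (8 + 84* s)*d + (64*e + 78*e* s)) * coeff22 s (e * (c + 1 - s)) 0 c d + ((56 - 56* s)*c^2 + (96*e - 36*e* s)*c*d + (-104 - 52* s)*c + (8*e - 44*e* s)*d + (-40 + 100* s)) * coeff13 s (e * (c + 1 - s)) 0 c d"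
    by (simp add: calc)
  then have 1: "(c + 1)^2 - s*(c + 1) - 1 = 0"
    by (rule left_cancel) (simp only: E mult_zero_right add_0_left, use int_nonzero[of 7 1] in simp)
  have "192 * (d - e*(s - 1 - 2*c)) = ((6*e - 6*e* s)*c*d^2 + (4 + 8* s)*c*d + (-10*e - 2*e* s)*c + (18 - 9* s)*d^3 + (12*e - 27*e* s)*d^2 + (-38 + 17* s)*d + (8*e - 17*e* s)) * coeff31 s (e * (c + 1 - s)) 0 c d + ((-4*e + 4*e* s)*c^2*d + (-4 - 8* s)*c^2 + (-12 + 6* s)*c*d^2 + (-4*e + 40*e* s)*c*d + (16 - 18* s)*c + (-6* s)*d^2 + (56*e + 20*e* s)*d + (-30* s)) * coeff22 s (e * (c + 1 - s)) 0 c d + ((-8*e - 40*e* s)*c^2 + (36* s)*c*d + (-104*e - 4*e* s)*c + (24 + 12* s)*d + (24*e + 36*e* s)) * coeff13 s (e * (c + 1 - s)) 0 c d"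
    by (simp add: calc)
  then have 2: "d - e*(s - 1 - 2*c) = 0"
    by (rule left_cancel) (simp only: E mult_zero_right add_0_left, use int_nonzero[of 6 1] in simp)
  show ?thesis using 1 2 by (simp only: right_minus_eq simp_thms)
qed

lemma opposite_case:
  assumes E: "coeff31 s (e * (c + 1 - s)) b c (- e * (b + 1 - s)) = 0" "coeff13 s (e * (c + 1 - s)) b c (- e * (b + 1 - s)) = 0"
  shows "3 * b = 2* s - 1 \<and> 3 * c = 2* s - 1"
proof -
  have "8 * (3 * c - (2* s - 1)) = (2 - s) * coeff31 s (e * (c + 1 - s)) b c (- e * (b + 1 - s))"
    by (simp add: calc)
  then have 1: "8 * (3 * c - (2* s - 1)) = 0" unfolding E by simp
  have "8 * (3 * b - (2* s - 1)) = (2 - s) * coeff13 s (e * (c + 1 - s)) b c (- e * (b + 1 - s))"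
    by (simp add: calc)
  then have 2: "8 * (3 * b - (2* s - 1)) = 0" unfolding E by simp
  have "(8::'a) \<noteq> 0" using int_nonzero[of 3 0] by simp
  then show ?thesis using 1 2 by (simp only: mult_eq_0_iff simp_thms right_minus_eq)
qed

text \<open>
  The shift \<open>T = c + 1 - s\<close>, \<open>W = b + 1 - s\<close> makes the first and the last equation exchange under
  \<open>T \<leftrightarrow> W\<close>. For \<open>T \<noteq> W\<close>, their difference divided by \<open>T - W\<close> is an equation in \<open>p = T W\<close> and
  \<open>q = T + W\<close>, and with their sum it gives \<open>p\<^sup>2 = 2\<close>, that is \<open>p = \<plusminus> e s\<close>.
\<close>

lemma equal_case:
  assumes E: "coeff31 s (e * T) (W - (1 - s)) (T - (1 - s)) (e * W) = 0"
    "coeff22 s (e * T) (W - (1 - s)) (T - (1 - s)) (e * W) = 0"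
    "coeff13 s (e * T) (W - (1 - s)) (T - (1 - s)) (e * W) = 0"
  shows "T = W \<and> (T - 1) * (T + s) = 0 \<or>
    (\<exists>k. (k = e \<or> k = - e) \<and> T * W = k * s \<and> T + W = 1 - s + k * s - k)"
proof -
  let ?F = "\<lambda>T W. T^3 * W - (1 - s) * T^2 * W - (2 + s) * T + 2"
  have four: "(4::'a) \<noteq> 0" using int_nonzero[of 2 0] by simp
  have "- 4 * ?F T W = coeff31 s (e * T) (W - (1 - s)) (T - (1 - s)) (e * W)" by (simp add: calc)
  then have F1: "?F T W = 0" unfolding E using four by (simp only: mult_eq_0_iff neg_equal_0_iff_equal simp_thms)
  have "- 4 * ?F W T = coeff13 s (e * T) (W - (1 - s)) (T - (1 - s)) (e * W)" by (simp add: calc)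
  then have F2: "?F W T = 0" unfolding E using four by (simp only: mult_eq_0_iff neg_equal_0_iff_equal simp_thms)
  show ?thesis
  proof (cases "T = W")
    case True
    have "T \<noteq> 0" using F1 int_nonzero[of 1 0] by auto
    moreover have "24 * (T * ((T - 1) * (T + s))) = e * (1 + s) * coeff22 s (e * T) (W - (1 - s)) (T - (1 - s)) (e * W)"
      unfolding True[symmetric] by (simp add: calc)
    moreover have "(24::'a) \<noteq> 0" using int_nonzero[of 3 1] by simp
    ultimately have "(T - 1) * (T + s) = 0" unfolding E by (simp only: mult_zero_right mult_eq_0_iff simp_thms)
    then show ?thesis using True by blast
  next
    case False
    define p q where "p = T * W" and "q = T + W"
    have "(T - W) * (p * q - (1 - s) * p - (2 + s)) = ?F T W - ?F W T"
      by (simp add: p_def q_def power_unfold algebra_simps)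
    then have G: "p * q - (1 - s) * p - (2 + s) = 0" unfolding F1 F2 using False by simp
    have "2 * ((p - e * s) * (p + e * s)) = q * (p * q - (1 - s) * p - (2 + s)) - ?F T W - ?F W T"
      by (simp add: p_def q_def power_unfold algebra_simps se_rules)
    then have "2 * ((p - e * s) * (p + e * s)) = 0" unfolding F1 F2 G by simp
    then have "(p - e * s) * (p + e * s) = 0" using int_nonzero[of 1 0] by simp
    then have "p = e * s \<or> p = - e * s" by (auto simp: add_eq_0_iff)
    then obtain k where k: "k = e \<or> k = - e" and p: "p = k * s" by blast
    have kk: "k * k = - 1" using k ee by auto
    have "2 * (q - (1 - s + k * s - k)) = k * s * (p * q - (1 - s) * p - (2 + s))"
      unfolding p by (simp add: algebra_simps se_rules kk square_rules[OF kk])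
    then have "2 * (q - (1 - s + k * s - k)) = 0" unfolding G by simp
    then have "q = 1 - s + k * s - k"
      using int_nonzero[of 1 0] by (simp only: power_one_right power_0 mult_1_right mult_eq_0_iff simp_thms right_minus_eq)
    then show ?thesis using k p by (auto simp: p_def q_def)
  qed
qed

end

section \<open>Finding the solutions in the table\<close>

lemma swap_table: "list_all (\<lambda>R. case R of C12 a b c d \<Rightarrow> C12 d c b a \<in> set line_table | _ \<Rightarrow> True) line_table"
  by code_simp

context eighth_root
begin

abbreviation s :: 'a where "s \<equiv> z + z ^ 3"

lemma ss: "s * s = - 2"
  by (simp add: power_unfold algebra_simps zeta_rules[OF z4])

lemma ii: "z ^ 2 * z ^ 2 = - 1" "(- (z ^ 2)) * (- (z ^ 2)) = - 1"
  using z4 by (simp_all flip: power_add)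

lemma lines_swap: "C12 d c b a \<in> set lines \<Longrightarrow> C12 a b c d \<in> set lines"
proof -
  assume "C12 d c b a \<in> set lines"
  then obtain R where R: "R \<in> set line_table" "C12 d c b a = map_cell (zfrac z) R" by (auto simp: lines_def)
  obtain d' c' b' a' where R': "R = C12 d' c' b' a'" using R(2) by (cases R) auto
  have "C12 a' b' c' d' \<in> set line_table" using R' R(1) swap_table by (auto simp: list_all_iff)
  then have "map_cell (zfrac z) (C12 a' b' c' d') \<in> set lines" unfolding lines_def by (metis image_eqI list.set_map)
  then show ?thesis using R(2) R' by simp
qed

lemma thirds: "3 * x = y \<longleftrightarrow> x = y / 3" for x y :: 'a
  using three by (simp add: eq_divide_eq mult.commute)

lemmas table_simps = lines_def line_table_def zfrac_def

lemma axis_exchange_mem: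
  assumes "coeff31 s 0 b c 0 = 0" "coeff13 s 0 b c 0 = 0"
  shows "C12 0 b c 0 \<in> set lines"
proof -
  note calc = power_unfold algebra_simps zeta_rules[OF z4]
  from axis_exchange_case[OF ss ii(1) six assms] show ?thesis
  proof (elim disjE conjE)
    assume bc: "b = c"
    assume "(b^2 + 2*b - 1) * (b^2 - 2 * s * b - 1) = 0"
    moreover have "b^2 + 2*b - 1 = (b - (- 1 + z - z^3)) * (b - (- 1 - z + z^3))" by (simp add: calc)
    moreover have "b^2 - 2 * s * b - 1 = (b - (z + z^2 + z^3)) * (b - (z - z^2 + z^3))" by (simp add: calc)
    ultimately have "b = - 1 + z - z^3 \<or> b = - 1 - z + z^3 \<or> b = z + z^2 + z^3 \<or> b = z - z^2 + z^3"
      by (simp only: mult_eq_0_iff right_minus_eq disj_assoc)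
    then show ?thesis unfolding bc[symmetric]
      by (elim disjE) (simp_all add: table_simps lines_axis_exchange_def)
  next
    assume c: "c = - b" and "b^2 + 1 = 0"
    moreover have "b^2 + 1 = (b - z^2) * (b - (- (z^2)))" by (simp add: calc)
    ultimately have "b = z^2 \<or> b = - (z^2)" by (simp only: mult_eq_0_iff right_minus_eq)
    then show ?thesis unfolding c
      by (elim disjE) (simp_all add: table_simps lines_axis_exchange_def)
  next
    assume bc: "b * c = - 1" and b: "(b - (1 + s)) * (3*b - (s - 1)) = 0"
    have *: "3 * x = y" if "u * x = - 1" "u * y = - 3" for u x y :: 'a
    proof -
      have "u * (3 * x - y) = 3 * (u * x) - u * y" by (simp add: algebra_simps)
      then have "u * (3 * x - y) = 0" unfolding that by simp
      moreover have "u \<noteq> 0" using that(1) by auto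
      ultimately show ?thesis by simp
    qed
    have s1: "s - 1 = - 1 + z + z^3" by (simp add: algebra_simps)
    from b consider "b = 1 + s" | "3 * b = s - 1" by (auto simp only: mult_eq_0_iff right_minus_eq)
    then show ?thesis
    proof cases
      case 1
      have "3 * c = s - 1" by (rule *[OF bc]) (simp add: 1 calc)
      then have "c = (- 1 + z + z^3) / 3" unfolding s1 by (simp only: thirds)
      then show ?thesis unfolding 1 by (simp add: table_simps lines_axis_exchange_def)
    next
      case 2
      have "3 * c = 3 * (1 + s)"
      proof (rule *[OF bc])
        have "b * (3 * (1 + s)) = (3 * b) * (1 + s)" by simp
        also have "\<dots> = - 3" unfolding 2 by (simp add: calc)
        finally show "b * (3 * (1 + s)) = - 3" .
      qed
      then have "c = 1 + s" using three by (simp only: mult_left_cancel not_False_eq_True)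
      moreover have "b = (- 1 + z + z^3) / 3" using 2 unfolding s1 by (simp only: thirds)
      ultimately show ?thesis by (simp add: table_simps lines_axis_exchange_def)
    qed
  qed
qed

lemma first_axis_mem:
  assumes "coeff31 s 0 0 c d = 0" "coeff22 s 0 0 c d = 0" "coeff13 s 0 0 c d = 0"
  shows "C12 0 0 c d \<in> set lines"
proof -
  note calc = power_unfold algebra_simps zeta_rules[OF z4]
  have c: "c = (1 + z + z^3) / 3" and "(3*d - z^2*(1 + s)) * (3*d + z^2*(1 + s)) = 0"
    using first_axis_case[OF ss ii(1) six assms] by (simp_all add: thirds add.assoc)
  then have "3 * d = z^2*(1 + s) \<or> 3 * d = - (z^2*(1 + s))"
    by (auto simp: add_eq_0_iff)
  moreover have "z^2*(1 + s) = - z + z^2 + z^3" by (simp add: calc)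
  ultimately have "d = (- z + z^2 + z^3) / 3 \<or> d = (z - z^2 - z^3) / 3"
    by (simp add: thirds)
  then show ?thesis unfolding c
    by (elim disjE) (simp_all add: table_simps lines_first_axis_def)
qed

lemma axis_preserving_mem:
  assumes "coeff31 s a 0 0 d = 0" "coeff22 s a 0 0 d = 0"
  shows "C12 a 0 0 d \<in> set lines"
proof -
  have d: "d = - a" and "a ^ 4 = 1"
    using axis_preserving_case[OF ss ii(1) six assms] by blast+
  moreover have "a ^ 4 - 1 = (a - 1) * ((a - (- 1)) * ((a - z^2) * (a - (- (z^2)))))"
    by (simp add: power_unfold algebra_simps zeta_rules[OF z4])
  ultimately have "a = 1 \<or> a = - 1 \<or> a = z^2 \<or> a = - (z^2)"
    by (metis diff_self mult_eq_0_iff right_minus_eq)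
  then show ?thesis unfolding d
    by (elim disjE) (simp_all add: table_simps lines_axis_preserving_def)
qed

lemma first_zero_mem:
  assumes e: "e = z^2 \<or> e = - (z^2)" and d: "d = e * (b + 1 - s)"
    and "coeff31 s 0 b c d = 0" "coeff22 s 0 b c d = 0" "coeff13 s 0 b c d = 0"
  shows "C12 0 b c d \<in> set lines"
proof -
  note calc = power_unfold algebra_simps zeta_rules[OF z4]
  have ee: "e * e = - 1" using e ii by auto
  have "(b - s - e) * (b - s + e) = 0" and c: "c = 3 + s * b"
    using first_zero_case[OF ss ee six assms(3-5)[unfolded d]] by blast+
  then have "b - s - e = 0 \<or> b - s + e = 0" by (simp only: mult_eq_0_iff)
  then have "b = s + e \<or> b = s - e" by (auto simp: algebra_simps eq_neg_iff_add_eq_0 add_eq_0_iff)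
  with e show ?thesis unfolding d c
    by (elim disjE) (simp_all only:, simp_all add: table_simps lines_first_zero_def calc)
qed

lemma second_zero_mem:
  assumes e: "e = z^2 \<or> e = - (z^2)" and a: "a = e * (c + 1 - s)"
    and "coeff31 s a 0 c d = 0" "coeff22 s a 0 c d = 0" "coeff13 s a 0 c d = 0"
  shows "C12 a 0 c d \<in> set lines"
proof -
  note calc = power_unfold algebra_simps zeta_rules[OF z4]
  have ee: "e * e = - 1" using e ii by auto
  have "(c + 1)^2 - s * (c + 1) - 1 = 0" and d: "d = e * (s - 1 - 2*c)"
    using second_zero_case[OF ss ee six assms(3-5)[unfolded a]] by blast+
  moreover have "(c + 1)^2 - s * (c + 1) - 1 = (c - (- 1 + z)) * (c - (- 1 + z^3))" by (simp add: calc)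
  ultimately have "c = - 1 + z \<or> c = - 1 + z^3" by (simp only: mult_eq_0_iff right_minus_eq)
  with e show ?thesis unfolding d a
    by (elim disjE) (simp_all only:, simp_all add: table_simps lines_second_zero_def calc)
qed

lemma generic_mem:
  assumes e: "e = z^2 \<or> e = - (z^2)" and a: "a = e * (c + 1 - s)" and d: "d = e * (b + 1 - s) \<or> d = - e * (b + 1 - s)"
    and E: "coeff31 s a b c d = 0" "coeff22 s a b c d = 0" "coeff13 s a b c d = 0"
  shows "C12 a b c d \<in> set lines"
proof -
  note calc = power_unfold algebra_simps zeta_rules[OF z4]
  have ee: "e * e = - 1" using e ii by auto
  from d show ?thesis
  proof
    assume d: "d = - e * (b + 1 - s)"
    have "3 * b = 2 * s - 1 \<and> 3 * c = 2 * s - 1"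
      by (rule opposite_case[OF ss ee six E(1,3)[unfolded a d]])
    then have bc: "3 * b = 2 * s - 1" "3 * c = 2 * s - 1" by blast+
    have "2 * s - 1 = - 1 + 2 * z + 2 * z^3" by (simp add: algebra_simps)
    then have b: "b = (- 1 + 2 * z + 2 * z^3) / 3" and c: "c = (- 1 + 2 * z + 2 * z^3) / 3"
      using bc by (simp_all only: thirds)
    have "3 * a = e * (3 * c + 3 * (1 - s))" unfolding a by (simp add: algebra_simps)
    then have "3 * a = e * (2 - s)" unfolding bc by (simp add: algebra_simps)
    moreover have "3 * d = - e * (3 * b + 3 * (1 - s))" unfolding d by (simp add: algebra_simps)
    then have "3 * d = - e * (2 - s)" unfolding bc by (simp add: algebra_simps)
    moreover have "z^2 * (2 - s) = z + 2 * z^2 - z^3" by (simp add: calc)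
    ultimately have "a = (z + 2 * z^2 - z^3) / 3 \<and> d = (- z - 2 * z^2 + z^3) / 3 \<or>
        a = (- z - 2 * z^2 + z^3) / 3 \<and> d = (z + 2 * z^2 - z^3) / 3"
      using e by (elim disjE) (simp_all only: thirds mult_minus_left minus_minus minus_add_distrib minus_diff_eq, simp_all)
    then show ?thesis unfolding b c
      by (elim disjE conjE) (simp_all add: table_simps lines_generic_def)
  next
    assume d: "d = e * (b + 1 - s)"
    define T W where "T = c + (1 - s)" and "W = b + (1 - s)"
    have bc: "b = W - (1 - s)" "c = T - (1 - s)" and ad: "a = e * T" "d = e * W"
      by (simp_all add: T_def W_def a d algebra_simps)
    have "T = W \<and> (T - 1) * (T + s) = 0 \<or>
      (\<exists>k. (k = e \<or> k = - e) \<and> T * W = k * s \<and> T + W = 1 - s + k * s - k)"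
      by (rule equal_case[OF ss ee six E[unfolded ad bc]])
    then have "T = 1 \<and> W = 1 \<or> T = - s \<and> W = - s \<or>
      T = z^2 - z^3 \<and> W = 1 - z^3 \<or> T = 1 - z^3 \<and> W = z^2 - z^3 \<or>
      T = - (z^2) - z \<and> W = 1 - z \<or> T = 1 - z \<and> W = - (z^2) - z"
    proof
      assume "T = W \<and> (T - 1) * (T + s) = 0"
      then show ?thesis by (auto simp only: mult_eq_0_iff right_minus_eq eq_neg_iff_add_eq_0)
    next
      assume "\<exists>k. (k = e \<or> k = - e) \<and> T * W = k * s \<and> T + W = 1 - s + k * s - k"
      then obtain k where k: "k = e \<or> k = - e" and p: "T * W = k * s" and q: "T + W = 1 - s + k * s - k"
        by blast
      from k e have "k = z^2 \<or> k = - (z^2)" by auto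
      then show ?thesis
      proof (elim disjE)
        assume k: "k = z^2"
        have p': "T * W = (1 - z) * (- (z^2) - z)" unfolding p k by (simp add: calc)
        have W: "W = (1 - z) + (- (z^2) - z) - T"
          using q unfolding k by (simp add: calc)
        have "(T - (1 - z)) * (T - (- (z^2) - z)) = (1 - z) * (- (z^2) - z) - T * W"
          unfolding W by (simp add: algebra_simps)
        then have "(T - (1 - z)) * (T - (- (z^2) - z)) = 0" unfolding p' by simp
        then have "T = 1 - z \<or> T = - (z^2) - z" by (simp only: mult_eq_0_iff right_minus_eq)
        then show ?thesis using W by auto
      next
        assume k: "k = - (z^2)"
        have p': "T * W = (1 - z^3) * (z^2 - z^3)" unfolding p k by (simp add: calc)
        have W: "W = (1 - z^3) + (z^2 - z^3) - T"
          using q unfolding k by (simp add: calc)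
        have "(T - (1 - z^3)) * (T - (z^2 - z^3)) = (1 - z^3) * (z^2 - z^3) - T * W"
          unfolding W by (simp add: algebra_simps)
        then have "(T - (1 - z^3)) * (T - (z^2 - z^3)) = 0" unfolding p' by simp
        then have "T = 1 - z^3 \<or> T = z^2 - z^3" by (simp only: mult_eq_0_iff right_minus_eq)
        then show ?thesis using W by auto
      qed
    qed
    with e show ?thesis unfolding bc ad
      by (elim disjE conjE) (simp_all only:, simp_all add: table_simps lines_generic_def calc)
  qed
qed

text \<open>
  The coefficients of \<open>u\<^sup>4\<close> and \<open>v\<^sup>4\<close> describe the intersections with the planes \<open>y\<^sub>4 = 0\<close> and \<open>y\<^sub>3 = 0\<close>.
  They factor as \<open>a c (a\<^sup>2 + (c + 1 - s)\<^sup>2)\<close> and \<open>b d (d\<^sup>2 + (b + 1 - s)\<^sup>2)\<close>, because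
  \<open>- 1 - 2 s = (1 - s)\<^sup>2\<close>; so each leaves four possibilities.
\<close>

lemma chart_classification:
  assumes "\<And>u v. quartic z (a * u + b * v) (c * u + d * v) u v = 0"
  shows "C12 a b c d \<in> set lines"
proof -
  note calc = power_unfold algebra_simps zeta_rules[OF z4]
  note E = chart_coefficients[OF assms]
  have k: "- 1 - 2 * s = - 1 - 2*z - 2*z^3" "2 - 2 * s = 2 - 2*z - 2*z^3" by (simp_all add: algebra_simps)
  have E31: "coeff31 s a b c d = 0" and E22: "coeff22 s a b c d = 0" and E13: "coeff13 s a b c d = 0"
    using E unfolding coeff31_def coeff22_def coeff13_def k by blast+
  note swapped = trans[OF coeff_swap(1) E13] trans[OF coeff_swap(2) E22] trans[OF coeff_swap(3) E31]
  have "a * (c * ((a - z^2 * (c + 1 - s)) * (a - - (z^2) * (c + 1 - s)))) = 0"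
  proof -
    have "a * (c * ((a - z^2 * (c + 1 - s)) * (a - - (z^2) * (c + 1 - s)))) =
      a^3*c + a*c^3 + (- 1 - 2*z - 2*z^3)*(a*c) + (2 - 2*z - 2*z^3)*(a*c^2)" by (simp add: calc)
    then show ?thesis using E by simp
  qed
  then have 1: "a = 0 \<or> c = 0 \<or> (\<exists>e. (e = z^2 \<or> e = - (z^2)) \<and> a = e * (c + 1 - s))"
    unfolding mult_eq_0_iff right_minus_eq by blast
  have "b * (d * ((d - z^2 * (b + 1 - s)) * (d - - (z^2) * (b + 1 - s)))) = 0"
  proof -
    have "b * (d * ((d - z^2 * (b + 1 - s)) * (d - - (z^2) * (b + 1 - s)))) =
      b^3*d + b*d^3 + (- 1 - 2*z - 2*z^3)*(b*d) + (2 - 2*z - 2*z^3)*(b^2*d)" by (simp add: calc)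
    then show ?thesis using E by simp
  qed
  then have 2: "b = 0 \<or> d = 0 \<or> (\<exists>e. (e = z^2 \<or> e = - (z^2)) \<and> d = e * (b + 1 - s))"
    unfolding mult_eq_0_iff right_minus_eq by blast
  from 1 2 show ?thesis
  proof (elim disjE)
    assume ab: "a = 0" "b = 0"
    show ?thesis using first_axis_mem[OF E31[unfolded ab] E22[unfolded ab] E13[unfolded ab]] unfolding ab .
  next
    assume ad: "a = 0" "d = 0"
    show ?thesis using axis_exchange_mem[OF E31[unfolded ad] E13[unfolded ad]] unfolding ad .
  next
    assume a: "a = 0" and "\<exists>e. (e = z^2 \<or> e = - (z^2)) \<and> d = e * (b + 1 - s)"
    then obtain e where e: "e = z^2 \<or> e = - (z^2)" "d = e * (b + 1 - s)" by blast
    show ?thesis using first_zero_mem[OF e E31[unfolded a] E22[unfolded a] E13[unfolded a]] unfolding a .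
  next
    assume cb: "c = 0" "b = 0"
    show ?thesis using axis_preserving_mem[OF E31[unfolded cb] E22[unfolded cb]] unfolding cb .
  next
    assume cd: "c = 0" "d = 0"
    show ?thesis using lines_swap[OF first_axis_mem[OF swapped[unfolded cd]]] unfolding cd .
  next
    assume c: "c = 0" and "\<exists>e. (e = z^2 \<or> e = - (z^2)) \<and> d = e * (b + 1 - s)"
    then obtain e where e: "e = z^2 \<or> e = - (z^2)" "d = e * (b + 1 - s)" by blast
    show ?thesis using lines_swap[OF second_zero_mem[OF e swapped[unfolded c]]] unfolding c .
  next
    assume b: "b = 0" and "\<exists>e. (e = z^2 \<or> e = - (z^2)) \<and> a = e * (c + 1 - s)"
    then obtain e where e: "e = z^2 \<or> e = - (z^2)" "a = e * (c + 1 - s)" by blast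
    show ?thesis using second_zero_mem[OF e E31[unfolded b] E22[unfolded b] E13[unfolded b]] unfolding b .
  next
    assume d: "d = 0" and "\<exists>e. (e = z^2 \<or> e = - (z^2)) \<and> a = e * (c + 1 - s)"
    then obtain e where e: "e = z^2 \<or> e = - (z^2)" "a = e * (c + 1 - s)" by blast
    show ?thesis using lines_swap[OF first_zero_mem[OF e swapped[unfolded d]]] unfolding d .
  next
    assume "\<exists>e. (e = z^2 \<or> e = - (z^2)) \<and> a = e * (c + 1 - s)" "\<exists>e. (e = z^2 \<or> e = - (z^2)) \<and> d = e * (b + 1 - s)"
    then obtain e e' where e: "e = z^2 \<or> e = - (z^2)" "a = e * (c + 1 - s)"
      and e': "e' = z^2 \<or> e' = - (z^2)" "d = e' * (b + 1 - s)" by blast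
    then have "e' = e \<or> e' = - e" by auto
    then have "d = e * (b + 1 - s) \<or> d = - e * (b + 1 - s)" using e'(2) by blast
    from generic_mem[OF e this E31 E22 E13] show ?thesis .
  qed
qed

end

section \<open>Lines that meet the line with vanishing last coordinates\<close>

lemma plane_basis:
  fixes H :: "('a::field ^ 4) set"
  assumes "vec.dim H = 2"
  obtains p q where "p \<in> H" "q \<in> H" "\<And>\<alpha> \<beta>. \<alpha> *s p + \<beta> *s q = 0 \<Longrightarrow> \<alpha> = 0 \<and> \<beta> = 0"
proof -
  obtain B where B: "B \<subseteq> H" "vec.independent B" "H \<subseteq> vec.span B" "card B = vec.dim H"
    by (rule vec.basis_exists[of H])
  have "card B = 2" unfolding B(4) by (rule assms)
  then obtain p q where pq: "B = {p, q}" "p \<noteq> q" unfolding card_2_iff by blast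
  have "p \<notin> vec.span {q} \<and> vec.independent {q}"
    using B(2) pq(2) unfolding pq(1) vec.independent_insert by simp
  then have p: "p \<notin> vec.span {q}" and q: "q \<noteq> 0" by (auto simp: vec.dependent_single)
  have ind: "\<alpha> = 0 \<and> \<beta> = 0" if 0: "\<alpha> *s p + \<beta> *s q = 0" for \<alpha> \<beta>
  proof -
    have "\<alpha> = 0"
    proof (rule ccontr)
      assume \<alpha>: "\<alpha> \<noteq> 0"
      have "\<alpha> *s p = (- \<beta>) *s q" using 0 by (simp add: add_eq_0_iff)
      have "p = inverse \<alpha> *s (\<alpha> *s p)" using \<alpha> by (simp add: vector_smult_assoc)
      also have "\<dots> = (inverse \<alpha> * (- \<beta>)) *s q"
        unfolding \<open>\<alpha> *s p = (- \<beta>) *s q\<close> by (simp only: vector_smult_assoc)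
      finally have "p = (inverse \<alpha> * (- \<beta>)) *s q" .
      then show False using p unfolding vec.span_singleton by blast
    qed
    moreover from this have "\<beta> = 0" using 0 q by simp
    ultimately show ?thesis by simp
  qed
  have "p \<in> H" "q \<in> H" using B(1) pq(1) by simp_all
  then show ?thesis using ind by (rule that)
qed

text \<open>
  Two spanning vectors of a cell that lie in a plane determine this plane.
\<close>

lemma plane_eq_cell:
  fixes H :: "('a::field ^ 4) set"
  assumes H: "vec.subspace H" "vec.dim H = 2" and C: "cell_vec C 1 0 \<in> H" "cell_vec C 0 1 \<in> H"
  shows "{q \<in> P3. q \<subseteq> H} = cell_line C"
proof -
  have "{cell_vec C u v | u v. True} \<subseteq> H"
  proof clarify
    fix u v
    show "cell_vec C u v \<in> H"
      by (subst cell_vec_combination) (intro vec.subspace_add vec.subspace_scale H C)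
  qed
  then have "{cell_vec C u v | u v. True} = H"
    by (rule vec.subspace_dim_equal[OF subspace_cell H(1)]) (simp only: dim_cell H(2))
  then show ?thesis by (simp add: cell_line_eq)
qed

definition point4 :: "'a \<Rightarrow> 'a \<Rightarrow> 'a \<Rightarrow> 'a \<Rightarrow> 'a ^ 4" where
  "point4 a b c d = (\<chi> i. tab4 a b c d i)"

lemma point4_nth [simp]: "point4 a b c d $ i = tab4 a b c d i" by (simp add: point4_def)

text \<open>
  Four values of the cubic suffice, as 6 is invertible.
\<close>

lemma cubic_zero:
  fixes c0 c1 c2 c3 :: "'a::field"
  assumes "(6::'a) \<noteq> 0" "\<And>t. c3 * t^3 + c2 * t^2 + c1 * t + c0 = 0"
  shows "c3 = 0 \<and> c2 = 0 \<and> c1 = 0"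
proof -
  have 0: "c0 = 0" "c3 + c2 + c1 + c0 = 0" "- c3 + c2 - c1 + c0 = 0" "8 * c3 + 4 * c2 + 2 * c1 + c0 = 0"
    subgoal using assms(2)[of 0] by simp
    subgoal using assms(2)[of 1] by simp
    subgoal using assms(2)[of "-1"] by simp
    subgoal using assms(2)[of 2] by (simp add: mult.commute)
    done
  have two: "(2::'a) \<noteq> 0" using two_three_smooth[OF assms(1), of 1 0] by simp
  have "6 * c3 = (8 * c3 + 4 * c2 + 2 * c1 + c0) - 3 * (c3 + c2 + c1 + c0) + 3 * c0 - (- c3 + c2 - c1 + c0)"
    by simp
  then have "6 * c3 = 0" unfolding 0(2-4) unfolding 0(1) by simp
  then have c3: "c3 = 0" using assms(1) by simp
  have "2 * c2 = (c3 + c2 + c1 + c0) + (- c3 + c2 - c1 + c0) - 2 * c0" by simp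
  then have "2 * c2 = 0" unfolding 0(2-4) unfolding 0(1) by simp
  then have "c2 = 0" using two by simp
  then show ?thesis using c3 0 by simp
qed

context eighth_root
begin

lemma restriction_coefficients_nonzero: "- 1 - 2 * s \<noteq> 0" "8 + 4 * s \<noteq> 0"
proof -
  have "(- 1 - 2 * s) * (- 1 + 2 * s) = 3 ^ 2" "(8 + 4 * s) * (2 - s) = 2 ^ 3 * 3"
    by (simp_all add: power_unfold algebra_simps zeta_rules[OF z4])
  then show "- 1 - 2 * s \<noteq> 0" "8 + 4 * s \<noteq> 0"
    using two_three_smooth[OF six, of 0 2] two_three_smooth[OF six, of 3 1] by auto
qed

text \<open>
  Along the line through \<open>(0:1:0:0)\<close> and \<open>(r:0:m:n)\<close> the quartic is a cubic in the parameter. Its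
  leading coefficient gives \<open>r = 0\<close>, and the next one \<open>m n = 0\<close>.
\<close>

lemma line_through_vertex_2:
  assumes H: "vec.subspace H" "vec.dim H = 2" and vanish: "\<And>x. x \<in> H \<Longrightarrow> quartic z (x $ 1) (x $ 2) (x $ 3) (x $ 4) = 0"
    and v: "point4 0 1 0 0 \<in> H" and w: "point4 r 0 m n \<in> H" and mn: "m \<noteq> 0 \<or> n \<noteq> 0"
  shows "\<exists>C\<in>set lines. {q \<in> P3. q \<subseteq> H} = cell_line C"
proof -
  have q: "r * t^3 + ((- 1 - 2 * s) * (m * n) + (2 - 2 * s) * (r * m)) * t^2 +
      (r^3 + (- 1 - 2 * s) * (r * n^2 + r * m^2) + (2 - 2 * s) * (r^2 * n - m^2 * n)) * t +
      (m^3 * n + m * n^3 + r * n * ((- 1 - 2 * s) * (r * m) - (2 - 2 * s) * (m * n))) = 0" for t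
  proof -
    have "point4 r t m n = point4 r 0 m n + t *s point4 0 1 0 0"
      by (simp add: vec_eq_iff forall_4)
    then have "point4 r t m n \<in> H" using H(1) v w by (simp add: vec.subspace_add vec.subspace_scale)
    from vanish[OF this] have "quartic z r t m n = 0" by simp
    then show ?thesis unfolding quartic_def by (simp add: power_unfold algebra_simps)
  qed
  note * = cubic_zero[OF six q]
  then have r: "r = 0" by blast
  with * have "(- 1 - 2 * s) * (m * n) = 0" by simp
  then consider "m = 0" | "n = 0" using restriction_coefficients_nonzero by (auto simp only: mult_eq_0_iff)
  then show ?thesis
  proof cases
    case 1
    have "{q \<in> P3. q \<subseteq> H} = cell_line (C13 0 0 0)"
    proof (rule plane_eq_cell[OF H])
      have "cell_vec (C13 0 0 0) 1 0 = (point4 0 1 0 0 :: 'a ^ 4)" by (simp add: cell_vec_def point4_def)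
      then show "cell_vec (C13 0 0 0) 1 0 \<in> H" using v by simp
      have "cell_vec (C13 0 0 0) 0 1 = inverse n *s point4 r 0 m n"
        using 1 mn r by (simp add: cell_vec_def vec_eq_iff forall_4)
      then show "cell_vec (C13 0 0 0) 0 1 \<in> H" using w H(1) by (simp add: vec.subspace_scale)
    qed
    moreover have "C13 0 0 0 \<in> set lines" by (simp add: table_simps lines_meeting_axis_def)
    ultimately show ?thesis by blast
  next
    case 2
    have "{q \<in> P3. q \<subseteq> H} = cell_line (C14 0 0)"
    proof (rule plane_eq_cell[OF H])
      have "cell_vec (C14 0 0) 1 0 = (point4 0 1 0 0 :: 'a ^ 4)" by (simp add: cell_vec_def point4_def)
      then show "cell_vec (C14 0 0) 1 0 \<in> H" using v by simp
      have "cell_vec (C14 0 0) 0 1 = inverse m *s point4 r 0 m n"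
        using 2 mn r by (simp add: cell_vec_def vec_eq_iff forall_4)
      then show "cell_vec (C14 0 0) 0 1 \<in> H" using w H(1) by (simp add: vec.subspace_scale)
    qed
    moreover have "C14 0 0 \<in> set lines" by (simp add: table_simps lines_meeting_axis_def)
    ultimately show ?thesis by blast
  qed
qed

lemma line_through_vertex_1:
  assumes H: "vec.subspace H" "vec.dim H = 2" and vanish: "\<And>x. x \<in> H \<Longrightarrow> quartic z (x $ 1) (x $ 2) (x $ 3) (x $ 4) = 0"
    and v: "point4 1 0 0 0 \<in> H" and w: "point4 0 r m n \<in> H" and mn: "m \<noteq> 0 \<or> n \<noteq> 0"
  shows "\<exists>C\<in>set lines. {q \<in> P3. q \<subseteq> H} = cell_line C"
proof -
  have q: "r * t^3 + ((- 1 - 2 * s) * (m * n) + (2 - 2 * s) * (r * n)) * t^2 +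
      (r^3 + (- 1 - 2 * s) * (r * m^2 + r * n^2) + (2 - 2 * s) * (r^2 * m - m * n^2)) * t +
      (m^3 * n + m * n^3 + r * m * ((- 1 - 2 * s) * (r * n) - (2 - 2 * s) * (m * n))) = 0" for t
  proof -
    have "point4 t r m n = point4 0 r m n + t *s point4 1 0 0 0"
      by (simp add: vec_eq_iff forall_4)
    then have "point4 t r m n \<in> H" using H(1) v w by (simp add: vec.subspace_add vec.subspace_scale)
    from vanish[OF this] have "quartic z t r m n = 0" by simp
    then show ?thesis unfolding quartic_def by (simp add: power_unfold algebra_simps)
  qed
  note * = cubic_zero[OF six q]
  then have r: "r = 0" by blast
  with * have "(- 1 - 2 * s) * (m * n) = 0" by simp
  then consider "m = 0" | "n = 0" using restriction_coefficients_nonzero by (auto simp only: mult_eq_0_iff)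
  then show ?thesis
  proof cases
    case 1
    have "{q \<in> P3. q \<subseteq> H} = cell_line (C23 0 0)"
    proof (rule plane_eq_cell[OF H])
      have "cell_vec (C23 0 0) 1 0 = (point4 1 0 0 0 :: 'a ^ 4)" by (simp add: cell_vec_def point4_def)
      then show "cell_vec (C23 0 0) 1 0 \<in> H" using v by simp
      have "cell_vec (C23 0 0) 0 1 = inverse n *s point4 0 r m n"
        using 1 mn r by (simp add: cell_vec_def vec_eq_iff forall_4)
      then show "cell_vec (C23 0 0) 0 1 \<in> H" using w H(1) by (simp add: vec.subspace_scale)
    qed
    moreover have "C23 0 0 \<in> set lines" by (simp add: table_simps lines_meeting_axis_def)
    ultimately show ?thesis by blast
  next
    case 2
    have "{q \<in> P3. q \<subseteq> H} = cell_line (C24 0)"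
    proof (rule plane_eq_cell[OF H])
      have "cell_vec (C24 0) 1 0 = (point4 1 0 0 0 :: 'a ^ 4)" by (simp add: cell_vec_def point4_def)
      then show "cell_vec (C24 0) 1 0 \<in> H" using v by simp
      have "cell_vec (C24 0) 0 1 = inverse m *s point4 0 r m n"
        using 2 mn r by (simp add: cell_vec_def vec_eq_iff forall_4)
      then show "cell_vec (C24 0) 0 1 \<in> H" using w H(1) by (simp add: vec.subspace_scale)
    qed
    moreover have "C24 0 \<in> set lines" by (simp add: table_simps lines_meeting_axis_def)
    ultimately show ?thesis by blast
  qed
qed

text \<open>
  The points \<open>(1:e:0:0)\<close> with \<open>e\<^sup>2 = - 1\<close> lie on the surface. The cubic coefficient determines \<open>r\<close>,
  which amounts to the line lying in the tangent plane; two more values then give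
  \<open>m n (e m + n) = 0\<close>, so there are three lines.
\<close>

lemma line_through_mixed_point:
  assumes e: "e = z^2 \<or> e = - (z^2)"
    and H: "vec.subspace H" "vec.dim H = 2" and vanish: "\<And>x. x \<in> H \<Longrightarrow> quartic z (x $ 1) (x $ 2) (x $ 3) (x $ 4) = 0"
    and v: "point4 1 e 0 0 \<in> H" and w: "point4 0 r m n \<in> H" and mn: "m \<noteq> 0 \<or> n \<noteq> 0"
  shows "\<exists>C\<in>set lines. {q \<in> P3. q \<subseteq> H} = cell_line C"
proof -
  have ee: "e * e = - 1" using e ii by auto
  note calc = power_unfold algebra_simps zeta_rules[OF z4] ee square_rules[OF ee]
  have mem: "point4 t (e * t + r) m n \<in> H" for t
  proof -
    have "point4 t (e * t + r) m n = point4 0 r m n + t *s point4 1 e 0 0"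
      by (simp add: vec_eq_iff forall_4 mult.commute)
    then show ?thesis using H(1) v w by (simp add: vec.subspace_add vec.subspace_scale)
  qed
  have poly: "\<exists>c2 c1 c0. \<forall>t. quartic z t (e * t + r) m n =
      (2 * ((1 - s) * e * (n + e * m) - r)) * t^3 + c2 * t^2 + c1 * t + c0"
    unfolding quartic_def
    by (rule exI[of _ "3 * e * r^2 + (n + e * m) * ((- 1 - 2 * s) * (m + e * n) + (2 - 2 * s) * r) + r * m * ((2 - 2 * s) * e)"],
      rule exI[of _ "r^3 + (n + e * m) * ((- 1 - 2 * s) * (r * n) - (2 - 2 * s) * (m * n)) + r * m * ((- 1 - 2 * s) * (m + e * n) + (2 - 2 * s) * r)"],
      rule exI[of _ "m^3 * n + m * n^3 + r * m * ((- 1 - 2 * s) * (r * n) - (2 - 2 * s) * (m * n))"])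
      (simp add: calc)
  then obtain c2 c1 c0 where c: "\<And>t. quartic z t (e * t + r) m n =
      (2 * ((1 - s) * e * (n + e * m) - r)) * t^3 + c2 * t^2 + c1 * t + c0" by blast
  have zero: "quartic z t (e * t + r) m n = 0" for t using vanish[OF mem[of t]] by simp
  have "2 * ((1 - s) * e * (n + e * m) - r) = 0"
    using cubic_zero[OF six, of "2 * ((1 - s) * e * (n + e * m) - r)" c2 c1 c0] zero c by metis
  then have r: "r = (1 - s) * e * (n + e * m)" using two by simp
  have "quartic z 1 (e * 1 + r) m n - quartic z (- 1) (e * (- 1) + r) m n = 2 * ((8 + 4 * s) * (m * n * (e * m + n)))"
    unfolding quartic_def r by (simp add: calc)
  then have "2 * ((8 + 4 * s) * (m * n * (e * m + n))) = 0" unfolding zero by simp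
  then have "m * n * (e * m + n) = 0" using two restriction_coefficients_nonzero(2) by (simp only: mult_eq_0_iff simp_thms)
  then consider "m = 0" | "n = 0" | "m \<noteq> 0" "e * m + n = 0" by auto
  then show ?thesis
  proof cases
    case 1
    have "{q \<in> P3. q \<subseteq> H} = cell_line (C13 e (1 - s) 0)"
    proof (rule plane_eq_cell[OF H])
      have "cell_vec (C13 e (1 - s) 0) 1 0 = (- e) *s point4 1 e 0 0"
        using ee by (simp add: cell_vec_def vec_eq_iff forall_4)
      then show "cell_vec (C13 e (1 - s) 0) 1 0 \<in> H" using v H(1) by (simp add: vec.subspace_scale vec.subspace_neg)
      have r': "inverse n * r = (1 - s) * e" using 1 mn unfolding r by simp
      have "cell_vec (C13 e (1 - s) 0) 0 1 = inverse n *s point4 0 r m n + (- (1 - s)) *s point4 1 e 0 0"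
        using 1 mn r' by (simp add: cell_vec_def vec_eq_iff forall_4 algebra_simps)
      then show "cell_vec (C13 e (1 - s) 0) 0 1 \<in> H"
        using v w H(1) by (simp only: vec.subspace_add vec.subspace_scale)
    qed
    moreover have "C13 e (1 - s) 0 \<in> set lines"
      using e by (elim disjE) (simp_all only:, simp_all add: table_simps lines_meeting_axis_def)
    ultimately show ?thesis by blast
  next
    case 2
    have "{q \<in> P3. q \<subseteq> H} = cell_line (C14 e (e * (1 - s)))"
    proof (rule plane_eq_cell[OF H])
      have "cell_vec (C14 e (e * (1 - s))) 1 0 = (- e) *s point4 1 e 0 0"
        using ee by (simp add: cell_vec_def vec_eq_iff forall_4)
      then show "cell_vec (C14 e (e * (1 - s))) 1 0 \<in> H" using v H(1) by (simp add: vec.subspace_scale vec.subspace_neg)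
      have "r = - (1 - s) * m" using 2 unfolding r by (simp add: calc)
      then have "inverse m * r = - (1 - s)" using 2 mn by simp
      moreover have "e * (1 - s) * e = - (1 - s)" by (simp add: calc)
      ultimately have "cell_vec (C14 e (e * (1 - s))) 0 1 = inverse m *s point4 0 r m n + (- (e * (1 - s))) *s point4 1 e 0 0"
        using 2 mn by (simp add: cell_vec_def vec_eq_iff forall_4)
      then show "cell_vec (C14 e (e * (1 - s))) 0 1 \<in> H"
        using v w H(1) by (simp only: vec.subspace_add vec.subspace_scale)
    qed
    moreover have "C14 e (e * (1 - s)) \<in> set lines"
      using e by (elim disjE) (simp_all only:, simp_all add: table_simps lines_meeting_axis_def power_unfold algebra_simps zeta_rules[OF z4])
    ultimately show ?thesis by blast
  next
    case 3
    then have n: "n = - (e * m)" by (simp add: add_eq_0_iff)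
    have r0: "r = 0" unfolding r n by simp
    have "{q \<in> P3. q \<subseteq> H} = cell_line (C13 e 0 (- e))"
    proof (rule plane_eq_cell[OF H])
      have "cell_vec (C13 e 0 (- e)) 1 0 = (- e) *s point4 1 e 0 0"
        using ee by (simp add: cell_vec_def vec_eq_iff forall_4)
      then show "cell_vec (C13 e 0 (- e)) 1 0 \<in> H" using v H(1) by (simp add: vec.subspace_scale vec.subspace_neg)
      have "e * inverse m * (e * m) = - 1" using 3 ee by (simp add: field_simps)
      then have "cell_vec (C13 e 0 (- e)) 0 1 = (e * inverse m) *s point4 0 r m n"
        using 3 by (simp add: r0 n cell_vec_def vec_eq_iff forall_4)
      then show "cell_vec (C13 e 0 (- e)) 0 1 \<in> H" using w H(1) by (simp only: vec.subspace_scale)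
    qed
    moreover have "C13 e 0 (- e) \<in> set lines"
      using e by (elim disjE) (simp_all only:, simp_all add: table_simps lines_meeting_axis_def)
    ultimately show ?thesis by blast
  qed
qed

text \<open>
  Let \<open>D\<close> be the minor of the last two coordinates in a basis of the plane. If it is nonzero, then the line
  belongs to the generic cell. Otherwise the line contains a point \<open>v\<close> with \<open>v\<^sub>3 = v\<^sub>4 = 0\<close>, and since
  the quartic restricts to \<open>y\<^sub>1 y\<^sub>2 (y\<^sub>1\<^sup>2 + y\<^sub>2\<^sup>2)\<close> there, it is one of four points.
\<close>

lemma plane_classification:
  assumes H: "vec.subspace H" "vec.dim H = 2" and vanish: "\<And>x. x \<in> H \<Longrightarrow> quartic z (x $ 1) (x $ 2) (x $ 3) (x $ 4) = 0"
  shows "\<exists>C\<in>set lines. {q \<in> P3. q \<subseteq> H} = cell_line C"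
proof -
  obtain p q where pq: "p \<in> H" "q \<in> H" and ind: "\<And>\<alpha> \<beta>. \<alpha> *s p + \<beta> *s q = 0 \<Longrightarrow> \<alpha> = 0 \<and> \<beta> = 0"
    using plane_basis[OF H(2)] by metis
  have comb: "\<alpha> *s p + \<beta> *s q \<in> H" for \<alpha> \<beta>
    using H(1) pq by (simp only: vec.subspace_add vec.subspace_scale)
  define D where "D = p $ 3 * q $ 4 - p $ 4 * q $ 3"
  show ?thesis
  proof (cases "D = 0")
    case False
    define P Q where "P = (q $ 4 / D) *s p + (- (p $ 4) / D) *s q" and "Q = (- (q $ 3) / D) *s p + (p $ 3 / D) *s q"
    have PQ: "P \<in> H" "Q \<in> H" unfolding P_def Q_def by (rule comb)+
    have "P $ 3 = 1" "P $ 4 = 0" "Q $ 3 = 0" "Q $ 4 = 1"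
      using False by (simp_all add: P_def Q_def field_simps) (simp_all add: D_def algebra_simps)
    then have C: "cell_vec (C12 (P $ 1) (Q $ 1) (P $ 2) (Q $ 2)) u v = u *s P + v *s Q" for u v
      by (simp add: cell_vec_def vec_eq_iff forall_4 mult.commute)
    have mem: "u *s P + v *s Q \<in> H" for u v using PQ H(1) by (simp only: vec.subspace_add vec.subspace_scale)
    have "{q \<in> P3. q \<subseteq> H} = cell_line (C12 (P $ 1) (Q $ 1) (P $ 2) (Q $ 2))"
      by (rule plane_eq_cell[OF H]) (simp_all only: C mem)
    moreover have "C12 (P $ 1) (Q $ 1) (P $ 2) (Q $ 2) \<in> set lines"
    proof (rule chart_classification)
      fix u v
      have "cell_vec (C12 (P $ 1) (Q $ 1) (P $ 2) (Q $ 2)) u v \<in> H" unfolding C by (rule mem)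
      from vanish[OF this] show "quartic z (P $ 1 * u + Q $ 1 * v) (P $ 2 * u + Q $ 2 * v) u v = 0"
        by (simp add: cell_vec_def)
    qed
    ultimately show ?thesis by blast
  next
    case True
    have zero: "\<alpha> *s p + \<beta> *s q \<noteq> 0" if "\<alpha> \<noteq> 0 \<or> \<beta> \<noteq> 0" for \<alpha> \<beta> using ind that by blast
    have "\<exists>v\<in>H. v \<noteq> 0 \<and> v $ 3 = 0 \<and> v $ 4 = 0"
    proof (cases "p $ 3 = 0 \<and> p $ 4 = 0")
      case True
      then show ?thesis using pq zero[of 1 0] by auto
    next
      case False
      define v where "v = (if p $ 3 \<noteq> 0 then q $ 3 *s p + (- (p $ 3)) *s q else q $ 4 *s p + (- (p $ 4)) *s q)"
      have "v \<in> H" using comb[of "q $ 3" "- (p $ 3)"] comb[of "q $ 4" "- (p $ 4)"] by (simp add: v_def)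
      moreover have "v \<noteq> 0"
        using False zero[of "q $ 3" "- (p $ 3)"] zero[of "q $ 4" "- (p $ 4)"] by (auto simp: v_def)
      moreover have "v $ 3 = 0 \<and> v $ 4 = 0"
        using \<open>D = 0\<close> by (auto simp: v_def D_def algebra_simps)
      ultimately show ?thesis by blast
    qed
    then obtain v where v: "v \<in> H" "v \<noteq> 0" "v $ 3 = 0" "v $ 4 = 0" by blast
    have "\<exists>w\<in>H. w $ 3 \<noteq> 0 \<or> w $ 4 \<noteq> 0"
    proof (rule ccontr)
      assume no: "\<not> ?thesis"
      then have 0: "p $ 3 = 0" "p $ 4 = 0" "q $ 3 = 0" "q $ 4 = 0" using pq by auto
      define E where "E = p $ 1 * q $ 2 - p $ 2 * q $ 1"
      have "E \<noteq> 0"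
      proof
        assume E: "E = 0"
        have "q $ 1 *s p + (- (p $ 1)) *s q = 0" "q $ 2 *s p + (- (p $ 2)) *s q = 0"
          using E 0 by (simp_all add: E_def vec_eq_iff forall_4 algebra_simps)
        then have "p $ 1 = 0" "p $ 2 = 0" using ind by (metis neg_equal_0_iff_equal)+
        then have "1 *s p + 0 *s q = 0" using 0 by (simp add: vec_eq_iff forall_4)
        then show False using zero[of 1 0] by simp
      qed
      define x where "x = ((q $ 2 - q $ 1) / E) *s p + ((p $ 1 - p $ 2) / E) *s q"
      (* The point (1:1:0:0) does not lie on the surface. *)
      have "x $ 1 = 1" "x $ 2 = 1" "x $ 3 = 0" "x $ 4 = 0"
        using \<open>E \<noteq> 0\<close> 0 by (simp_all add: x_def field_simps) (simp_all add: E_def algebra_simps)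
      moreover have "x \<in> H" unfolding x_def by (rule comb)
      ultimately show False using vanish[of x] two by (simp add: quartic_def)
    qed
    then obtain w where w: "w \<in> H" "w $ 3 \<noteq> 0 \<or> w $ 4 \<noteq> 0" by blast
    have mem: "\<alpha> *s v + \<beta> *s w \<in> H" for \<alpha> \<beta>
      using H(1) v(1) w(1) by (simp only: vec.subspace_add vec.subspace_scale)
    have v12: "v $ 1 \<noteq> 0 \<or> v $ 2 \<noteq> 0" using v(2-4) by (auto simp: vec_eq_iff forall_4)
    have "v $ 1 * (v $ 2 * ((v $ 2 - z^2 * v $ 1) * (v $ 2 - - (z^2) * v $ 1))) = quartic z (v $ 1) (v $ 2) (v $ 3) (v $ 4)"
      unfolding quartic_def v(3,4) by (simp add: power_unfold algebra_simps zeta_rules[OF z4])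
    then have "v $ 1 * (v $ 2 * ((v $ 2 - z^2 * v $ 1) * (v $ 2 - - (z^2) * v $ 1))) = 0"
      using vanish[OF v(1)] by simp
    then consider "v $ 1 = 0" | "v $ 2 = 0" | e where "v $ 1 \<noteq> 0" "e = z^2 \<or> e = - (z^2)" "v $ 2 = e * v $ 1"
      by (simp only: mult_eq_0_iff right_minus_eq) metis
    then show ?thesis
    proof cases
      case 1
      have "point4 0 1 0 0 = (1 / v $ 2) *s v + 0 *s w"
        using 1 v v12 by (simp add: vec_eq_iff forall_4)
      then have V: "point4 0 1 0 0 \<in> H" using mem by metis
      have "point4 (w $ 1) 0 (w $ 3) (w $ 4) = (- (w $ 2) / v $ 2) *s v + 1 *s w"
        using 1 v v12 by (simp add: vec_eq_iff forall_4)
      then have "point4 (w $ 1) 0 (w $ 3) (w $ 4) \<in> H" using mem by metis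
      from line_through_vertex_2[OF H vanish V this w(2)] show ?thesis .
    next
      case 2
      have "point4 1 0 0 0 = (1 / v $ 1) *s v + 0 *s w"
        using 2 v v12 by (simp add: vec_eq_iff forall_4)
      then have V: "point4 1 0 0 0 \<in> H" using mem by metis
      have "point4 0 (w $ 2) (w $ 3) (w $ 4) = (- (w $ 1) / v $ 1) *s v + 1 *s w"
        using 2 v v12 by (simp add: vec_eq_iff forall_4)
      then have "point4 0 (w $ 2) (w $ 3) (w $ 4) \<in> H" using mem by metis
      from line_through_vertex_1[OF H vanish V this w(2)] show ?thesis .
    next
      case (3 e)
      have "point4 1 e 0 0 = (1 / v $ 1) *s v + 0 *s w"
        using 3 v by (simp add: vec_eq_iff forall_4)
      then have V: "point4 1 e 0 0 \<in> H" using mem by metis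
      have "point4 0 (w $ 2 - e * w $ 1) (w $ 3) (w $ 4) = (- (w $ 1) / v $ 1) *s v + 1 *s w"
        using 3 v by (simp add: vec_eq_iff forall_4)
      then have "point4 0 (w $ 2 - e * w $ 1) (w $ 3) (w $ 4) \<in> H" using mem by metis
      from line_through_mixed_point[OF 3(2) H vanish V this w(2)] show ?thesis .
    qed
  qed
qed

lemma line_classification:
  assumes "proj_line l" "l \<subseteq> surface (quartic_poly z)"
  shows "\<exists>C\<in>set lines. l = cell_line C"
proof -
  obtain H where H: "vec.subspace H" "vec.dim H = 2" "l = {q \<in> P3. q \<subseteq> H}"
    using assms(1) by (auto simp: proj_line_def)
  have "quartic z (x $ 1) (x $ 2) (x $ 3) (x $ 4) = 0" if x: "x \<in> H" for x
  proof (cases "x = 0")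
    case True
    then show ?thesis by (simp add: quartic_def)
  next
    case False
    have "pt x \<subseteq> H" unfolding pt_def using vec.span_minimal[of "{x}" H] x H(1) by simp
    then have "pt x \<in> surface (quartic_poly z)" using assms(2) H(3) pt_in_P3[OF False] by blast
    then show ?thesis using pt_in_surface[OF hom_quartic False] by (simp add: peval_quartic_poly)
  qed
  from plane_classification[OF H(1,2) this] show ?thesis unfolding H(3) by blast
qed

lemma card_lines_on_surface: "card {l. proj_line l \<and> l \<subseteq> surface (quartic_poly z)} = 56"
proof -
  have "{l. proj_line l \<and> l \<subseteq> surface (quartic_poly z)} = cell_line ` set lines"
    using line_classification lines_on_surface proj_line_cell by auto
  then show ?thesis using card_lines by simp
qed

end

section \<open>Reduction modulo a prime\<close>

lemma zeta_4: "\<zeta> ^ 4 = - 1"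
proof -
  have "\<zeta> ^ 4 = exp (of_nat 4 * (2 * of_real pi * \<i> / 8))"
    unfolding zeta_def by (rule exp_of_nat_mult[symmetric])
  also have "of_nat 4 * (2 * of_real pi * \<i> / 8) = of_real pi * \<i>" by simp
  also have "exp (of_real pi * \<i>) = - 1" by (rule exp_pi_i)
  finally show ?thesis .
qed

lemma Zzeta_eq: "Zzeta = range (ev \<zeta>)"
proof
  show "Zzeta \<subseteq> range (ev \<zeta>)"
  proof -
    have "poly (map_poly of_int q) \<zeta> \<in> range (ev \<zeta>)" for q :: "int poly"
    proof (induction q)
      case 0
      have "ev \<zeta> 0 = 0" by simp
      then show ?case by (metis map_poly_0 poly_0 rangeI)
    next
      case (pCons a q)
      then obtain x where x: "poly (map_poly of_int q) \<zeta> = ev \<zeta> x" by auto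
      have "poly (map_poly of_int (pCons a q)) \<zeta> = of_int a + \<zeta> * ev \<zeta> x"
        using pCons.hyps by (simp add: map_poly_pCons x)
      also have "\<dots> = ev \<zeta> (Zeta a 0 0 0 + Zeta 0 1 0 0 * x)"
        by (simp add: ev_mult[OF zeta_4] del: times_zeta_int.simps plus_zeta_int.simps)
      finally show ?case by blast
    qed
    then show ?thesis unfolding Zzeta_def by blast
  qed
  show "range (ev \<zeta>) \<subseteq> Zzeta"
  proof
    fix y assume "y \<in> range (ev \<zeta>)"
    then obtain a b c d where y: "y = ev \<zeta> (Zeta a b c d)" by (metis rangeE zeta_int.exhaust)
    have "y = poly (map_poly of_int [:a, b, c, d:]) \<zeta>"
      unfolding y by (simp add: map_poly_pCons algebra_simps power2_eq_square power3_eq_cube)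
    then show "y \<in> Zzeta" unfolding Zzeta_def by blast
  qed
qed

lemma Zzeta_closed: "x \<in> Zzeta \<Longrightarrow> y \<in> Zzeta \<Longrightarrow> x + y \<in> Zzeta" "x \<in> Zzeta \<Longrightarrow> y \<in> Zzeta \<Longrightarrow> x * y \<in> Zzeta"
    "x \<in> Zzeta \<Longrightarrow> - x \<in> Zzeta" "of_int n \<in> Zzeta" "\<zeta> \<in> Zzeta" "1 \<in> Zzeta" "0 \<in> Zzeta"
proof -
  show "x \<in> Zzeta \<Longrightarrow> y \<in> Zzeta \<Longrightarrow> x + y \<in> Zzeta"
    unfolding Zzeta_eq by (auto simp flip: ev_add)
  show "x \<in> Zzeta \<Longrightarrow> y \<in> Zzeta \<Longrightarrow> x * y \<in> Zzeta"
    unfolding Zzeta_eq by (auto simp flip: ev_mult[OF zeta_4])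
  show "x \<in> Zzeta \<Longrightarrow> - x \<in> Zzeta"
    unfolding Zzeta_eq by (auto simp flip: ev_uminus)
  have "ev \<zeta> (Zeta n 0 0 0) = of_int n" "ev \<zeta> (Zeta 0 1 0 0) = \<zeta>" by simp_all
  then show "of_int n \<in> Zzeta" "\<zeta> \<in> Zzeta" unfolding Zzeta_eq by (metis rangeI)+
  show "1 \<in> Zzeta" "0 \<in> Zzeta" unfolding Zzeta_eq by (metis ev_1 rangeI, metis ev_0 rangeI)
qed

lemma Zzeta_ring_simps: "carrier Zzeta_ring = Zzeta" "x \<oplus>\<^bsub>Zzeta_ring\<^esub> y = x + y" "x \<otimes>\<^bsub>Zzeta_ring\<^esub> y = x * y"
    "\<one>\<^bsub>Zzeta_ring\<^esub> = 1" "\<zero>\<^bsub>Zzeta_ring\<^esub> = 0"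
  by (simp_all add: Zzeta_ring_def ring_of_type_algebra_def)

text \<open>
  The residue class map, followed by the embedding of the residue field, is a ring homomorphism
  \<open>r\<close> on \<open>\<int>[\<zeta>]\<close> with values in the type \<open>'k\<close>.
\<close>

locale reduction =
  fixes P :: "complex set" and \<sigma> :: "complex set \<Rightarrow> 'k::field" and p :: nat
  assumes prime: "Factorial_Ring.prime p" and p3: "p > 3"
    and P: "primeideal P Zzeta_ring" and over: "lies_over P p"
    and closure: "closure_of_residue_field P \<sigma>"
begin

abbreviation r :: "complex \<Rightarrow> 'k" where "r \<equiv> red P \<sigma>"
abbreviation z :: 'k where "z \<equiv> r \<zeta>"

lemma ideal: "ideal P Zzeta_ring" using P by (rule primeideal.axioms(1))

lemma sigma: "\<sigma> \<in> Ring.ring_hom (Zzeta_ring Quot P) ring_of_type_algebra"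
  using closure by (simp add: closure_of_residue_field_def residue_field_def)

lemma coset: "x \<in> Zzeta \<Longrightarrow> P +>\<^bsub>Zzeta_ring\<^esub> x \<in> carrier (Zzeta_ring Quot P)"
  using ring_hom_closed[OF ideal.rcos_ring_hom[OF ideal]] by (simp add: Zzeta_ring_simps)

lemma r_add: "x \<in> Zzeta \<Longrightarrow> y \<in> Zzeta \<Longrightarrow> r (x + y) = r x + r y"
  using ring_hom_add[OF ideal.rcos_ring_hom[OF ideal], of x y] ring_hom_add[OF sigma coset[of x] coset[of y]]
  by (simp add: Zzeta_ring_simps red_def) (simp add: ring_of_type_algebra_def)

lemma r_mult: "x \<in> Zzeta \<Longrightarrow> y \<in> Zzeta \<Longrightarrow> r (x * y) = r x * r y"
  using ring_hom_mult[OF ideal.rcos_ring_hom[OF ideal], of x y] ring_hom_mult[OF sigma coset[of x] coset[of y]]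
  by (simp add: Zzeta_ring_simps red_def) (simp add: ring_of_type_algebra_def)

lemma r_1: "r 1 = 1"
  using ring_hom_one[OF ideal.rcos_ring_hom[OF ideal]] ring_hom_one[OF sigma]
  by (simp add: Zzeta_ring_simps red_def) (simp add: ring_of_type_algebra_def)

lemma r_0: "r 0 = 0"
  using r_add[of 0 0] Zzeta_closed(7) by (metis add_0_right add_left_cancel)

lemma r_uminus: "x \<in> Zzeta \<Longrightarrow> r (- x) = - r x"
  using r_add[of x "- x"] Zzeta_closed(3)[of x] r_0 by (simp add: eq_neg_iff_add_eq_0 add.commute)

lemma r_of_nat: "r (of_nat n) = of_nat n"
proof (induction n)
  case (Suc n)
  have "(of_nat n :: complex) \<in> Zzeta" using Zzeta_closed(4)[of "int n"] by simp
  then show ?case using Suc by (simp add: r_add r_1 Zzeta_closed)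
qed (simp add: r_0)

lemma r_of_int: "r (of_int n) = of_int n"
proof (cases n)
  case (nonneg m)
  then show ?thesis using r_of_nat[of m] by simp
next
  case (neg m)
  have "r (- of_nat (Suc m)) = - of_nat (Suc m)"
    using r_uminus[of "of_nat (Suc m)"] r_of_nat[of "Suc m"] Zzeta_closed(4)[of "int (Suc m)"] by simp
  then show ?thesis using neg by simp
qed

lemma r_power: "x \<in> Zzeta \<Longrightarrow> r (x ^ n) = r x ^ n \<and> x ^ n \<in> Zzeta"
  by (induction n) (simp_all add: r_1 r_mult Zzeta_closed)

lemma r_ev: "r (ev \<zeta> x) = ev z x"
proof (cases x)
  case (Zeta a b c d)
  have "of_int b * \<zeta> \<in> Zzeta" "of_int c * \<zeta> ^ 2 \<in> Zzeta" "of_int d * \<zeta> ^ 3 \<in> Zzeta" "of_int a + of_int b * \<zeta> \<in> Zzeta"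
    "of_int a + of_int b * \<zeta> + of_int c * \<zeta> ^ 2 \<in> Zzeta"
    using r_power[of \<zeta>] by (simp_all add: Zzeta_closed)
  then show ?thesis unfolding Zeta
    using r_power[of \<zeta>] by (simp add: r_add r_mult r_of_int Zzeta_closed)
qed

lemma z4: "z ^ 4 = - 1"
  using r_power[of \<zeta> 4] r_uminus[of 1] by (simp add: zeta_4 r_1 Zzeta_closed)

lemma p_zero: "(of_nat p :: 'k) = 0"
proof -
  have "int p \<in> {n. of_int n \<in> P}" using over unfolding lies_over_def by simp
  then have pP: "of_nat p \<in> P" by simp
  interpret ideal P Zzeta_ring by (rule ideal)
  have "P +>\<^bsub>Zzeta_ring\<^esub> of_nat p = P" by (rule a_rcos_const[OF pP])
  moreover have "P +>\<^bsub>Zzeta_ring\<^esub> 0 = P"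
    using a_rcos_const[OF additive_subgroup.zero_closed[OF ideal.axioms(1)[OF ideal]]] by (simp add: Zzeta_ring_simps)
  ultimately have "r (of_nat p) = r 0" by (simp add: red_def)
  then show ?thesis by (simp add: r_of_nat r_0)
qed

text \<open>
  In \<open>'k\<close> the number \<open>p\<close> becomes zero, and 6 is prime to \<open>p\<close>.
\<close>

lemma six: "(6::'k) \<noteq> 0"
proof
  assume 6: "(6::'k) = 0"
  have "\<not> p dvd 6"
  proof
    assume "p dvd 6"
    then have "p dvd 2 * 3" by simp
    then have "p dvd 2 \<or> p dvd 3" using prime prime_dvd_mult_iff by blast
    then show False using p3 by (auto dest!: dvd_imp_le)
  qed
  then have "coprime p 6" using prime prime_imp_coprime by blast
  then obtain u v where "u * int p + v * 6 = 1"
    using bezout_int[of "int p" 6] by (auto simp: coprime_iff_gcd_eq_1 gcd_int_int_eq[of p 6, simplified])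
  then have "(of_int (u * int p + v * 6) :: 'k) = 1" by simp
  then show False using p_zero 6 by simp
qed

text \<open>
  An algebraic closure of a subfield is algebraically closed; this is applied to the
  polynomial \<open>X\<^sup>2 - a\<close>.
\<close>

lemma square_roots: "\<exists>b. b ^ 2 = (a :: 'k)"
proof -
  let ?L = "ring_of_type_algebra :: 'k ring"
  interpret algebraic_closure ?L "\<sigma> ` carrier (residue_field P)"
    using closure by (simp add: closure_of_residue_field_def)
  define Q where "Q = [1, 0, - a]"
  have Q: "Q \<in> carrier (poly_ring ?L)"
    by (simp add: Q_def univ_poly_def polynomial_def ring_of_type_algebra_def)
  then have "splitted Q" by (rule roots_over_carrier)
  then have "roots Q \<noteq> {#}" by (auto simp: splitted_def Q_def)
  then obtain x where "x \<in># roots Q" by blast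
  then have "is_root Q x" using roots_mem_iff_is_root[OF Q] by auto
  then have "eval Q x = \<zero>\<^bsub>?L\<^esub>" by (simp add: is_root_def)
  then have "x * x = a"
    by (simp add: Q_def) (simp add: ring_of_type_algebra_def nat_pow_def eval_nat_numeral)
  then show ?thesis by (auto simp: power2_eq_square)
qed

sublocale K: eighth_root_closed z
  by unfold_locales (use z4 six square_roots in auto)

text \<open>
  As a relation between polynomials, coefficientwise reduction can be followed through the construction of a
  polynomial. The requirement that all coefficients lie in \<open>\<int>[\<zeta>]\<close> is what makes it
  compatible with sums and products, as \<open>red\<close> is a homomorphism only there.
\<close>

definition reduces_to :: "complex poly4 \<Rightarrow> 'k poly4 \<Rightarrow> bool" where
  "reduces_to f g \<longleftrightarrow> (\<forall>m. Poly_Mapping.lookup f m \<in> Zzeta \<and> Poly_Mapping.lookup g m = r (Poly_Mapping.lookup f m))"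

lemma reduces_to_red_poly: "reduces_to f g \<Longrightarrow> red_poly P \<sigma> f = g"
  by (rule poly_mapping_eqI) (auto simp: reduces_to_def red_poly_def map.rep_eq when_def r_0)

lemma reduces_to_single: "c \<in> Zzeta \<Longrightarrow> reduces_to (Poly_Mapping.single m c) (Poly_Mapping.single m (r c))"
  by (auto simp: reduces_to_def lookup_single when_def r_0 Zzeta_closed)

lemma reduces_to_add: "reduces_to f g \<Longrightarrow> reduces_to f' g' \<Longrightarrow> reduces_to (f + f') (g + g')"
  by (simp add: reduces_to_def lookup_add r_add Zzeta_closed)

lemma reduces_to_0: "reduces_to 0 0"
  by (simp add: reduces_to_def r_0 Zzeta_closed)

lemma reduces_to_sum: "(\<And>x. x \<in> A \<Longrightarrow> reduces_to (f x) (g x)) \<Longrightarrow> reduces_to (sum f A) (sum g A)"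
  by (induction A rule: infinite_finite_induct) (auto intro: reduces_to_add reduces_to_0)

lemma reduces_to_mult:
  assumes "reduces_to f g" "reduces_to f' g'"
  shows "reduces_to (f * f') (g * g')"
proof -
  let ?f = "Poly_Mapping.lookup f" and ?f' = "Poly_Mapping.lookup f'"
  let ?K = "Poly_Mapping.keys f" and ?K' = "Poly_Mapping.keys f'"
  have in_Z: "?f m \<in> Zzeta" "?f' m \<in> Zzeta" for m using assms by (simp_all add: reduces_to_def)
  have g: "g = (\<Sum>m\<in>?K. Poly_Mapping.single m (r (?f m)))"
    using reduces_to_red_poly[OF assms(1)]
      reduces_to_red_poly[OF reduces_to_sum[of ?K "\<lambda>m. Poly_Mapping.single m (?f m)", OF reduces_to_single[OF in_Z(1)]]]
    by (simp add: sum_single_keys)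
  have g': "g' = (\<Sum>m\<in>?K'. Poly_Mapping.single m (r (?f' m)))"
    using reduces_to_red_poly[OF assms(2)]
      reduces_to_red_poly[OF reduces_to_sum[of ?K' "\<lambda>m. Poly_Mapping.single m (?f' m)", OF reduces_to_single[OF in_Z(2)]]]
    by (simp add: sum_single_keys)
  have "reduces_to (\<Sum>m\<in>?K. \<Sum>n\<in>?K'. Poly_Mapping.single (m + n) (?f m * ?f' n))
      (\<Sum>m\<in>?K. \<Sum>n\<in>?K'. Poly_Mapping.single (m + n) (r (?f m) * r (?f' n)))"
    unfolding r_mult[OF in_Z(1) in_Z(2), symmetric]
    by (intro reduces_to_sum reduces_to_single Zzeta_closed in_Z)
  then show ?thesis
    unfolding g g' mult_single[symmetric] sum_product[symmetric] sum_single_keys .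
qed

lemma reduces_to_Const: "c \<in> Zzeta \<Longrightarrow> reduces_to (Const c) (Const (r c))"
  unfolding Const_def by (rule reduces_to_single)

lemma reduces_to_Var: "reduces_to (Var i) (Var i)"
  unfolding Var_def using reduces_to_single[OF Zzeta_closed(6)] by (simp add: r_1)

lemma reduces_to_1: "reduces_to 1 1"
  using reduces_to_Const[OF Zzeta_closed(6)] by (simp add: r_1)

lemma reduces_to_numeral: "reduces_to (numeral n) (numeral n)"
  using reduces_to_Const[OF Zzeta_closed(4)[of "numeral n"]] r_of_int[of "numeral n"] by (simp add: Const_numeral)

lemma reduces_to_uminus: "reduces_to f g \<Longrightarrow> reduces_to (- f) (- g)"
  by (simp add: reduces_to_def r_uminus Zzeta_closed)

lemma reduces_to_diff: "reduces_to f g \<Longrightarrow> reduces_to f' g' \<Longrightarrow> reduces_to (f - f') (g - g')"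
  using reduces_to_add[OF _ reduces_to_uminus] by fastforce

lemma reduces_to_power: "reduces_to f g \<Longrightarrow> reduces_to (f ^ n) (g ^ n)"
  by (induction n) (auto intro: reduces_to_mult reduces_to_1)

lemmas reduces_to_intros = reduces_to_add reduces_to_diff reduces_to_uminus reduces_to_mult reduces_to_power
  reduces_to_Var reduces_to_1 reduces_to_numeral reduces_to_Const[OF Zzeta_closed(5)] reduces_to_0

lemma red_quartic: "red_poly P \<sigma> (quartic_poly \<zeta>) = quartic_poly z"
  unfolding quartic_poly_def quartic_def by (intro reduces_to_red_poly reduces_to_intros)

lemma red_cubics: "red_poly P \<sigma> (cubic_polys \<zeta> i) = cubic_polys z i"
proof -
  have "\<forall>i. reduces_to (cubic_polys \<zeta> i) (cubic_polys z i)"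
    unfolding forall_4 cubic_polys_def cubics_def tab4_simps
    by (intro conjI reduces_to_intros)
  then show ?thesis using reduces_to_red_poly by blast
qed

text \<open>
  Uniqueness: if \<open>x / 3\<^sup>k = a / 3\<^sup>l\<close>, then \<open>3\<^sup>l x = 3\<^sup>k a\<close> in \<open>\<int>[\<zeta>]\<close>, and 3 is invertible in
  \<open>'k\<close>.
\<close>

lemma red_third_frac: "red_third P \<sigma> (zfrac \<zeta> x) = zfrac z x"
  unfolding red_third_def
proof (rule the_equality)
  show "\<exists>a\<in>Zzeta. \<exists>k. zfrac \<zeta> x = a / 3 ^ k \<and> zfrac z x = r a / 3 ^ k"
    unfolding zfrac_def Zzeta_eq using r_ev by auto
  fix d assume "\<exists>a\<in>Zzeta. \<exists>k. zfrac \<zeta> x = a / 3 ^ k \<and> d = r a / 3 ^ k"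
  then obtain a k where a: "a \<in> Zzeta" "zfrac \<zeta> x = a / 3 ^ k" "d = r a / 3 ^ k" by blast
  have three: "r (3 ^ l) = 3 ^ l" "3 ^ l \<in> Zzeta" for l
    using r_of_int[of "3 ^ l"] Zzeta_closed(4)[of "3 ^ l"] by simp_all
  have "ev \<zeta> (fst x) * 3 ^ k = a * 3 ^ snd x" using a(2) by (simp add: zfrac_def field_simps)
  then have "r (ev \<zeta> (fst x) * 3 ^ k) = r (a * 3 ^ snd x)" by simp
  moreover have "ev \<zeta> (fst x) \<in> Zzeta" by (simp add: Zzeta_eq)
  ultimately have "ev z (fst x) * 3 ^ k = r a * 3 ^ snd x"
    using a(1) by (simp add: r_mult three r_ev)
  then show "d = zfrac z x" using K.three by (simp add: a(3) zfrac_def frac_eq_eq)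
qed

lemma frac_uminus: "- zfrac y x = zfrac y (- fst x, snd x)" by (simp add: zfrac_def)
lemma frac_0: "0 = zfrac y (Zeta 0 0 0 0, 0)" and frac_1: "1 = zfrac y (Zeta 1 0 0 0, 0)" by (simp_all add: zfrac_def)

lemma red_third_simps: "red_third P \<sigma> (zfrac \<zeta> x) = zfrac z x" "red_third P \<sigma> (- zfrac \<zeta> x) = - zfrac z x"
    "red_third P \<sigma> 0 = 0" "red_third P \<sigma> 1 = 1"
  subgoal by (rule red_third_frac)
  subgoal unfolding frac_uminus by (rule red_third_frac)
  subgoal using red_third_frac[of "(Zeta 0 0 0 0, 0)"] by (simp only: frac_0[symmetric])
  subgoal using red_third_frac[of "(Zeta 1 0 0 0, 0)"] by (simp only: frac_1[symmetric])
  done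

text \<open>
  The matrix of a line of the table over \<open>\<complex>\<close> reduces to the matrix of the line with the same
  entry of the table; so every line of the reduced surface lifts.
\<close>

lemma red_cell_matrix: "red_matrix P \<sigma> (cell_matrix (map_cell (zfrac \<zeta>) R)) = cell_matrix (map_cell (zfrac z) R)"
  unfolding red_matrix_def vec_eq_iff forall_2 forall_4
  by (cases R) (simp_all add: cell_matrix_def red_third_simps)

end

lemma frac_in_Zzeta_third: "zfrac \<zeta> x \<in> Zzeta_third" "- zfrac \<zeta> x \<in> Zzeta_third" "0 \<in> Zzeta_third" "1 \<in> Zzeta_third"
proof -
  show m: "zfrac \<zeta> x \<in> Zzeta_third" for x by (auto simp: Zzeta_third_def zfrac_def Zzeta_eq)
  show "- zfrac \<zeta> x \<in> Zzeta_third" using m[of "(- fst x, snd x)"] by (simp add: zfrac_def)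
  show "0 \<in> Zzeta_third" using m[of "(Zeta 0 0 0 0, 0)"] by (simp add: zfrac_def)
  show "1 \<in> Zzeta_third" using m[of "(Zeta 1 0 0 0, 0)"] by (simp add: zfrac_def)
qed

lemma cell_matrix_entries: "cell_matrix (map_cell (zfrac \<zeta>) R) $ i $ j \<in> Zzeta_third"
proof -
  have "\<forall>i j. cell_matrix (map_cell (zfrac \<zeta>) R) $ i $ j \<in> Zzeta_third"
    unfolding forall_2 forall_4 by (cases R) (simp_all add: cell_matrix_def frac_in_Zzeta_third)
  then show ?thesis by blast
qed

lemma rref_cell_matrix: "rref (cell_matrix C)"
proof -
  have sets: "{Suc 0..<2} = {1}" "{Suc 0..<3} = {1, 2}" "{Suc 0..<4} = {1, 2, 3}" by auto
  show ?thesis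
  proof (cases C)
    case (C12 a b c d)
    show ?thesis unfolding rref_def C12
      by (rule exI[of _ 1], rule exI[of _ 2], simp add: sets cell_matrix_def)
  next
    case (C13 a b c)
    show ?thesis unfolding rref_def C13
      by (rule exI[of _ 1], rule exI[of _ 3], simp add: sets cell_matrix_def)
  next
    case (C14 a b)
    show ?thesis unfolding rref_def C14
      by (rule exI[of _ 1], rule exI[of _ 4], simp add: sets cell_matrix_def)
  next
    case (C23 b c)
    show ?thesis unfolding rref_def C23
      by (rule exI[of _ 2], rule exI[of _ 3], simp add: sets cell_matrix_def)
  next
    case (C24 a)
    show ?thesis unfolding rref_def C24
      by (rule exI[of _ 2], rule exI[of _ 4], simp add: sets cell_matrix_def)
  qed
qed

lemma Psi_eq: "Psi = quartic_poly \<zeta>"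
proof -
  have "Const coeff_A = - 1 - 2 * Const \<zeta> - 2 * Const \<zeta> ^ 3" "Const coeff_B = 2 - 2 * Const \<zeta> - 2 * Const \<zeta> ^ 3"
    by (simp_all add: coeff_A_def coeff_B_def Const_add Const_diff Const_uminus Const_mult Const_power Const_numeral)
  then show ?thesis unfolding Psi_def quartic_poly_def quartic_def by simp
qed

lemma cubic_forms_eq: "cubic_forms = cubic_polys \<zeta>"
proof
  fix i
  have "\<forall>i. cubic_forms i = cubic_polys \<zeta> i"
    unfolding forall_4 cubic_forms_def cubic_polys_def cubics_def f1_def f2_def f3_def f4_def
    by (simp add: idx4_neq Const_add Const_diff Const_uminus Const_mult Const_power Const_numeral)
  then show "cubic_forms i = cubic_polys \<zeta> i" ..
qed

interpretation complex: eighth_root_closed \<zeta>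
proof unfold_locales
  show "\<exists>b. b ^ 2 = a" for a :: complex by (rule exI[of _ "csqrt a"]) simp
qed (simp_all add: zeta_4)

theorem theorem5p6:
  fixes p :: nat and P :: "complex set" and \<sigma> :: "complex set \<Rightarrow> 'k::field"
  assumes "Factorial_Ring.prime p" and "p > 3"
    and "primeideal P Zzeta_ring" and "lies_over P p"
    and "closure_of_residue_field P \<sigma>"
  shows "smooth_surface (red_poly P \<sigma> Psi)
    \<and> card {l. proj_line l \<and> l \<subseteq> surface (red_poly P \<sigma> Psi)} = 56
    \<and> (\<forall>l'. proj_line l' \<and> l' \<subseteq> surface (red_poly P \<sigma> Psi) \<longrightarrow>
          (\<exists>l. proj_line l \<and> l \<subseteq> surface Psi \<and> reduction_of_line P \<sigma> l l'))
    \<and> isomorphism_given_by (surface fermat) (surface Psi) cubic_forms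
    \<and> isomorphism_given_by (surface fermat) (surface (red_poly P \<sigma> Psi))
        (\<lambda>i. red_poly P \<sigma> (cubic_forms i))"
proof -
  interpret reduction P \<sigma> p by (rule reduction.intro) (fact assms)+
  have lines: "\<exists>l. proj_line l \<and> l \<subseteq> surface (quartic_poly \<zeta>) \<and> reduction_of_line P \<sigma> l l'"
    if l': "proj_line l'" "l' \<subseteq> surface (quartic_poly z)" for l'
  proof -
    obtain R where R: "R \<in> set line_table" "l' = cell_line (map_cell (zfrac z) R)"
      using K.line_classification[OF l'] by (auto simp: K.lines_def)
    let ?C = "map_cell (zfrac \<zeta>) R"
    have "reduction_of_line P \<sigma> (cell_line ?C) l'"
      unfolding reduction_of_line_def R(2) cell_line_def red_cell_matrix[symmetric]
      using rref_cell_matrix cell_matrix_entries by blast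
    moreover have "?C \<in> set complex.lines" using R(1) by (simp add: complex.lines_def)
    then have "cell_line ?C \<subseteq> surface (quartic_poly \<zeta>)" by (rule complex.lines_on_surface)
    ultimately show ?thesis using proj_line_cell by blast
  qed
  show ?thesis
    unfolding Psi_eq cubic_forms_eq red_quartic red_cubics
    using K.quartic_smooth K.card_lines_on_surface lines complex.cubics_give_isomorphism
      K.cubics_give_isomorphism by blast
qed

end
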